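(* Let $\Gamma$ be a discrete group having only finitely many finite subgroups up to conjugacy, and let $\mathcal{F}$ be a family of finite subgroups of $\Gamma$. Then $G_{\mathcal{F}}(\mathbb{C}[\Gamma])$ is free abelian of rank $n_{\mathcal{F}}(\Gamma)$, where $n_{\mathcal{F}}(\Gamma)$ denotes the number of distinct conjugacy classes of elements $\gamma\in\Gamma$ such that $\langle\gamma\rangle\in\mathcal{F}$.
   Context: A family $\mathcal{F}$ of finite subgroups of $\Gamma$ is a non-empty collection of finite subgroups of $\Gamma$ closed under conjugation and under taking subgroups. For a finite group $H$ and a field $\mathbb{K}$, $G(\mathbb{K}[H])$ is the Grothendieck ring of finitely generated $\mathbb{K}[H]$-modules (relations from short exact sequences; product given by $\otimes_{\mathbb{K}}$ with diagonal action). $G_{\mathcal{F}}(\mathbb{K}[\Gamma])=\varprojlim_{H\in\mathcal{F}} G(\mathbb{K}[H])$ is the subring of those $(x_H)\in\prod_{H\in\mathcal{F}}G(\mathbb{K}[H])$ such that (1) $\mathrm{res}^K_H(x_K)=x_H$ whenever $H\subseteq K$ are in $\mathcal{F}$, and (2) $C_\gamma^*(x_K)=x_H$ whenever $K=\gamma H\gamma^{-1}$, where $C_\gamma^*:G(\mathbb{K}[\gamma H\gamma^{-1}])\to G(\mathbb{K}[H])$ is induced by the homomorphism $H\to\gamma H\gamma^{-1}$, $h\mapsto \gamma h\gamma^{-1}$. *)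

theory Defs
  imports Complex_Main "HOL-Algebra.Free_Abelian_Groups" "HOL-Algebra.Group_Action"
    "HOL-Algebra.Generated_Groups" "HOL-Algebra.Module"
begin

section \<open>Group algebras and their finitely generated modules\<close>

text \<open>Elements of the group algebra are functions of finite support contained in the group;
  they vanish (rather than being undefined) off the carrier. Hence, for a subgroup \<open>H\<close> of \<open>K\<close>,
  the algebra of \<open>H\<close> is literally a subset of the algebra of \<open>K\<close>.\<close>

definition group_algebra :: "('g, 'x) monoid_scheme \<Rightarrow> ('g \<Rightarrow> 'k::field) ring" where
  "group_algebra G =
    \<lparr> carrier = {a. finite {g. a g \<noteq> 0} \<and> {g. a g \<noteq> 0} \<subseteq> carrier G},
      monoid.mult = (\<lambda>a b x. \<Sum>(g, h) \<in> {(g, h). a g \<noteq> 0 \<and> b h \<noteq> 0 \<and> g \<otimes>\<^bsub>G\<^esub> h = x}. a g * b h),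
      one = (\<lambda>x. if x = \<one>\<^bsub>G\<^esub> then 1 else 0),
      ring.zero = (\<lambda>x. 0),
      ring.add = (\<lambda>a b x. a x + b x) \<rparr>"

lemma group_algebra_mult:
  fixes a b :: "'g \<Rightarrow> 'k::field"
  assumes "finite A" "finite B" "{g. a g \<noteq> 0} \<subseteq> A" "{g. b g \<noteq> 0} \<subseteq> B"
  shows "(a \<otimes>\<^bsub>group_algebra G\<^esub> b) x = (\<Sum>g\<in>A. \<Sum>h\<in>B. if g \<otimes>\<^bsub>G\<^esub> h = x then a g * b h else 0)"
proof -
  have "(\<Sum>(g, h) \<in> {(g, h). a g \<noteq> 0 \<and> b h \<noteq> 0 \<and> g \<otimes>\<^bsub>G\<^esub> h = x}. a g * b h)
      = (\<Sum>(g, h) \<in> A \<times> B. if g \<otimes>\<^bsub>G\<^esub> h = x then a g * b h else 0)"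
    using assms by (intro sum.mono_neutral_cong_left) (auto split: if_splits)
  then show ?thesis
    by (simp add: group_algebra_def sum.cartesian_product)
qed

lemma ring_group_algebra:
  fixes G (structure)
  assumes "group G"
  shows "ring (group_algebra G :: ('g \<Rightarrow> 'k::field) ring)"
proof -
  interpret group G by fact
  let ?R = "group_algebra G :: ('g \<Rightarrow> 'k) ring"
  let ?s = "\<lambda>a::'g \<Rightarrow> 'k. {g. a g \<noteq> 0}"
  have car: "a \<in> carrier ?R \<longleftrightarrow> finite (?s a) \<and> ?s a \<subseteq> carrier G" for a
    by (simp add: group_algebra_def)
  have add: "a \<oplus>\<^bsub>?R\<^esub> b = (\<lambda>x. a x + b x)" for a b
    by (simp add: group_algebra_def)
  have zero: "\<zero>\<^bsub>?R\<^esub> = (\<lambda>x. 0)" and one: "\<one>\<^bsub>?R\<^esub> = (\<lambda>x. if x = \<one>\<^bsub>G\<^esub> then 1 else 0)"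
    by (simp_all add: group_algebra_def)
  have addc: "a \<oplus>\<^bsub>?R\<^esub> b \<in> carrier ?R" if "a \<in> carrier ?R" "b \<in> carrier ?R" for a b
  proof -
    have "?s (\<lambda>x. a x + b x) \<subseteq> ?s a \<union> ?s b" by auto
    with that show ?thesis unfolding car add
      by (meson finite_UnI finite_subset le_sup_iff subset_trans)
  qed
  have supp: "?s (a \<otimes>\<^bsub>?R\<^esub> b) \<subseteq> (\<lambda>(g,h). g \<otimes>\<^bsub>G\<^esub> h) ` (?s a \<times> ?s b)"
    if "a \<in> carrier ?R" "b \<in> carrier ?R" for a b
  proof
    fix x assume "x \<in> ?s (a \<otimes>\<^bsub>?R\<^esub> b)"
    then have "(\<Sum>(g, h) \<in> {(g, h). a g \<noteq> 0 \<and> b h \<noteq> 0 \<and> g \<otimes>\<^bsub>G\<^esub> h = x}. a g * b h) \<noteq> 0"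
      by (simp add: group_algebra_def)
    then obtain p where "p \<in> {(g, h). a g \<noteq> 0 \<and> b h \<noteq> 0 \<and> g \<otimes>\<^bsub>G\<^esub> h = x}"
      by (meson sum.not_neutral_contains_not_neutral)
    then show "x \<in> (\<lambda>(g,h). g \<otimes>\<^bsub>G\<^esub> h) ` (?s a \<times> ?s b)" by force
  qed
  have multc: "a \<otimes>\<^bsub>?R\<^esub> b \<in> carrier ?R" if "a \<in> carrier ?R" "b \<in> carrier ?R" for a b
  proof -
    have "finite ((\<lambda>(g,h). g \<otimes>\<^bsub>G\<^esub> h) ` (?s a \<times> ?s b))" 
      and "(\<lambda>(g,h). g \<otimes>\<^bsub>G\<^esub> h) ` (?s a \<times> ?s b) \<subseteq> carrier G" using that unfolding car by auto
    with supp[OF that] show ?thesis unfolding car by (meson finite_subset subset_trans)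
  qed
  have assoc: "(a \<otimes>\<^bsub>?R\<^esub> b) \<otimes>\<^bsub>?R\<^esub> c = a \<otimes>\<^bsub>?R\<^esub> (b \<otimes>\<^bsub>?R\<^esub> c)"
    if abc: "a \<in> carrier ?R" "b \<in> carrier ?R" "c \<in> carrier ?R" for a b c
  proof
    fix x
    define A B C where "A = ?s a" "B = ?s b" "C = ?s c"
    have fin: "finite A" "finite B" "finite C" and sub: "A \<subseteq> carrier G" "B \<subseteq> carrier G" "C \<subseteq> carrier G"
      using abc unfolding car A_B_C_def by auto
    let ?AB = "(\<lambda>(g,h). g \<otimes>\<^bsub>G\<^esub> h) ` (A \<times> B)" and ?BC = "(\<lambda>(g,h). g \<otimes>\<^bsub>G\<^esub> h) ` (B \<times> C)"
    have "((a \<otimes>\<^bsub>?R\<^esub> b) \<otimes>\<^bsub>?R\<^esub> c) x = (\<Sum>y\<in>?AB. \<Sum>k\<in>C. if y \<otimes> k = x then (a \<otimes>\<^bsub>?R\<^esub> b) y * c k else 0)"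
      using fin supp[of a b] abc by (intro group_algebra_mult) (auto simp: A_B_C_def)
    also have "\<dots> = (\<Sum>y\<in>?AB. \<Sum>k\<in>C. if y \<otimes> k = x then (\<Sum>g\<in>A. \<Sum>h\<in>B. if g \<otimes>\<^bsub>G\<^esub> h = y then a g * b h else 0) * c k else 0)"
      using fin by (subst group_algebra_mult[of A B]) (auto simp: A_B_C_def)
    also have "\<dots> = (\<Sum>y\<in>?AB. \<Sum>k\<in>C. \<Sum>g\<in>A. \<Sum>h\<in>B. if g \<otimes> h = y then if y \<otimes> k = x then a g * b h * c k else 0 else 0)"
      by (intro sum.cong refl) (simp add: sum_distrib_right if_distrib[of "\<lambda>z. z * _"] split: if_split cong: sum.cong if_cong)
    also have "\<dots> = (\<Sum>k\<in>C. \<Sum>g\<in>A. \<Sum>h\<in>B. \<Sum>y\<in>?AB. if g \<otimes> h = y then if y \<otimes> k = x then a g * b h * c k else 0 else 0)"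
      by (subst sum.swap, rule sum.cong[OF refl], subst sum.swap, rule sum.cong[OF refl], rule sum.swap)
    also have "\<dots> = (\<Sum>k\<in>C. \<Sum>g\<in>A. \<Sum>h\<in>B. if (g \<otimes> h) \<otimes> k = x then a g * b h * c k else 0)"
      using fin by (intro sum.cong refl) (subst sum.delta', auto)
    also have "\<dots> = (\<Sum>g\<in>A. \<Sum>h\<in>B. \<Sum>k\<in>C. if g \<otimes> (h \<otimes> k) = x then a g * b h * c k else 0)"
      using sub by (subst sum.swap, rule_tac sum.cong[OF refl], subst sum.swap, rule_tac sum.cong[OF refl]) (auto simp: m_assoc subset_iff intro!: sum.cong)
    also have "\<dots> = (\<Sum>g\<in>A. \<Sum>h\<in>B. \<Sum>k\<in>C. \<Sum>y\<in>?BC. if h \<otimes> k = y then if g \<otimes> y = x then a g * b h * c k else 0 else 0)"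
      using fin by (intro sum.cong refl) (subst sum.delta', auto)
    also have "\<dots> = (\<Sum>g\<in>A. \<Sum>y\<in>?BC. \<Sum>h\<in>B. \<Sum>k\<in>C. if h \<otimes> k = y then if g \<otimes> y = x then a g * b h * c k else 0 else 0)"
      by (rule sum.cong[OF refl], subst (2) sum.swap, rule sum.cong[OF refl], rule sum.swap)
    also have "\<dots> = (\<Sum>g\<in>A. \<Sum>y\<in>?BC. if g \<otimes> y = x then a g * (\<Sum>h\<in>B. \<Sum>k\<in>C. if h \<otimes> k = y then b h * c k else 0) else 0)"
      by (intro sum.cong refl) (simp add: sum_distrib_left mult.assoc if_distrib[of "(*) _"] split: if_split cong: sum.cong if_cong)
    also have "\<dots> = (\<Sum>g\<in>A. \<Sum>y\<in>?BC. if g \<otimes> y = x then a g * (b \<otimes>\<^bsub>?R\<^esub> c) y else 0)"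
      using fin by (subst group_algebra_mult[of B C b c]) (auto simp: A_B_C_def)
    also have "\<dots> = (a \<otimes>\<^bsub>?R\<^esub> (b \<otimes>\<^bsub>?R\<^esub> c)) x"
      using fin supp[of b c] abc by (intro group_algebra_mult[symmetric]) (auto simp: A_B_C_def)
    finally show "((a \<otimes>\<^bsub>?R\<^esub> b) \<otimes>\<^bsub>?R\<^esub> c) x = (a \<otimes>\<^bsub>?R\<^esub> (b \<otimes>\<^bsub>?R\<^esub> c)) x" .
  qed
  have onec: "\<one>\<^bsub>?R\<^esub> \<in> carrier ?R" unfolding car one by auto
  have lone: "\<one>\<^bsub>?R\<^esub> \<otimes>\<^bsub>?R\<^esub> a = a" if "a \<in> carrier ?R" for a
  proof
    fix x
    have f: "finite (?s a)" "?s a \<subseteq> carrier G" using that unfolding car by auto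
    have "(\<one>\<^bsub>?R\<^esub> \<otimes>\<^bsub>?R\<^esub> a) x = (\<Sum>h\<in>?s a. if \<one> \<otimes> h = x then \<one>\<^bsub>?R\<^esub> \<one> * a h else 0)"
      using group_algebra_mult[of "{\<one>}" "?s a" "\<one>\<^bsub>?R\<^esub>" a G x] f by (auto simp: one)
    also have "\<dots> = (\<Sum>h\<in>?s a. if h = x then a h else 0)"
      using f by (intro sum.cong refl) (auto simp: one subset_iff)
    finally have "(\<one>\<^bsub>?R\<^esub> \<otimes>\<^bsub>?R\<^esub> a) x = (\<Sum>h\<in>?s a. if h = x then a h else 0)" .
    then show "(\<one>\<^bsub>?R\<^esub> \<otimes>\<^bsub>?R\<^esub> a) x = a x" using that unfolding car by (simp add: sum.delta)
  qed
  have rone: "a \<otimes>\<^bsub>?R\<^esub> \<one>\<^bsub>?R\<^esub> = a" if "a \<in> carrier ?R" for a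
  proof
    fix x
    have f: "finite (?s a)" "?s a \<subseteq> carrier G" using that unfolding car by auto
    have "(a \<otimes>\<^bsub>?R\<^esub> \<one>\<^bsub>?R\<^esub>) x = (\<Sum>h\<in>?s a. if h \<otimes> \<one> = x then a h * \<one>\<^bsub>?R\<^esub> \<one> else 0)"
      using group_algebra_mult[of "?s a" "{\<one>}" a "\<one>\<^bsub>?R\<^esub>" G x] f by (auto simp: one)
    also have "\<dots> = (\<Sum>h\<in>?s a. if h = x then a h else 0)"
      using f by (intro sum.cong refl) (auto simp: one subset_iff)
    finally have "(a \<otimes>\<^bsub>?R\<^esub> \<one>\<^bsub>?R\<^esub>) x = (\<Sum>h\<in>?s a. if h = x then a h else 0)" .
    then show "(a \<otimes>\<^bsub>?R\<^esub> \<one>\<^bsub>?R\<^esub>) x = a x" using that unfolding car by (simp add: sum.delta)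
  qed
  have ld: "(a \<oplus>\<^bsub>?R\<^esub> b) \<otimes>\<^bsub>?R\<^esub> c = (a \<otimes>\<^bsub>?R\<^esub> c) \<oplus>\<^bsub>?R\<^esub> (b \<otimes>\<^bsub>?R\<^esub> c)"
    if "a \<in> carrier ?R" "b \<in> carrier ?R" "c \<in> carrier ?R" for a b c
  proof
    fix x
    let ?A = "?s a \<union> ?s b"
    have f: "finite ?A" "finite (?s c)" using that unfolding car by auto
    have *: "(d \<otimes>\<^bsub>?R\<^esub> c) x = (\<Sum>g\<in>?A. \<Sum>h\<in>?s c. if g \<otimes>\<^bsub>G\<^esub> h = x then d g * c h else 0)" if "?s d \<subseteq> ?A" for d
      using f that by (intro group_algebra_mult) auto
    have **: "?s a \<subseteq> ?A" "?s b \<subseteq> ?A" "?s (\<lambda>x. a x + b x) \<subseteq> ?A" by auto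
    show "((a \<oplus>\<^bsub>?R\<^esub> b) \<otimes>\<^bsub>?R\<^esub> c) x = ((a \<otimes>\<^bsub>?R\<^esub> c) \<oplus>\<^bsub>?R\<^esub> (b \<otimes>\<^bsub>?R\<^esub> c)) x"
      unfolding add *[OF **(1)] *[OF **(2)] *[OF **(3)] sum.distrib[symmetric]
      by (intro sum.cong refl) (auto simp: algebra_simps)
  qed
  have rd: "c \<otimes>\<^bsub>?R\<^esub> (a \<oplus>\<^bsub>?R\<^esub> b) = (c \<otimes>\<^bsub>?R\<^esub> a) \<oplus>\<^bsub>?R\<^esub> (c \<otimes>\<^bsub>?R\<^esub> b)"
    if "a \<in> carrier ?R" "b \<in> carrier ?R" "c \<in> carrier ?R" for a b c
  proof
    fix x
    let ?A = "?s a \<union> ?s b"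
    have f: "finite ?A" "finite (?s c)" using that unfolding car by auto
    have *: "(c \<otimes>\<^bsub>?R\<^esub> d) x = (\<Sum>g\<in>?s c. \<Sum>h\<in>?A. if g \<otimes>\<^bsub>G\<^esub> h = x then c g * d h else 0)" if "?s d \<subseteq> ?A" for d
      using f that by (intro group_algebra_mult) auto
    have **: "?s a \<subseteq> ?A" "?s b \<subseteq> ?A" "?s (\<lambda>x. a x + b x) \<subseteq> ?A" by auto
    show "(c \<otimes>\<^bsub>?R\<^esub> (a \<oplus>\<^bsub>?R\<^esub> b)) x = ((c \<otimes>\<^bsub>?R\<^esub> a) \<oplus>\<^bsub>?R\<^esub> (c \<otimes>\<^bsub>?R\<^esub> b)) x"
      unfolding add *[OF **(1)] *[OF **(2)] *[OF **(3)] sum.distrib[symmetric]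
      by (intro sum.cong refl) (auto simp: algebra_simps)
  qed
  show ?thesis
  proof (rule ringI)
    show "abelian_group ?R"
    proof (rule abelian_groupI)
      fix a assume a: "a \<in> carrier ?R"
      show "\<exists>b\<in>carrier ?R. b \<oplus>\<^bsub>?R\<^esub> a = \<zero>\<^bsub>?R\<^esub>"
        by (rule bexI[of _ "\<lambda>x. - a x"]) (use a in \<open>auto simp: car add zero\<close>)
    qed (auto simp: addc, auto simp: add zero car add.assoc add.commute)
    show "monoid ?R" by (rule monoidI) (auto simp: multc onec assoc lone rone)
  qed (auto simp: ld rd)
qed

text \<open>The linear extension of a map of groups: \<open>\<Sum> a\<^sub>h h\<close> goes to \<open>\<Sum> a\<^sub>h \<phi>(h)\<close>.\<close>

definition group_algebra_map :: "('g \<Rightarrow> 'h) \<Rightarrow> ('g \<Rightarrow> 'k::field) \<Rightarrow> ('h \<Rightarrow> 'k)" where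
  "group_algebra_map \<phi> a = (\<lambda>y. \<Sum>x \<in> {x. a x \<noteq> 0 \<and> \<phi> x = y}. a x)"

text \<open>The library's locale \<open>module\<close> requires a commutative ring of scalars, so its axioms
  are repeated here for an arbitrary ring. The fields \<open>mult\<close> and \<open>one\<close> that a
  module record inherits from the record type of rings carry no meaning.\<close>

locale left_module = R?: ring R + M?: abelian_group M
  for R :: "('r, 'x) ring_scheme" (structure) and M :: "('r, 'm, 'y) module_scheme" (structure) +
  assumes smult_closed:
      "\<lbrakk>a \<in> carrier R; x \<in> carrier M\<rbrakk> \<Longrightarrow> a \<odot>\<^bsub>M\<^esub> x \<in> carrier M"
    and smult_l_distr:
      "\<lbrakk>a \<in> carrier R; b \<in> carrier R; x \<in> carrier M\<rbrakk> \<Longrightarrow>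
        (a \<oplus>\<^bsub>R\<^esub> b) \<odot>\<^bsub>M\<^esub> x = a \<odot>\<^bsub>M\<^esub> x \<oplus>\<^bsub>M\<^esub> b \<odot>\<^bsub>M\<^esub> x"
    and smult_r_distr:
      "\<lbrakk>a \<in> carrier R; x \<in> carrier M; y \<in> carrier M\<rbrakk> \<Longrightarrow>
        a \<odot>\<^bsub>M\<^esub> (x \<oplus>\<^bsub>M\<^esub> y) = a \<odot>\<^bsub>M\<^esub> x \<oplus>\<^bsub>M\<^esub> a \<odot>\<^bsub>M\<^esub> y"
    and smult_assoc1:
      "\<lbrakk>a \<in> carrier R; b \<in> carrier R; x \<in> carrier M\<rbrakk> \<Longrightarrow>
        (a \<otimes>\<^bsub>R\<^esub> b) \<odot>\<^bsub>M\<^esub> x = a \<odot>\<^bsub>M\<^esub> (b \<odot>\<^bsub>M\<^esub> x)"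
    and smult_one: "x \<in> carrier M \<Longrightarrow> \<one>\<^bsub>R\<^esub> \<odot>\<^bsub>M\<^esub> x = x"

definition finitely_generated_module ::
    "('r, 'x) ring_scheme \<Rightarrow> ('r, 'm, 'y) module_scheme \<Rightarrow> bool" where
  "finitely_generated_module R M \<longleftrightarrow> left_module R M \<and>
    (\<exists>S. finite S \<and> S \<subseteq> carrier M \<and>
      (\<forall>x \<in> carrier M. \<exists>c \<in> S \<rightarrow> carrier R. x = (\<Oplus>\<^bsub>M\<^esub>s\<in>S. c s \<odot>\<^bsub>M\<^esub> s)))"

definition module_homs ::
    "('r, 'x) ring_scheme \<Rightarrow> ('r, 'm, 'y) module_scheme \<Rightarrow> ('r, 'n, 'z) module_scheme \<Rightarrow> ('m \<Rightarrow> 'n) set" where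
  "module_homs R M N = {f \<in> carrier M \<rightarrow> carrier N.
    (\<forall>x \<in> carrier M. \<forall>y \<in> carrier M. f (x \<oplus>\<^bsub>M\<^esub> y) = f x \<oplus>\<^bsub>N\<^esub> f y) \<and>
    (\<forall>a \<in> carrier R. \<forall>x \<in> carrier M. f (a \<odot>\<^bsub>M\<^esub> x) = a \<odot>\<^bsub>N\<^esub> f x)}"

text \<open>Existence of a short exact sequence \<open>0 \<rightarrow> L \<rightarrow> M \<rightarrow> N \<rightarrow> 0\<close>.\<close>

definition short_exact ::
    "('r, 'x) ring_scheme \<Rightarrow> ('r, 'l, 'y) module_scheme \<Rightarrow> ('r, 'm, 'z) module_scheme \<Rightarrow>
      ('r, 'n, 'w) module_scheme \<Rightarrow> bool" where
  "short_exact R L M N \<longleftrightarrow> (\<exists>f \<in> module_homs R L M. \<exists>g \<in> module_homs R M N.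
    inj_on f (carrier L) \<and> g ` carrier M = carrier N \<and>
    f ` carrier L = {x \<in> carrier M. g x = \<zero>\<^bsub>N\<^esub>})"

section \<open>Grothendieck groups\<close>

text \<open>The modules are those whose underlying set lives in a given type \<open>'m\<close>. Isomorphic
  modules are identified by the relations, as \<open>0 \<rightarrow> L \<rightarrow> M \<rightarrow> 0 \<rightarrow> 0\<close> and \<open>0 \<rightarrow> 0 \<rightarrow> 0 \<rightarrow> 0 \<rightarrow> 0\<close> are
  short exact sequences.\<close>

definition fg_modules :: "('r, 'x) ring_scheme \<Rightarrow> ('r, 'm) module set" where
  "fg_modules R = {M. finitely_generated_module R M}"

definition exact_relations :: "('r, 'x) ring_scheme \<Rightarrow> (('r, 'm) module \<Rightarrow>\<^sub>0 int) set" where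
  "exact_relations R = {frag_of M - (frag_of L + frag_of N) | L M N.
    L \<in> fg_modules R \<and> M \<in> fg_modules R \<and> N \<in> fg_modules R \<and> short_exact R L M N}"

definition exact_subgroup :: "('r, 'x) ring_scheme \<Rightarrow> (('r, 'm) module \<Rightarrow>\<^sub>0 int) set" where
  "exact_subgroup R = generate (free_Abelian_group (fg_modules R)) (exact_relations R)"

definition grothendieck_group :: "('r, 'x) ring_scheme \<Rightarrow> (('r, 'm) module \<Rightarrow>\<^sub>0 int) set monoid" where
  "grothendieck_group R = free_Abelian_group (fg_modules R) Mod exact_subgroup R"

text \<open>For a finite group \<open>H\<close> and a field \<open>\<bbbK>\<close>, a finitely generated \<open>\<bbbK>[H]\<close>-module is in bijection
  with some \<open>\<bbbK>\<^sup>n\<close>, that is, with the functions \<open>nat \<Rightarrow> 'k\<close> vanishing from \<open>n\<close> on. So every such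
  module is isomorphic to one with underlying set in \<open>nat \<Rightarrow> 'k\<close>. Only the
  additive group of the Grothendieck ring is built, without the product given by \<open>\<otimes>\<close> over \<open>\<bbbK>\<close>:
  neither the compatible families below nor being free abelian involve the product.\<close>

type_synonym ('g, 'k) rep_module = "('g \<Rightarrow> 'k, nat \<Rightarrow> 'k) module"
type_synonym ('g, 'k) rep_class = "(('g, 'k) rep_module \<Rightarrow>\<^sub>0 int) set"

definition rep_group :: "('g, 'x) monoid_scheme \<Rightarrow> ('g, 'k::field) rep_class monoid" where
  "rep_group H = grothendieck_group (group_algebra H)"

definition pullback_module ::
    "('g \<Rightarrow> 'h) \<Rightarrow> ('h, 'k::field) rep_module \<Rightarrow> ('g, 'k) rep_module" where
  "pullback_module \<phi> M =
    \<lparr> carrier = carrier M, monoid.mult = monoid.mult M, one = one M,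
      ring.zero = ring.zero M, ring.add = ring.add M,
      smult = (\<lambda>a x. group_algebra_map \<phi> a \<odot>\<^bsub>M\<^esub> x) \<rparr>"

text \<open>The map \<open>\<phi>\<^sup>*\<close> from the Grothendieck group of the target of \<open>\<phi>\<close> to that of its source \<open>H\<close>,
  sending \<open>[M]\<close> to \<open>[\<phi>\<^sup>*M]\<close>. A class is a coset of formal combinations; the union below
  runs over its representatives, all of which yield the same coset.\<close>

definition rep_pullback ::
    "('g, 'x) monoid_scheme \<Rightarrow> ('g \<Rightarrow> 'h) \<Rightarrow> ('h, 'k::field) rep_class \<Rightarrow> ('g, 'k) rep_class" where
  "rep_pullback H \<phi> X =
    (\<Union>p\<in>X. r_coset (free_Abelian_group (fg_modules (group_algebra H)))
      (exact_subgroup (group_algebra H)) (frag_extend (\<lambda>M. frag_of (pullback_module \<phi> M)) p))"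

section \<open>Families of finite subgroups\<close>

definition family_of_finite_subgroups :: "('g, 'x) monoid_scheme \<Rightarrow> 'g set set \<Rightarrow> bool" where
  "family_of_finite_subgroups G F \<longleftrightarrow>
    F \<noteq> {} \<and>
    (\<forall>H \<in> F. subgroup H G \<and> finite H) \<and>
    (\<forall>H \<in> F. \<forall>\<gamma> \<in> carrier G. \<gamma> <#\<^bsub>G\<^esub> H #>\<^bsub>G\<^esub> inv\<^bsub>G\<^esub> \<gamma> \<in> F) \<and>
    (\<forall>H \<in> F. \<forall>L. subgroup L G \<and> L \<subseteq> H \<longrightarrow> L \<in> F)"

definition finitely_many_finite_subgroups_up_to_conj :: "('g, 'x) monoid_scheme \<Rightarrow> bool" where
  "finitely_many_finite_subgroups_up_to_conj G \<longleftrightarrow>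
    finite (orbits G {H. subgroup H G \<and> finite H} (\<lambda>\<gamma> H. \<gamma> <#\<^bsub>G\<^esub> H #>\<^bsub>G\<^esub> inv\<^bsub>G\<^esub> \<gamma>))"

text \<open>The conjugacy classes of elements \<open>\<gamma>\<close> with \<open>\<langle>\<gamma>\<rangle>\<close> in the family.\<close>

definition family_conj_classes :: "('g, 'x) monoid_scheme \<Rightarrow> 'g set set \<Rightarrow> 'g set set" where
  "family_conj_classes G F =
    orbits G {\<gamma> \<in> carrier G. generate G {\<gamma>} \<in> F} (\<lambda>\<delta> \<gamma>. \<delta> \<otimes>\<^bsub>G\<^esub> \<gamma> \<otimes>\<^bsub>G\<^esub> inv\<^bsub>G\<^esub> \<delta>)"

text \<open>The additive group of the inverse limit \<open>G\<^sub>F(\<bbbK>[\<Gamma>])\<close>, with \<open>\<bbbK>\<close> given by the type argument.\<close>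

definition family_rep_group ::
    "'k::field itself \<Rightarrow> ('g, 'x) monoid_scheme \<Rightarrow> 'g set set \<Rightarrow> ('g set \<Rightarrow> ('g, 'k) rep_class) monoid" where
  "family_rep_group _ G F =
    (let P = product_group F (\<lambda>H. rep_group (G\<lparr>carrier := H\<rparr>)) in
     P\<lparr>carrier := {x \<in> carrier P.
       (\<forall>H \<in> F. \<forall>K \<in> F. H \<subseteq> K \<longrightarrow> rep_pullback (G\<lparr>carrier := H\<rparr>) (\<lambda>h. h) (x K) = x H) \<and>
       (\<forall>H \<in> F. \<forall>K \<in> F. \<forall>\<gamma> \<in> carrier G. K = \<gamma> <#\<^bsub>G\<^esub> H #>\<^bsub>G\<^esub> inv\<^bsub>G\<^esub> \<gamma> \<longrightarrow>
         rep_pullback (G\<lparr>carrier := H\<rparr>) (\<lambda>h. \<gamma> \<otimes>\<^bsub>G\<^esub> h \<otimes>\<^bsub>G\<^esub> inv\<^bsub>G\<^esub> \<gamma>) (x K) = x H)}\<rparr>)"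

definition free_abelian_of_rank :: "('a, 'x) monoid_scheme \<Rightarrow> nat \<Rightarrow> bool" where
  "free_abelian_of_rank A n \<longleftrightarrow> comm_group A \<and> A \<cong> free_Abelian_group {..<n}"

end

theory Submission
  imports Defs "HOL-Library.Function_Algebras" "HOL-Algebra.Multiplicative_Group"
    "HOL-Number_Theory.Cong"
begin

text \<open>Every finitely generated \<open>\<complex>[H]\<close>-module is described by matrices, and its character is the trace. Two modules with
  the same character have the same class: their characters have a positive inner product, so averaging yields a
  nonzero homomorphism between them, a common summand splits off, and the dimension drops. Hence the Grothendieck group
  is the group of virtual characters, and the inverse limit is the group \<open>A\<close> of class functions on
  \<open>{\<gamma>. \<langle>\<gamma>\<rangle> \<in> F}\<close> that restrict to a virtual character on every member of \<open>F\<close>.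

  The multiplicities of the eigenvalues of the elements \<open>\<gamma>\<close> are linear functionals that are integral on \<open>A\<close> and jointly
  injective, so \<open>A\<close> has a \<open>\<int>\<close>-basis that is linearly independent over \<open>\<complex>\<close>. Its size is the number of classes because \<open>A\<close>
  spans all class functions: sums of characters induced from cyclic subgroups, supported on generators of these,
  fit together over \<open>F\<close>.\<close>

section \<open>Matrices as operators on sequences\<close>

text \<open>The delicate point is to match characters over \<open>F\<close>. A character induced
  from a cyclic subgroup to \<open>H\<close> is in general not the restriction of the one induced to
  a larger \<open>K\<close>: conjugates outside \<open>H\<close> contribute, and the normalisation
  involves the order of the group. Both effects disappear if k contributes at h only through h = k^t
  with t coprime to a common exponent \<open>m\<close>. Then k is itself a power of h, hence lies in
  every member of \<open>F\<close> that contains h, and a common multiple \<open>m\<close> of all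
  orders evens out the factors. Finiteness up to conjugacy provides \<open>m\<close>.

  Positivity of the inner product rests on \<chi>(h^-1) being the complex conjugate of \<chi>(h).
  This follows because eigenvalue multiplicities are traces of idempotents, hence natural numbers;
  the same computation yields the integral functionals on the lattice.

  Spanning alone would not determine the rank: a subgroup such as \<int> + \<int> sqrt 2 of
  \<complex> has rank 2 inside a line. Complex-linear functionals with integral values exclude
  this.\<close>

definition scl :: "complex \<Rightarrow> (nat \<Rightarrow> complex) \<Rightarrow> nat \<Rightarrow> complex" where
  "scl c v = (\<lambda>i. c * v i)"

definition unit_vec :: "nat \<Rightarrow> nat \<Rightarrow> complex" where
  "unit_vec i = (\<lambda>j. if j = i then 1 else 0)"

lemma scl_apply [simp]: "scl c v i = c * v i"
  by (simp add: scl_def)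

lemma unit_vec_apply [simp]: "unit_vec i j = (if j = i then 1 else 0)"
  by (simp add: unit_vec_def)

lemma sum_fun_apply [simp]: "(\<Sum>a\<in>A. f a) x = (\<Sum>a\<in>A. f a x)"
  by (induction A rule: infinite_finite_induct) auto

interpretation cvec: vector_space scl
  by unfold_locales (auto simp: fun_eq_iff algebra_simps)

interpretation cvec2: vector_space_pair scl scl
  by unfold_locales

text \<open>Square matrices of size \<open>n\<close>, as operators on sequences that only involve the first \<open>n\<close> entries.\<close>

definition fin_op :: "nat \<Rightarrow> ((nat \<Rightarrow> complex) \<Rightarrow> nat \<Rightarrow> complex) \<Rightarrow> bool" where
  "fin_op n T \<longleftrightarrow> (\<forall>u v. T (u + v) = T u + T v) \<and> (\<forall>c v. T (scl c v) = scl c (T v)) \<and>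
     (\<forall>v. \<forall>i\<ge>n. T v i = 0) \<and> (\<forall>v. T (\<lambda>i. if i < n then v i else 0) = T v)"

text \<open>Summing over the nonzero diagonal entries avoids a reference to the size, so that
  enlarging \<open>n\<close> does not change the trace. For a \<open>fin_op\<close> the index set is
  finite and \<open>op_trace_eq\<close> gives the usual formula.\<close>

definition op_trace :: "((nat \<Rightarrow> complex) \<Rightarrow> nat \<Rightarrow> complex) \<Rightarrow> complex" where
  "op_trace T = (\<Sum>i | T (unit_vec i) i \<noteq> 0. T (unit_vec i) i)"

lemma fin_op_linear: "fin_op n T \<Longrightarrow> Vector_Spaces.linear scl scl T"
  unfolding Vector_Spaces.linear_iff fin_op_def using cvec.vector_space_axioms by blast

lemma fin_op_add: "fin_op n T \<Longrightarrow> T (u + v) = T u + T v"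
  and fin_op_scl: "fin_op n T \<Longrightarrow> T (scl c v) = scl c (T v)"
  and fin_op_beyond: "fin_op n T \<Longrightarrow> i \<ge> n \<Longrightarrow> T v i = 0"
  by (auto simp: fin_op_def)

lemma fin_op_0: "fin_op n T \<Longrightarrow> T 0 = 0"
  using fin_op_add[of n T 0 0] by simp

lemma fin_op_diff: "fin_op n T \<Longrightarrow> T (u - v) = T u - T v"
  using fin_op_add[of n T "u - v" v] by (simp add: algebra_simps)

lemma fin_op_sum: "fin_op n T \<Longrightarrow> T (\<Sum>a\<in>A. f a) = (\<Sum>a\<in>A. T (f a))"
  by (induction A rule: infinite_finite_induct) (auto simp: fin_op_0 fin_op_add)

lemma truncate_eq_sum: "(\<lambda>i. if i < n then v i else 0) = (\<Sum>j<n. scl (v j) (unit_vec j))"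
proof
  fix i
  have "(\<Sum>j<n. v j * (if i = j then 1 else 0)) = (if i < n then v i else 0)"
    by (simp add: if_distrib[of "(*) _"] cong: if_cong)
  then show "(if i < n then v i else 0) = (\<Sum>j<n. scl (v j) (unit_vec j)) i"
    by simp
qed

lemma fin_op_expand:
  assumes "fin_op n T"
  shows "T v = (\<Sum>j<n. scl (v j) (T (unit_vec j)))"
proof -
  have "T v = T (\<lambda>i. if i < n then v i else 0)"
    using assms by (simp add: fin_op_def)
  then show ?thesis
    unfolding truncate_eq_sum fin_op_sum[OF assms] fin_op_scl[OF assms] .
qed

lemma fin_op_cong:
  assumes "fin_op n T" "\<And>i. i < n \<Longrightarrow> u i = v i"
  shows "T u = T v"
  unfolding fin_op_expand[OF assms(1), of u] fin_op_expand[OF assms(1), of v] using assms(2) by simp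

text \<open>Padding by zeros; it lets operators of different sizes be compared within one common
  size.\<close>

lemma fin_op_mono:
  assumes "fin_op n T" "n \<le> n'"
  shows "fin_op n' T"
  unfolding fin_op_def
proof (intro conjI allI impI)
  show "T (\<lambda>i. if i < n' then v i else 0) = T v" for v
    using assms(2) by (intro fin_op_cong[OF assms(1)]) auto
qed (use assms in \<open>auto simp: fin_op_add fin_op_scl fin_op_beyond\<close>)

lemma op_trace_eq:
  assumes "fin_op n T"
  shows "op_trace T = (\<Sum>i<n. T (unit_vec i) i)"
  unfolding op_trace_def using assms
  by (intro sum.mono_neutral_left) (auto simp: fin_op_beyond not_le[symmetric] intro: ccontr)

lemma fin_op_comp: "fin_op n S \<Longrightarrow> fin_op n T \<Longrightarrow> fin_op n (\<lambda>v. S (T v))"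
  unfolding fin_op_def by auto

lemma fin_op_plus: "fin_op n S \<Longrightarrow> fin_op n T \<Longrightarrow> fin_op n (\<lambda>v. S v + T v)"
  unfolding fin_op_def by (auto simp: fun_eq_iff algebra_simps)

lemma fin_op_minus: "fin_op n S \<Longrightarrow> fin_op n T \<Longrightarrow> fin_op n (\<lambda>v. S v - T v)"
  unfolding fin_op_def by (auto simp: fun_eq_iff algebra_simps)

lemma fin_op_scaled: "fin_op n T \<Longrightarrow> fin_op n (\<lambda>v. scl c (T v))"
  unfolding fin_op_def by (auto simp: fun_eq_iff algebra_simps)

lemma fin_op_zero: "fin_op n (\<lambda>v. 0)"
  unfolding fin_op_def by auto

lemma fin_op_summed: "(\<And>a. a \<in> A \<Longrightarrow> fin_op n (T a)) \<Longrightarrow> fin_op n (\<lambda>v. \<Sum>a\<in>A. T a v)"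
  by (induction A rule: infinite_finite_induct) (auto simp: fin_op_zero fin_op_plus)

lemma op_trace_plus: "fin_op n S \<Longrightarrow> fin_op n T \<Longrightarrow> op_trace (\<lambda>v. S v + T v) = op_trace S + op_trace T"
  by (simp add: op_trace_eq[of n] fin_op_plus sum.distrib)

lemma op_trace_minus: "fin_op n S \<Longrightarrow> fin_op n T \<Longrightarrow> op_trace (\<lambda>v. S v - T v) = op_trace S - op_trace T"
  by (simp add: op_trace_eq[of n] fin_op_minus sum_subtractf)

lemma op_trace_scaled: "fin_op n T \<Longrightarrow> op_trace (\<lambda>v. scl c (T v)) = c * op_trace T"
  by (simp add: op_trace_eq[of n] fin_op_scaled sum_distrib_left)

lemma op_trace_zero: "op_trace (\<lambda>v. 0) = 0"
  by (simp add: op_trace_def)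

lemma op_trace_summed:
  "(\<And>a. a \<in> A \<Longrightarrow> fin_op n (T a)) \<Longrightarrow> op_trace (\<lambda>v. \<Sum>a\<in>A. T a v) = (\<Sum>a\<in>A. op_trace (T a))"
  by (induction A rule: infinite_finite_induct) (auto simp: op_trace_zero op_trace_plus[of n] fin_op_summed)

lemma op_trace_comm:
  assumes "fin_op n S" "fin_op n T"
  shows "op_trace (\<lambda>v. S (T v)) = op_trace (\<lambda>v. T (S v))"
proof -
  have *: "op_trace (\<lambda>v. S (T v)) = (\<Sum>i<n. \<Sum>j<n. T (unit_vec i) j * S (unit_vec j) i)"
    if "fin_op n S" "fin_op n T" for S T
  proof -
    have "S (T (unit_vec i)) i = (\<Sum>j<n. T (unit_vec i) j * S (unit_vec j) i)" for i
      using fin_op_expand[OF that(1), of "T (unit_vec i)"] by simp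
    then show ?thesis
      by (simp add: op_trace_eq[OF fin_op_comp[OF that]])
  qed
  show ?thesis
    unfolding *[OF assms] *[OF assms(2,1)] by (subst sum.swap) (simp add: mult.commute)
qed

text \<open>Computed in a basis \<open>B\<close> of the range, where \<open>P\<close> fixes every
  basis vector, the trace is the number of elements of \<open>B\<close>. This is the source of all
  integrality below; the case \<open>k = 0\<close> is what makes dimension arguments
  terminate.\<close>

lemma op_trace_idempotent:
  assumes P: "fin_op n P" and idem: "\<And>v. P (P v) = P v"
  obtains k :: nat where "op_trace P = of_nat k" "k = 0 \<Longrightarrow> P = (\<lambda>v. 0)"
proof -
  obtain B where B: "B \<subseteq> range P" "cvec.independent B" "range P \<subseteq> cvec.span B"
    using cvec.maximal_independent_subset[of "range P"] by blast
  have PB: "P b = b" if "b \<in> B" for b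
    using B(1) that idem by auto
  have "range P \<subseteq> cvec.span (unit_vec ` {..<n})"
  proof safe
    fix v
    have "P v = (\<lambda>i. if i < n then P v i else 0)"
      using fin_op_beyond[OF P] by (auto simp: fun_eq_iff)
    also have "\<dots> = (\<Sum>j<n. scl (P v j) (unit_vec j))"
      by (rule truncate_eq_sum)
    finally show "P v \<in> cvec.span (unit_vec ` {..<n})"
      by (metis (no_types, lifting) cvec.span_base cvec.span_scale cvec.span_sum image_eqI)
  qed
  then have finB: "finite B"
    using cvec.independent_span_bound[OF _ B(2), of "unit_vec ` {..<n}"] B(1) by auto
  let ?r = "cvec.representation B"
  have rep: "(\<Sum>b\<in>B. scl (?r (P v) b) b) = P v" for v
    using cvec.sum_representation_eq[OF B(2) _ finB order_refl, of "P v"] B(3) by auto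
  have spanP: "P v \<in> cvec.span B" for v
    using B(3) by auto
  have "op_trace P = (\<Sum>i<n. \<Sum>b\<in>B. ?r (P (unit_vec i)) b * b i)"
    unfolding op_trace_eq[OF P]
    by (intro sum.cong refl) (subst rep[symmetric], simp)
  \<comment> \<open>The entry \<open>b i\<close> is moved into the coordinate functional, so that
    the inner sum becomes the \<open>b\<close>-coordinate of \<open>P b\<close> by
    \<open>fin_op_expand\<close>.\<close>
  also have "\<dots> = (\<Sum>b\<in>B. \<Sum>i<n. ?r (scl (b i) (P (unit_vec i))) b)"
    by (subst sum.swap) (simp add: cvec.representation_scale[OF B(2) spanP] mult.commute)
  also have "\<dots> = (\<Sum>b\<in>B. ?r (P b) b)"
  proof (intro sum.cong refl)
    fix b
    have "cvec.span B = cvec.span B \<and> (\<Sum>i<n. ?r (scl (b i) (P (unit_vec i))) b)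
        = ?r (\<Sum>i<n. scl (b i) (P (unit_vec i))) b"
      by (simp add: cvec.representation_sum[OF B(2)] cvec.span_scale spanP)
    then show "(\<Sum>i<n. ?r (scl (b i) (P (unit_vec i))) b) = ?r (P b) b"
      using fin_op_expand[OF P, of b] by simp
  qed
  also have "\<dots> = (\<Sum>b\<in>B. 1)"
    by (intro sum.cong refl) (simp add: PB cvec.representation_basis[OF B(2)])
  finally have tr: "op_trace P = of_nat (card B)"
    by simp
  show ?thesis
  proof (rule that[OF tr])
    assume "card B = 0"
    then have "B = {}"
      using finB by simp
    then show "P = (\<lambda>v. 0)"
      using rep by auto
  qed
qed

text \<open>A linear right inverse on the range exists on the space of all sequences; truncating its
  argument and its value to \<open>n\<close> entries turns it into a matrix without affecting the
  identity, since \<open>T\<close> ignores later entries.\<close>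

lemma fin_op_generalized_inverse:
  assumes T: "fin_op n T"
  obtains U where "fin_op n U" "\<And>v. T (U (T v)) = T v"
proof -
  obtain g where g: "Vector_Spaces.linear scl scl g" "\<And>v. T (g (T v)) = T v"
    using cvec2.linear_exists_right_inverse_on[OF fin_op_linear[OF T] cvec.subspace_UNIV] by blast
  define t where "t v = (\<lambda>i::nat. if i < n then v i else (0::complex))" for v
  have tadd: "t (u + v) = t u + t v" and tscl: "t (scl c v) = scl c (t v)" and tt: "t (t v) = t v" for u v c
    by (auto simp: t_def fun_eq_iff)
  define U where "U = (\<lambda>v. t (g (t v)))"
  have "fin_op n U"
    using g(1) unfolding Vector_Spaces.linear_iff
    by (auto simp: fin_op_def U_def tadd tscl) (auto simp: t_def cong: if_cong)
  moreover have "T (U (T v)) = T v" for v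
  proof -
    have "t (T v) = T v"
      using fin_op_beyond[OF T] by (auto simp: t_def fun_eq_iff)
    then have "T (U (T v)) = T (g (T v))"
      unfolding U_def by (intro fin_op_cong[OF T]) (auto simp: t_def)
    then show ?thesis
      using g(2) by simp
  qed
  ultimately show ?thesis
    using that by blast
qed

section \<open>Modules over a complex group algebra as matrix representations\<close>

locale finite_group = group H for H :: "('g, 'x) monoid_scheme" (structure) +
  assumes finite_carrier [simp, intro]: "finite (carrier H)"

definition ga_monom :: "complex \<Rightarrow> 'g \<Rightarrow> 'g \<Rightarrow> complex" where
  "ga_monom c h = (\<lambda>x. if x = h then c else 0)"

text \<open>A matrix representation need not be unital: it is a representation on the image of the
  idempotent \<open>\<rho>(1)\<close>. This way every direct summand of a representation has the same format.\<close>

definition mat_rep ::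
    "('g, 'x) monoid_scheme \<Rightarrow> ('g \<Rightarrow> (nat \<Rightarrow> complex) \<Rightarrow> nat \<Rightarrow> complex) \<Rightarrow> bool" where
  "mat_rep H \<rho> \<longleftrightarrow> (\<exists>n. \<forall>h \<in> carrier H. fin_op n (\<rho> h)) \<and>
    (\<forall>g \<in> carrier H. \<forall>h \<in> carrier H. \<forall>v. \<rho> (g \<otimes>\<^bsub>H\<^esub> h) v = \<rho> g (\<rho> h v))"

text \<open>The image of the idempotent \<rho>(1) is written as its set of fixed points.\<close>

definition rep_mod ::
    "('g, 'x) monoid_scheme \<Rightarrow> ('g \<Rightarrow> (nat \<Rightarrow> complex) \<Rightarrow> nat \<Rightarrow> complex) \<Rightarrow> ('g, complex) rep_module" where
  "rep_mod H \<rho> = \<lparr>carrier = {v. \<rho> \<one>\<^bsub>H\<^esub> v = v}, monoid.mult = (+), one = 0,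
     ring.zero = 0, ring.add = (+), smult = (\<lambda>a v. \<Sum>h\<in>carrier H. scl (a h) (\<rho> h v))\<rparr>"

lemma rep_mod_simps [simp]:
  "carrier (rep_mod H \<rho>) = {v. \<rho> \<one>\<^bsub>H\<^esub> v = v}"
  "u \<oplus>\<^bsub>rep_mod H \<rho>\<^esub> v = u + v" "\<zero>\<^bsub>rep_mod H \<rho>\<^esub> = 0"
  "a \<odot>\<^bsub>rep_mod H \<rho>\<^esub> v = (\<Sum>h\<in>carrier H. scl (a h) (\<rho> h v))"
  by (simp_all add: rep_mod_def)

lemma mat_rep_mult:
  "mat_rep H \<rho> \<Longrightarrow> g \<in> carrier H \<Longrightarrow> h \<in> carrier H \<Longrightarrow> \<rho> g (\<rho> h v) = \<rho> (g \<otimes>\<^bsub>H\<^esub> h) v"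
  by (simp add: mat_rep_def)

lemma finsum_rep_mod:
  assumes "abelian_group (rep_mod H \<rho>)" "finite A" "f \<in> A \<rightarrow> carrier (rep_mod H \<rho>)"
  shows "finsum (rep_mod H \<rho>) f A = sum f A"
proof -
  interpret M: abelian_group "rep_mod H \<rho>" by fact
  show ?thesis
    using assms(2,3) by (induction A rule: finite_induct) (auto simp: Pi_iff)
qed

context finite_group
begin

abbreviation CH :: "('g \<Rightarrow> complex) ring" where "CH \<equiv> group_algebra H"

lemma CH_simps [simp]:
  "a \<in> carrier CH \<longleftrightarrow> (\<forall>x. x \<notin> carrier H \<longrightarrow> a x = 0)"
  "a \<oplus>\<^bsub>CH\<^esub> b = (\<lambda>x. a x + b x)" "\<zero>\<^bsub>CH\<^esub> = (\<lambda>x. 0)" "\<one>\<^bsub>CH\<^esub> = ga_monom 1 \<one>"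
  using finite_subset[OF _ finite_carrier, of "{g. a g \<noteq> 0}"]
  by (auto simp: group_algebra_def ga_monom_def)

lemma CH_mult:
  assumes "a \<in> carrier CH" "b \<in> carrier CH"
  shows "(a \<otimes>\<^bsub>CH\<^esub> b) x = (\<Sum>g\<in>carrier H. \<Sum>h\<in>carrier H. if g \<otimes> h = x then a g * b h else 0)"
  using assms by (intro group_algebra_mult) auto

lemma ring_CH: "ring CH"
  by (rule ring_group_algebra) (rule group_axioms)

lemma ga_monom_closed [simp]: "h \<in> carrier H \<Longrightarrow> ga_monom c h \<in> carrier CH"
  by (simp add: ga_monom_def)

lemma ga_monom_mult:
  assumes "g \<in> carrier H" "h \<in> carrier H"
  shows "ga_monom c g \<otimes>\<^bsub>CH\<^esub> ga_monom d h = ga_monom (c * d) (g \<otimes> h)"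
proof
  fix x
  have "(ga_monom c g \<otimes>\<^bsub>CH\<^esub> ga_monom d h) x =
      (\<Sum>g'\<in>carrier H. \<Sum>h'\<in>carrier H. if g = g' then if h = h' then if g \<otimes> h = x then c * d else 0 else 0 else 0)"
    using assms by (subst CH_mult) (auto simp: ga_monom_def intro!: sum.cong)
  also have "\<dots> = (\<Sum>g'\<in>carrier H. if g = g' then \<Sum>h'\<in>carrier H. if h = h' then if g \<otimes> h = x then c * d else 0 else 0 else 0)"
    by (intro sum.cong) auto
  also have "\<dots> = ga_monom (c * d) (g \<otimes> h) x"
    using assms by (auto simp: ga_monom_def sum.delta')
  finally show "(ga_monom c g \<otimes>\<^bsub>CH\<^esub> ga_monom d h) x = ga_monom (c * d) (g \<otimes> h) x" .
qed

lemma CH_induct [consumes 1, case_names zero add]: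
  assumes "a \<in> carrier CH" and zero: "P (\<lambda>x. 0)"
    and add: "\<And>c h a. h \<in> carrier H \<Longrightarrow> a \<in> carrier CH \<Longrightarrow> a h = 0 \<Longrightarrow> P a \<Longrightarrow> P (ga_monom c h \<oplus>\<^bsub>CH\<^esub> a)"
  shows "P a"
proof -
  have "P a" if "finite S" "S \<subseteq> carrier H" "\<And>x. x \<notin> S \<Longrightarrow> a x = 0" for S a
    using that
  proof (induction S arbitrary: a rule: finite_induct)
    case empty
    then have "a = (\<lambda>x. 0)" by auto
    then show ?case using zero by simp
  next
    case (insert h S)
    have "P (a(h := 0))"
      using insert.prems by (intro insert.IH) auto
    moreover have "a(h := 0) \<in> carrier CH"
      using insert.prems by (auto simp: subset_iff)
    moreover have "a = ga_monom (a h) h \<oplus>\<^bsub>CH\<^esub> a(h := 0)"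
      by (auto simp: ga_monom_def)
    ultimately show ?case
      using add[of h "a(h := 0)" "a h"] insert.prems by simp
  qed
  from this[OF finite_carrier order_refl] show ?thesis
    using assms(1) by simp
qed

lemma left_module_zero_smult:
  assumes "left_module CH M" "x \<in> carrier M"
  shows "(\<lambda>x. 0) \<odot>\<^bsub>M\<^esub> x = \<zero>\<^bsub>M\<^esub>"
proof -
  interpret left_module CH M by fact
  have "(\<lambda>x. 0) \<odot>\<^bsub>M\<^esub> x \<in> carrier M"
    using assms(2) by (intro smult_closed) auto
  then show ?thesis
    using smult_l_distr[of "\<lambda>x. 0" "\<lambda>x. 0" x] assms(2) by simp
qed

text \<open>Translates a scalar multiple in an abstract module into an ordinary sum of sequences. It
  is applied to a coordinate map that is not yet known to respect the action of the whole group
  algebra.\<close>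

lemma additive_smult:
  fixes c :: "'m \<Rightarrow> nat \<Rightarrow> complex"
  assumes M: "left_module CH M" and x: "x \<in> carrier M" and a: "a \<in> carrier CH"
    and c: "\<And>x y. x \<in> carrier M \<Longrightarrow> y \<in> carrier M \<Longrightarrow> c (x \<oplus>\<^bsub>M\<^esub> y) = c x + c y"
  shows "c (a \<odot>\<^bsub>M\<^esub> x) = (\<Sum>h\<in>carrier H. c (ga_monom (a h) h \<odot>\<^bsub>M\<^esub> x))"
proof -
  interpret left_module CH M by fact
  have 0: "c \<zero>\<^bsub>M\<^esub> = 0"
    using c[of "\<zero>\<^bsub>M\<^esub>" "\<zero>\<^bsub>M\<^esub>"] by simp
  have ga0: "ga_monom 0 h = (\<lambda>x. 0)" for h :: 'g
    by (auto simp: ga_monom_def)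
  note z = left_module_zero_smult[OF M x]
  show ?thesis using a
  proof (induction rule: CH_induct)
    case zero
    then show ?case by (simp add: z 0 ga0)
  next
    case (add d h a)
    have "c ((ga_monom d h \<oplus>\<^bsub>CH\<^esub> a) \<odot>\<^bsub>M\<^esub> x) = c (ga_monom d h \<odot>\<^bsub>M\<^esub> x) + c (a \<odot>\<^bsub>M\<^esub> x)"
      using add(1,2) x smult_l_distr[of "ga_monom d h" a x]
      by (metis c ga_monom_closed smult_closed)
    also have "\<dots> = (\<Sum>h'\<in>carrier H. (if h = h' then c (ga_monom d h \<odot>\<^bsub>M\<^esub> x) else 0) + c (ga_monom (a h') h' \<odot>\<^bsub>M\<^esub> x))"
      unfolding sum.distrib add(4) using add(1) by (simp add: sum.delta')
    also have "\<dots> = (\<Sum>h'\<in>carrier H. c (ga_monom ((ga_monom d h \<oplus>\<^bsub>CH\<^esub> a) h') h' \<odot>\<^bsub>M\<^esub> x))"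
    proof (intro sum.cong refl)
      fix h'
      have "ga_monom d h h = d" "h' \<noteq> h \<Longrightarrow> ga_monom d h h' = 0"
        by (auto simp: ga_monom_def)
      then show "(if h = h' then c (ga_monom d h \<odot>\<^bsub>M\<^esub> x) else 0) + c (ga_monom (a h') h' \<odot>\<^bsub>M\<^esub> x)
          = c (ga_monom ((ga_monom d h \<oplus>\<^bsub>CH\<^esub> a) h') h' \<odot>\<^bsub>M\<^esub> x)"
        using add(3) by (cases "h = h'") (auto simp: ga0 z 0)
    qed
    finally show ?case .
  qed
qed

lemma left_module_rep_mod:
  assumes \<rho>: "mat_rep H \<rho>"
  shows "left_module CH (rep_mod H \<rho>)"
proof -
  obtain n where n: "\<And>h. h \<in> carrier H \<Longrightarrow> fin_op n (\<rho> h)"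
    using \<rho> unfolding mat_rep_def by blast
  note one = n[OF one_closed]
  interpret R: ring CH by (rule ring_CH)
  have closed: "\<rho> \<one> (\<Sum>h\<in>carrier H. scl (a h) (\<rho> h v)) = (\<Sum>h\<in>carrier H. scl (a h) (\<rho> h v))" for a v
    by (simp add: fin_op_sum[OF one] fin_op_scl[OF one] mat_rep_mult[OF \<rho>])
  show ?thesis
  proof (intro left_module.intro left_module_axioms.intro)
    show "ring CH" by (rule ring_CH)
    show "abelian_group (rep_mod H \<rho>)"
    proof (rule abelian_groupI)
      fix x assume "x \<in> carrier (rep_mod H \<rho>)"
      then show "\<exists>y\<in>carrier (rep_mod H \<rho>). y \<oplus>\<^bsub>rep_mod H \<rho>\<^esub> x = \<zero>\<^bsub>rep_mod H \<rho>\<^esub>"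
        using fin_op_diff[OF one, of 0 x] by (intro bexI[of _ "- x"]) (auto simp: fin_op_0[OF one])
    qed (auto simp: fin_op_add[OF one] fin_op_0[OF one])
    fix a b :: "'g \<Rightarrow> complex" and x y :: "nat \<Rightarrow> complex"
    show "a \<odot>\<^bsub>rep_mod H \<rho>\<^esub> x \<in> carrier (rep_mod H \<rho>)"
      by (simp add: closed)
    show "(a \<oplus>\<^bsub>CH\<^esub> b) \<odot>\<^bsub>rep_mod H \<rho>\<^esub> x = a \<odot>\<^bsub>rep_mod H \<rho>\<^esub> x \<oplus>\<^bsub>rep_mod H \<rho>\<^esub> b \<odot>\<^bsub>rep_mod H \<rho>\<^esub> x"
      by (simp add: sum.distrib cvec.scale_left_distrib)
    show "a \<odot>\<^bsub>rep_mod H \<rho>\<^esub> (x \<oplus>\<^bsub>rep_mod H \<rho>\<^esub> y) = a \<odot>\<^bsub>rep_mod H \<rho>\<^esub> x \<oplus>\<^bsub>rep_mod H \<rho>\<^esub> a \<odot>\<^bsub>rep_mod H \<rho>\<^esub> y"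
      by (simp add: sum.distrib cvec.scale_right_distrib fin_op_add[OF n])
    show "(a \<otimes>\<^bsub>CH\<^esub> b) \<odot>\<^bsub>rep_mod H \<rho>\<^esub> x = a \<odot>\<^bsub>rep_mod H \<rho>\<^esub> (b \<odot>\<^bsub>rep_mod H \<rho>\<^esub> x)"
      if a: "a \<in> carrier CH" and b: "b \<in> carrier CH"
    proof -
      have "(a \<otimes>\<^bsub>CH\<^esub> b) \<odot>\<^bsub>rep_mod H \<rho>\<^esub> x = (\<Sum>k\<in>carrier H. \<Sum>g\<in>carrier H. \<Sum>h\<in>carrier H. if g \<otimes> h = k then scl (a g * b h) (\<rho> k x) else 0)"
        using CH_mult[OF a b] by (auto simp: cvec.scale_sum_left intro!: sum.cong)
      also have "\<dots> = (\<Sum>g\<in>carrier H. \<Sum>h\<in>carrier H. \<Sum>k\<in>carrier H. if g \<otimes> h = k then scl (a g * b h) (\<rho> k x) else 0)"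
        by (subst sum.swap, rule sum.cong[OF refl], rule sum.swap)
      also have "\<dots> = (\<Sum>g\<in>carrier H. \<Sum>h\<in>carrier H. scl (a g * b h) (\<rho> (g \<otimes> h) x))"
        by (intro sum.cong refl) (simp add: sum.delta')
      also have "\<dots> = a \<odot>\<^bsub>rep_mod H \<rho>\<^esub> (b \<odot>\<^bsub>rep_mod H \<rho>\<^esub> x)"
        by (simp add: fin_op_sum[OF n] fin_op_scl[OF n] mat_rep_mult[OF \<rho>] cvec.scale_sum_right)
      finally show ?thesis .
    qed
    show "\<one>\<^bsub>CH\<^esub> \<odot>\<^bsub>rep_mod H \<rho>\<^esub> x = x"
      if x: "x \<in> carrier (rep_mod H \<rho>)"
    proof -
      have "(\<Sum>h\<in>carrier H. scl (ga_monom 1 \<one> h) (\<rho> h x)) = (\<Sum>h\<in>carrier H. if \<one> = h then \<rho> h x else 0)"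
        by (intro sum.cong refl) (auto simp: ga_monom_def)
      then show ?thesis
        using x by simp
    qed
  qed
qed

lemma fg_rep_mod:
  assumes \<rho>: "mat_rep H \<rho>"
  shows "rep_mod H \<rho> \<in> fg_modules CH"
proof -
  obtain n where n: "\<And>h. h \<in> carrier H \<Longrightarrow> fin_op n (\<rho> h)"
    using \<rho> unfolding mat_rep_def by blast
  note one = n[OF one_closed]
  interpret left_module CH "rep_mod H \<rho>" by (rule left_module_rep_mod[OF \<rho>])
  let ?s = "\<lambda>j. \<rho> \<one> (unit_vec j)"
  have "\<exists>c \<in> ?s ` {..<n} \<rightarrow> carrier CH. x = (\<Oplus>\<^bsub>rep_mod H \<rho>\<^esub>s\<in>?s ` {..<n}. c s \<odot>\<^bsub>rep_mod H \<rho>\<^esub> s)"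
    if x: "x \<in> carrier (rep_mod H \<rho>)" for x
  proof
    \<comment> \<open>Different \<open>j\<close> may give the same generator \<rho>(1) e_j, so the
      coefficient of a generator collects the entries of \<open>x\<close> over its whole
      fibre.\<close>
    define c where "c s = ga_monom (\<Sum>j | j \<in> {..<n} \<and> ?s j = s. x j) \<one>" for s
    show c: "c \<in> ?s ` {..<n} \<rightarrow> carrier CH"
      unfolding c_def by (intro Pi_I ga_monom_closed) simp
    have s: "c s \<odot>\<^bsub>rep_mod H \<rho>\<^esub> s = (\<Sum>j | j \<in> {..<n} \<and> ?s j = s. scl (x j) (?s j))" if "\<rho> \<one> s = s" for s
    proof -
      have "(\<Sum>h\<in>carrier H. scl (c s h) (\<rho> h s)) = (\<Sum>h\<in>carrier H. if \<one> = h then scl (\<Sum>j | j \<in> {..<n} \<and> ?s j = s. x j) (\<rho> h s) else 0)"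
        by (intro sum.cong refl) (auto simp: ga_monom_def c_def)
      also have "\<dots> = (\<Sum>j | j \<in> {..<n} \<and> ?s j = s. scl (x j) (?s j))"
        using that by (simp add: cvec.scale_sum_left)
      finally show ?thesis by simp
    qed
    have idem: "\<rho> \<one> (?s j) = ?s j" for j
      using mat_rep_mult[OF \<rho>, of \<one> \<one>] by simp
    have "(\<Oplus>\<^bsub>rep_mod H \<rho>\<^esub>s\<in>?s ` {..<n}. c s \<odot>\<^bsub>rep_mod H \<rho>\<^esub> s) = (\<Sum>s\<in>?s ` {..<n}. c s \<odot>\<^bsub>rep_mod H \<rho>\<^esub> s)"
    proof (rule finsum_rep_mod)
      show "(\<lambda>s. c s \<odot>\<^bsub>rep_mod H \<rho>\<^esub> s) \<in> ?s ` {..<n} \<rightarrow> carrier (rep_mod H \<rho>)"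
        using c idem by (intro Pi_I smult_closed) (auto simp del: CH_simps rep_mod_simps(4))
    qed (use M.abelian_group_axioms in auto)
    also have "\<dots> = (\<Sum>s\<in>?s ` {..<n}. \<Sum>j | j \<in> {..<n} \<and> ?s j = s. scl (x j) (?s j))"
      by (intro sum.cong refl s) (use idem in auto)
    also have "\<dots> = (\<Sum>j<n. scl (x j) (?s j))"
      by (rule sum.image_gen[symmetric]) simp
    also have "\<dots> = x"
      using fin_op_expand[OF one, of x] x by simp
    finally show "x = (\<Oplus>\<^bsub>rep_mod H \<rho>\<^esub>s\<in>?s ` {..<n}. c s \<odot>\<^bsub>rep_mod H \<rho>\<^esub> s)" ..
  qed
  moreover have "?s ` {..<n} \<subseteq> carrier (rep_mod H \<rho>)"
    using mat_rep_mult[OF \<rho>, of \<one> \<one>] by auto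
  moreover have "finite (?s ` {..<n})"
    by simp
  ultimately show ?thesis
    unfolding fg_modules_def finitely_generated_module_def mem_Collect_eq
    using left_module_rep_mod[OF \<rho>] by blast
qed

definition module_iso :: "('g \<Rightarrow> complex, 'm, 'y) module_scheme \<Rightarrow> ('g \<Rightarrow> complex, 'n, 'z) module_scheme \<Rightarrow> bool" where
  "module_iso M N \<longleftrightarrow> (\<exists>f \<in> module_homs CH M N. bij_betw f (carrier M) (carrier N))"

text \<open>The map \<open>E\<close> presents \<open>M\<close> as a quotient of \<complex>^n. A
  linear section \<open>c\<close> of \<open>E\<close> identifies \<open>M\<close> with a subspace of
  \<complex>^n, and the action is transported along it.\<close>

lemma fg_module_iso_rep_mod:
  fixes M :: "('g \<Rightarrow> complex, 'm, 'y) module_scheme"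
  assumes M: "finitely_generated_module CH M"
  obtains \<rho> where "mat_rep H \<rho>" "module_iso M (rep_mod H \<rho>)"
proof -
  note one_H = one_closed
  interpret left_module CH M using M by (simp add: finitely_generated_module_def)
  note LM = left_module_axioms
  obtain S where S: "finite S" "S \<subseteq> carrier M"
    and gen: "\<And>x. x \<in> carrier M \<Longrightarrow> \<exists>c \<in> S \<rightarrow> carrier CH. x = (\<Oplus>\<^bsub>M\<^esub>s\<in>S. c s \<odot>\<^bsub>M\<^esub> s)"
    using M unfolding finitely_generated_module_def by blast
  \<comment> \<open>Over \<complex> the module is spanned by the products of a group element with a
    generator, hence one coordinate for each such pair.\<close>
  define n where "n = card (S \<times> carrier H)"
  obtain e where e: "bij_betw e {..<n} (S \<times> carrier H)"
    unfolding n_def using bij_betw_from_nat_into_finite[of "S \<times> carrier H"] S(1)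
    by (metis finite_SigmaI finite_carrier)
  define m where "m i = ga_monom 1 (snd (e i)) \<odot>\<^bsub>M\<^esub> fst (e i)" for i
  have eS: "fst (e i) \<in> S" "snd (e i) \<in> carrier H" if "i < n" for i
    using bij_betwE[OF e] that by (auto simp: mem_Times_iff)
  have m [simp]: "m i \<in> carrier M" if "i < n" for i
    unfolding m_def using S(2) eS[OF that] by (intro smult_closed ga_monom_closed) auto
  define sc where "sc c = ga_monom c \<one>" for c :: complex
  have sc [simp]: "sc c \<in> carrier CH" for c
    unfolding sc_def by (rule ga_monom_closed) (rule one_H)
  have sc_smult [simp]: "sc c \<odot>\<^bsub>M\<^esub> x \<in> carrier M" if "x \<in> carrier M" for c x
    using smult_closed[OF sc that] .
  have sc_add: "sc (c + d) \<odot>\<^bsub>M\<^esub> x = sc c \<odot>\<^bsub>M\<^esub> x \<oplus>\<^bsub>M\<^esub> sc d \<odot>\<^bsub>M\<^esub> x" if "x \<in> carrier M" for c d x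
  proof -
    have "sc (c + d) = sc c \<oplus>\<^bsub>CH\<^esub> sc d"
      by (auto simp: sc_def ga_monom_def)
    then show ?thesis using smult_l_distr[OF sc sc that] by metis
  qed
  have sc_monom: "sc c \<odot>\<^bsub>M\<^esub> (ga_monom d h \<odot>\<^bsub>M\<^esub> x) = ga_monom (c * d) h \<odot>\<^bsub>M\<^esub> x" 
    and monom_sc: "ga_monom d h \<odot>\<^bsub>M\<^esub> (sc c \<odot>\<^bsub>M\<^esub> x) = sc c \<odot>\<^bsub>M\<^esub> (ga_monom d h \<odot>\<^bsub>M\<^esub> x)"
    if "h \<in> carrier H" "x \<in> carrier M" for c d h x
    using that smult_assoc1[OF sc ga_monom_closed[OF that(1)] that(2), of c d]
      smult_assoc1[OF ga_monom_closed[OF that(1)] sc that(2), of d c]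
      ga_monom_mult[OF one_H that(1), of c d] ga_monom_mult[OF that(1) one_H, of d c]
    by (simp_all add: sc_def mult.commute)
  have sc_sc: "sc c \<odot>\<^bsub>M\<^esub> (sc d \<odot>\<^bsub>M\<^esub> x) = sc (c * d) \<odot>\<^bsub>M\<^esub> x" if "x \<in> carrier M" for c d x
    using sc_monom[of \<one> x c d] that by (simp add: sc_def)
  have sc1: "sc 1 \<odot>\<^bsub>M\<^esub> x = x" if "x \<in> carrier M" for x
    using smult_one[OF that] by (simp add: sc_def)
  have sc0: "sc c \<odot>\<^bsub>M\<^esub> \<zero>\<^bsub>M\<^esub> = \<zero>\<^bsub>M\<^esub>" for c
    using smult_r_distr[OF sc, of "\<zero>\<^bsub>M\<^esub>" "\<zero>\<^bsub>M\<^esub>" c] smult_closed[OF sc, of "\<zero>\<^bsub>M\<^esub>" c] by simp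
  have zsc: "sc 0 \<odot>\<^bsub>M\<^esub> x = \<zero>\<^bsub>M\<^esub>" if "x \<in> carrier M" for x
  proof -
    have "sc 0 = (\<lambda>x. 0)" by (auto simp: sc_def ga_monom_def)
    then show ?thesis using left_module_zero_smult[OF LM that] by simp
  qed
  define E where "E v = (\<Oplus>\<^bsub>M\<^esub>i\<in>{..<n}. sc (v i) \<odot>\<^bsub>M\<^esub> m i)" for v :: "nat \<Rightarrow> complex"
  have clos: "(\<lambda>i. sc (v i) \<odot>\<^bsub>M\<^esub> m i) \<in> {..<n} \<rightarrow> carrier M" for v
    by (intro Pi_I sc_smult) auto
  have E_closed [simp]: "E v \<in> carrier M" for v
    unfolding E_def by (rule M.finsum_closed) (rule clos)
  have E_add: "E (u + v) = E u \<oplus>\<^bsub>M\<^esub> E v" for u v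
  proof -
    have "E (u + v) = (\<Oplus>\<^bsub>M\<^esub>i\<in>{..<n}. sc (u i) \<odot>\<^bsub>M\<^esub> m i \<oplus>\<^bsub>M\<^esub> sc (v i) \<odot>\<^bsub>M\<^esub> m i)"
      unfolding E_def by (rule M.finsum_cong') (auto simp: sc_add)
    then show ?thesis
      unfolding E_def by (simp add: M.finsum_addf[OF clos clos])
  qed
  have E_scl: "E (scl c v) = sc c \<odot>\<^bsub>M\<^esub> E v" for c v
  proof -
    have "k \<le> n \<Longrightarrow> (\<Oplus>\<^bsub>M\<^esub>i\<in>{..<k}. sc (c * v i) \<odot>\<^bsub>M\<^esub> m i) = sc c \<odot>\<^bsub>M\<^esub> (\<Oplus>\<^bsub>M\<^esub>i\<in>{..<k}. sc (v i) \<odot>\<^bsub>M\<^esub> m i)" for k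
    proof (induction k)
      case (Suc k)
      have f: "(\<lambda>i. sc (v i) \<odot>\<^bsub>M\<^esub> m i) \<in> {..<k} \<rightarrow> carrier M" for v
        using Suc.prems by (intro Pi_I sc_smult) auto
      have g: "sc (v k) \<odot>\<^bsub>M\<^esub> m k \<in> carrier M" for v
        using Suc.prems by (intro sc_smult) auto
      show ?case
        using Suc by (simp add: lessThan_Suc M.finsum_insert[OF _ _ f g] M.finsum_insert[OF _ _ f[of "\<lambda>i. c * v i"] g[of "\<lambda>i. c * v i"]]
            smult_r_distr[OF sc g M.finsum_closed[OF f]] sc_sc)
    qed (simp add: sc0)
    then show ?thesis unfolding E_def by simp
  qed
  have E_unit: "E (unit_vec i) = m i" if "i < n" for i
  proof -
    have "E (unit_vec i) = (\<Oplus>\<^bsub>M\<^esub>j\<in>{..<n}. if i = j then m j else \<zero>\<^bsub>M\<^esub>)"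
      unfolding E_def by (rule M.finsum_cong') (auto simp: sc1 zsc)
    then show ?thesis using M.finsum_singleton[of i "{..<n}" m] that by simp
  qed
  have E_cong: "E u = E v" if "\<And>i. i < n \<Longrightarrow> u i = v i" for u v
    unfolding E_def using that by (intro M.finsum_cong') auto
  have E_0: "E 0 = \<zero>\<^bsub>M\<^esub>"
  proof -
    have "E 0 \<oplus>\<^bsub>M\<^esub> E 0 = E 0"
      using E_add[of 0 0, symmetric] by (simp only: add_0)
    then show ?thesis
      by simp
  qed
  have range1: "ga_monom c h \<odot>\<^bsub>M\<^esub> s \<in> range E" if "s \<in> S" "h \<in> carrier H" for c h s
  proof -
    have "(s, h) \<in> e ` {..<n}"
      using e that by (simp add: bij_betw_def)
    then obtain i where i: "i < n" "e i = (s, h)"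
      by auto
    have "ga_monom c h \<odot>\<^bsub>M\<^esub> s = E (scl c (unit_vec i))"
      unfolding E_scl E_unit[OF i(1)] m_def i(2) using that S(2) sc_monom[of h s c 1] by auto
    then show ?thesis by simp
  qed
  have range_add: "x \<oplus>\<^bsub>M\<^esub> y \<in> range E" if xy: "x \<in> range E" "y \<in> range E" for x y
  proof -
    obtain u v where "x = E u" "y = E v"
      using xy by blast
    then show ?thesis
      using E_add[of u v, symmetric] by simp
  qed
  have range2: "a \<odot>\<^bsub>M\<^esub> s \<in> range E" if "a \<in> carrier CH" "s \<in> S" for a s
    using that(1)
  proof (induction rule: CH_induct)
    case zero
    have "(\<lambda>x. 0) \<odot>\<^bsub>M\<^esub> s = E 0"
      using left_module_zero_smult[OF LM, of s] S(2) that(2) E_0 by auto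
    then show ?case by simp
  next
    case (add c h a)
    then show ?case
      using range_add[OF range1[OF that(2) add(1), of c] add(4)] S(2) that(2)
        smult_l_distr[OF ga_monom_closed[OF add(1)] add(2), of s c] by auto
  qed
  have surj: "\<exists>v. E v = x" if x: "x \<in> carrier M" for x
  proof -
    obtain c where c: "c \<in> S \<rightarrow> carrier CH" "x = (\<Oplus>\<^bsub>M\<^esub>s\<in>S. c s \<odot>\<^bsub>M\<^esub> s)"
      using gen[OF x] by blast
    have "T \<subseteq> S \<Longrightarrow> (\<Oplus>\<^bsub>M\<^esub>s\<in>T. c s \<odot>\<^bsub>M\<^esub> s) \<in> range E" if "finite T" for T
      using that
    proof (induction T rule: finite_induct)
      case empty
      have "(\<Oplus>\<^bsub>M\<^esub>s\<in>{}. c s \<odot>\<^bsub>M\<^esub> s) = E 0"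
        using E_0 by simp
      then show ?case by simp
    next
      case (insert s T)
      have "c s \<odot>\<^bsub>M\<^esub> s \<in> range E"
        using insert c(1) by (intro range2) (auto simp: Pi_iff)
      moreover have "(\<lambda>s. c s \<odot>\<^bsub>M\<^esub> s) \<in> T \<rightarrow> carrier M" "c s \<odot>\<^bsub>M\<^esub> s \<in> carrier M"
        using insert c(1) S(2) by (auto simp: Pi_iff simp del: CH_simps intro!: smult_closed)
      ultimately show ?case
        using insert by (auto simp: M.finsum_insert intro!: range_add)
    qed
    from this[OF S(1) order_refl] show ?thesis
      using c(2) by auto
  qed
  \<comment> \<open>The kernel is taken among all sequences, including those that vanish below
    \<open>n\<close>. Below, \<open>p\<close> is a projection onto it.\<close>
  define K where "K = {v. E v = \<zero>\<^bsub>M\<^esub>}"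
  have "cvec.subspace K"
    by (auto simp: cvec.subspace_def K_def E_add E_scl E_0 sc0)
  moreover have "Vector_Spaces.linear scl scl id"
    by (rule cvec.linear_id)
  ultimately obtain p where p: "range p \<subseteq> K" "Vector_Spaces.linear scl scl p" "\<And>v. v \<in> K \<Longrightarrow> p v = v"
    using cvec2.linear_exists_left_inverse_on[of id K] by auto
  have p_add: "p (u + v) = p u + p v" and p_scl: "p (scl c v) = scl c (p v)" for u v c
    using p(2) by (auto simp: Vector_Spaces.linear_iff)
  \<comment> \<open>Removing the kernel component makes the result depend on \<open>E v\<close>
    only, and cutting off at \<open>n\<close> does not change the value of \<open>E\<close>.\<close>
  define t where "t v = (\<lambda>i. if i < n then v i - p v i else 0)" for v
  have t_add: "t (u + v) = t u + t v" and t_scl: "t (scl c v) = scl c (t v)" for u v c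
    by (auto simp: t_def p_add p_scl algebra_simps)
  have Et: "E (t v) = E v" for v
  proof -
    have "E v = E (v - p v) \<oplus>\<^bsub>M\<^esub> E (p v)"
      using E_add[of "v - p v" "p v"] by simp
    also have "E (p v) = \<zero>\<^bsub>M\<^esub>"
      using p(1) by (auto simp: K_def)
    also have "E (v - p v) = E (t v)"
      by (rule E_cong) (simp add: t_def)
    finally show ?thesis by simp
  qed
  have t_cong: "t u = t v" if "E u = E v" for u v
  proof -
    have "E (u - v) \<oplus>\<^bsub>M\<^esub> E v = E v"
      using that E_add[of "u - v" v] by simp
    then have "u - v \<in> K"
      unfolding K_def by simp
    then have "t (u - v) = 0"
      by (auto simp: t_def p(3))
    then show ?thesis
      using t_add[of "u - v" v] by simp
  qed
  \<comment> \<open>By \<open>t_cong\<close> the chosen preimage does not matter, which is why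
    \<open>c\<close> is linear.\<close>
  define c where "c x = t (SOME v. E v = x)" for x
  have cE: "c (E v) = t v" for v
    unfolding c_def by (rule t_cong) (rule someI[of _ v], simp)
  have Ec: "E (c x) = x" if x: "x \<in> carrier M" for x
  proof -
    obtain v where "E v = x"
      using surj[OF x] by blast
    then show ?thesis
      using Et[of v] cE[of v] by simp
  qed
  have c_add: "c (x \<oplus>\<^bsub>M\<^esub> y) = c x + c y" if xy: "x \<in> carrier M" "y \<in> carrier M" for x y
  proof -
    obtain u v where "E u = x" "E v = y"
      using surj[OF xy(1)] surj[OF xy(2)] by blast
    then show ?thesis
      using cE[of u] cE[of v] cE[of "u + v"] by (simp add: E_add t_add)
  qed
  have c_scl: "c (sc a \<odot>\<^bsub>M\<^esub> x) = scl a (c x)" if x: "x \<in> carrier M" for a x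
  proof -
    obtain v where "E v = x"
      using surj[OF x] by blast
    then show ?thesis
      using cE[of v] cE[of "scl a v"] by (simp add: E_scl t_scl)
  qed
  \<comment> \<open>Here \<rho>(1) = c E is a projection of \<complex>^n onto the copy of
    \<open>M\<close>, in general not the identity; this is where non-unital representations
    arise.\<close>
  define \<rho> where "\<rho> h v = c (ga_monom 1 h \<odot>\<^bsub>M\<^esub> E v)" for h v
  have gE: "ga_monom 1 h \<odot>\<^bsub>M\<^esub> x \<in> carrier M" if "h \<in> carrier H" "x \<in> carrier M" for h x
    using that by (intro smult_closed ga_monom_closed)
  have fin: "fin_op n (\<rho> h)" if h: "h \<in> carrier H" for h
    unfolding fin_op_def
  proof (intro conjI allI impI)
    fix u v :: "nat \<Rightarrow> complex" and a i
    show "\<rho> h (u + v) = \<rho> h u + \<rho> h v"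
      unfolding \<rho>_def using h by (simp add: E_add smult_r_distr[OF ga_monom_closed] c_add gE)
    show "\<rho> h (scl a v) = scl a (\<rho> h v)"
      unfolding \<rho>_def using h by (simp add: E_scl monom_sc c_scl gE)
    show "\<rho> h (\<lambda>i. if i < n then v i else 0) = \<rho> h v"
      unfolding \<rho>_def by (subst E_cong[of "\<lambda>i. if i < n then v i else 0" v]) auto
    assume "i \<ge> n"
    then show "\<rho> h v i = 0"
      unfolding \<rho>_def c_def t_def by simp
  qed
  have mult: "\<rho> (g \<otimes> h) v = \<rho> g (\<rho> h v)" if "g \<in> carrier H" "h \<in> carrier H" for g h v
    unfolding \<rho>_def using that smult_assoc1[of "ga_monom 1 g" "ga_monom 1 h" "E v"]
    by (simp add: Ec gE ga_monom_mult del: CH_simps(1))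
  have rep: "mat_rep H \<rho>"
    using fin mult by (auto simp: mat_rep_def)
  have \<rho>1: "\<rho> \<one> v = c (E v)" for v
    using sc1[of "E v"] by (simp add: \<rho>_def sc_def)
  have bij: "bij_betw c (carrier M) (carrier (rep_mod H \<rho>))"
    by (rule bij_betw_byWitness[where f' = E]) (auto simp: Ec \<rho>1)
  have "c \<in> module_homs CH M (rep_mod H \<rho>)"
    unfolding module_homs_def
  proof (intro CollectI conjI ballI)
    show "c \<in> carrier M \<rightarrow> carrier (rep_mod H \<rho>)"
      using bij by (rule bij_betw_imp_funcset)
    fix a x assume a: "a \<in> carrier CH" and x: "x \<in> carrier M"
    have "c (a \<odot>\<^bsub>M\<^esub> x) = (\<Sum>h\<in>carrier H. c (ga_monom (a h) h \<odot>\<^bsub>M\<^esub> x))"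
      by (rule additive_smult[OF LM x a c_add])
    also have "\<dots> = (\<Sum>h\<in>carrier H. scl (a h) (\<rho> h (c x)))"
    proof (intro sum.cong refl)
      fix h assume h: "h \<in> carrier H"
      have "c (ga_monom (a h) h \<odot>\<^bsub>M\<^esub> x) = c (sc (a h) \<odot>\<^bsub>M\<^esub> (ga_monom 1 h \<odot>\<^bsub>M\<^esub> x))"
        using sc_monom[OF h x, of "a h" 1] by simp
      then show "c (ga_monom (a h) h \<odot>\<^bsub>M\<^esub> x) = scl (a h) (\<rho> h (c x))"
        by (simp add: c_scl gE h x \<rho>_def Ec)
    qed
    finally show "c (a \<odot>\<^bsub>M\<^esub> x) = a \<odot>\<^bsub>rep_mod H \<rho>\<^esub> c x" by simp
  qed (auto simp: c_add)
  then have "module_iso M (rep_mod H \<rho>)"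
    using bij by (auto simp: module_iso_def)
  with rep show ?thesis
    using that by blast
qed

end

section \<open>Additivity of the trace\<close>

definition root_unity :: "nat \<Rightarrow> int \<Rightarrow> complex" where
  "root_unity m k = cis (2 * pi * of_int k / of_nat m)"

lemma root_unity_0 [simp]: "root_unity m 0 = 1"
  by (simp add: root_unity_def)

lemma root_unity_add: "root_unity m (k + l) = root_unity m k * root_unity m l"
  by (simp add: root_unity_def cis_mult ring_distribs add_divide_distrib)

lemma root_unity_period: "m > 0 \<Longrightarrow> root_unity m (int m * k) = 1"
  using cis_multiple_2pi[of "of_int k"] by (simp add: root_unity_def mult.assoc)

lemma cnj_root_unity: "cnj (root_unity m k) = root_unity m (- k)"
  by (simp add: root_unity_def cis_cnj)

lemma root_unity_power: "root_unity m k ^ a = root_unity m (int a * k)"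
  by (induction a) (auto simp: root_unity_add ring_distribs)

lemma root_unity_eq_1_iff:
  assumes "m > 0"
  shows "root_unity m k = 1 \<longleftrightarrow> int m dvd k"
proof
  assume "root_unity m k = 1"
  then have "cos (2 * pi * of_int k / of_nat m) = 1"
    by (simp add: root_unity_def complex_eq_iff)
  then obtain j :: int where "2 * pi * of_int k / of_nat m = of_int j * 2 * pi"
    by (auto simp: cos_one_2pi_int)
  then have "of_int k = (of_int j * of_nat m :: real)"
    using assms by (simp add: field_simps)
  then have "of_int k = (of_int (j * int m) :: real)"
    by simp
  then have "k = j * int m"
    by linarith
  then show "int m dvd k" by simp
qed (use assms in \<open>auto simp: root_unity_period\<close>)

lemma sum_root_unity:
  assumes "m > 0"
  shows "(\<Sum>a<m. root_unity m (int a * k)) = (if int m dvd k then of_nat m else 0)"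
proof (cases "int m dvd k")
  case True
  then have "root_unity m (int a * k) = 1" for a
    using root_unity_power[of m k a] root_unity_eq_1_iff[OF assms, of k] by simp
  then show ?thesis using True by simp
next
  case False
  then have "root_unity m k \<noteq> 1"
    using root_unity_eq_1_iff[OF assms] by simp
  then have "(\<Sum>a<m. root_unity m k ^ a) = 0"
    using geometric_sum[of "root_unity m k" m] assms by (simp add: root_unity_power root_unity_period)
  then show ?thesis using False by (simp add: root_unity_power)
qed

text \<open>Translation invariance of sums over \<int>/m, with functions on \<int>/m represented as
  periodic functions on the naturals.\<close>

lemma sum_periodic:
  fixes f :: "nat \<Rightarrow> 'a::ab_group_add"
  assumes "\<And>t. f (t + m) = f t"
  shows "(\<Sum>t<m. f (s + t)) = (\<Sum>t<m. f t)"
proof (induction s)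
  case (Suc s)
  have "f s + (\<Sum>t<m. f (Suc s + t)) = (\<Sum>t<Suc m. f (s + t))"
    by (subst sum.lessThan_Suc_shift) simp
  also have "\<dots> = (\<Sum>t<m. f (s + t)) + f s"
    by (simp add: assms)
  finally have "f s + (\<Sum>t<m. f (Suc s + t)) = f s + (\<Sum>t<m. f t)"
    using Suc by (simp add: add.commute)
  then show ?case
    by (simp only: add_left_cancel)
qed simp

context finite_group
begin

lemma mat_rep_common_size:
  assumes "mat_rep H \<rho>" "mat_rep H \<sigma>"
  obtains n where "\<And>h. h \<in> carrier H \<Longrightarrow> fin_op n (\<rho> h)" "\<And>h. h \<in> carrier H \<Longrightarrow> fin_op n (\<sigma> h)"
proof -
  obtain n m where n: "\<forall>h\<in>carrier H. fin_op n (\<rho> h)" and m: "\<forall>h\<in>carrier H. fin_op m (\<sigma> h)"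
    using assms unfolding mat_rep_def by blast
  show ?thesis
    by (rule that[of "max n m"]) (use n m fin_op_mono in \<open>meson max.cobounded1 max.cobounded2\<close>)+
qed

lemma mat_rep_one: "mat_rep H \<rho> \<Longrightarrow> h \<in> carrier H \<Longrightarrow> \<rho> \<one> (\<rho> h v) = \<rho> h v"
  "mat_rep H \<rho> \<Longrightarrow> h \<in> carrier H \<Longrightarrow> \<rho> h (\<rho> \<one> v) = \<rho> h v"
  by (simp_all add: mat_rep_mult)

lemma ga_monom_smult_rep_mod:
  assumes "h \<in> carrier H"
  shows "ga_monom c h \<odot>\<^bsub>rep_mod H \<rho>\<^esub> v = scl c (\<rho> h v)"
proof -
  have "(\<Sum>g\<in>carrier H. scl (ga_monom c h g) (\<rho> g v)) = (\<Sum>g\<in>carrier H. if h = g then scl c (\<rho> g v) else 0)"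
    by (intro sum.cong refl) (auto simp: ga_monom_def)
  then show ?thesis
    using assms by (simp add: sum.delta')
qed

lemma intertwiner_module_hom:
  assumes "fin_op n T" "\<And>h v. h \<in> carrier H \<Longrightarrow> T (\<rho> h v) = \<sigma> h (T v)"
  shows "T \<in> module_homs CH (rep_mod H \<rho>) (rep_mod H \<sigma>)"
  unfolding module_homs_def
proof (intro CollectI conjI ballI Pi_I)
  fix x assume "x \<in> carrier (rep_mod H \<rho>)"
  then show "T x \<in> carrier (rep_mod H \<sigma>)"
    using assms(2)[of \<one> x] by simp
qed (simp_all add: fin_op_add[OF assms(1)] fin_op_sum[OF assms(1)] fin_op_scl[OF assms(1)] assms(2))

text \<open>A module homomorphism is only controlled on the carrier, that is, on the image of
  \<rho>(1). Composing it with \<rho>(1) gives a matrix defined on all sequences.\<close>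

lemma module_hom_rep_mod:
  assumes \<rho>: "mat_rep H \<rho>" and \<sigma>: "mat_rep H \<sigma>"
    and n: "\<And>h. h \<in> carrier H \<Longrightarrow> fin_op n (\<rho> h)" "\<And>h. h \<in> carrier H \<Longrightarrow> fin_op n (\<sigma> h)"
    and f: "f \<in> module_homs CH (rep_mod H \<rho>) (rep_mod H \<sigma>)"
  shows "fin_op n (\<lambda>v. f (\<rho> \<one> v))" 
    and "\<And>h v. h \<in> carrier H \<Longrightarrow> f (\<rho> h v) = \<sigma> h (f (\<rho> \<one> v))"
proof -
  have add: "f (u + v) = f u + f v" if "\<rho> \<one> u = u" "\<rho> \<one> v = v" for u v
    using f that by (simp add: module_homs_def)
  have hom: "f (scl c (\<rho> h v)) = scl c (\<sigma> h (f v))" if "\<rho> \<one> v = v" "h \<in> carrier H" for c h v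
  proof -
    have "f (ga_monom c h \<odot>\<^bsub>rep_mod H \<rho>\<^esub> v) = ga_monom c h \<odot>\<^bsub>rep_mod H \<sigma>\<^esub> f v"
      using f that(1) ga_monom_closed[OF that(2), of c] unfolding module_homs_def
      by (simp del: CH_simps rep_mod_simps(4))
    then show ?thesis
      unfolding ga_monom_smult_rep_mod[OF that(2)] .
  qed
  have clos: "\<sigma> \<one> (f v) = f v" if "\<rho> \<one> v = v" for v
    using f that by (auto simp: module_homs_def)
  note idem = mat_rep_one[OF \<rho> one_closed]
  show eq: "f (\<rho> h v) = \<sigma> h (f (\<rho> \<one> v))" if "h \<in> carrier H" for h v
    using hom[of "\<rho> \<one> v" h 1] that by (simp add: mat_rep_one[OF \<rho>])
  show "fin_op n (\<lambda>v. f (\<rho> \<one> v))"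
    unfolding fin_op_def
  proof (intro conjI allI impI)
    fix u v :: "nat \<Rightarrow> complex" and c i
    show "f (\<rho> \<one> (u + v)) = f (\<rho> \<one> u) + f (\<rho> \<one> v)"
      by (simp add: fin_op_add[OF n(1)] add idem)
    show "f (\<rho> \<one> (scl c v)) = scl c (f (\<rho> \<one> v))"
      using hom[of "\<rho> \<one> v" \<one> c] by (simp add: fin_op_scl[OF n(1)] idem clos)
    show "f (\<rho> \<one> (\<lambda>i. if i < n then v i else 0)) = f (\<rho> \<one> v)"
      using n(1)[OF one_closed] by (simp add: fin_op_def)
    show "f (\<rho> \<one> v) i = 0" if "i \<ge> n"
      using clos[of "\<rho> \<one> v"] fin_op_beyond[OF n(2)[OF one_closed] that, of "f (\<rho> \<one> v)"] by (simp add: idem)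
  qed
qed

text \<open>The sequence is split by matrices \<open>R\<close> and \<open>S\<close> with X R + S Y =
  \<sigma>(1), R X = \<rho>(1) and Y S = \<tau>(1). They need not commute with the group: cyclicity
  of the trace moves \<open>R\<close> and \<open>Y\<close> to the front, and there \<open>X\<close>
  and \<open>Y\<close> absorb the group action.\<close>

lemma op_trace_short_exact:
  assumes \<rho>: "mat_rep H \<rho>" and \<sigma>: "mat_rep H \<sigma>" and \<tau>: "mat_rep H \<tau>"
    and ex: "short_exact CH (rep_mod H \<rho>) (rep_mod H \<sigma>) (rep_mod H \<tau>)"
    and h: "h \<in> carrier H"
  shows "op_trace (\<sigma> h) = op_trace (\<rho> h) + op_trace (\<tau> h)"
proof -
  obtain n1 where n1: "\<And>h. h \<in> carrier H \<Longrightarrow> fin_op n1 (\<rho> h)" "\<And>h. h \<in> carrier H \<Longrightarrow> fin_op n1 (\<sigma> h)"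
    using mat_rep_common_size[OF \<rho> \<sigma>] by blast
  obtain n2 where n2: "\<And>h. h \<in> carrier H \<Longrightarrow> fin_op n2 (\<tau> h)"
    using mat_rep_common_size[OF \<tau> \<tau>] by blast
  define n where "n = max n1 n2"
  have nr: "fin_op n (\<rho> h)" and ns: "fin_op n (\<sigma> h)" and nt: "fin_op n (\<tau> h)" if "h \<in> carrier H" for h
    using n1 n2 that fin_op_mono unfolding n_def by (meson max.cobounded1 max.cobounded2)+
  obtain f g where f: "f \<in> module_homs CH (rep_mod H \<rho>) (rep_mod H \<sigma>)"
    and g: "g \<in> module_homs CH (rep_mod H \<sigma>) (rep_mod H \<tau>)"
    and inj: "inj_on f {v. \<rho> \<one> v = v}" and surj: "g ` {v. \<sigma> \<one> v = v} = {v. \<tau> \<one> v = v}"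
    and ker: "f ` {v. \<rho> \<one> v = v} = {v \<in> {v. \<sigma> \<one> v = v}. g v = 0}"
    using ex unfolding short_exact_def rep_mod_simps by blast
  define X where "X v = f (\<rho> \<one> v)" for v
  define Y where "Y v = g (\<sigma> \<one> v)" for v
  have X: "fin_op n X"
    unfolding X_def by (rule module_hom_rep_mod(1)[OF \<rho> \<sigma> nr ns f])
  have Xh: "X (\<rho> h v) = \<sigma> h (X v)" if "h \<in> carrier H" for h v
    unfolding X_def mat_rep_one(1)[OF \<rho> that] by (rule module_hom_rep_mod(2)[OF \<rho> \<sigma> nr ns f that])
  have Y: "fin_op n Y"
    unfolding Y_def by (rule module_hom_rep_mod(1)[OF \<sigma> \<tau> ns nt g])
  have Yh: "Y (\<sigma> h v) = \<tau> h (Y v)" if "h \<in> carrier H" for h v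
    unfolding Y_def mat_rep_one(1)[OF \<sigma> that] by (rule module_hom_rep_mod(2)[OF \<sigma> \<tau> ns nt g that])
  note idem = mat_rep_one[OF \<rho> one_closed] mat_rep_one[OF \<sigma> one_closed] mat_rep_one[OF \<tau> one_closed]
  have YX: "Y (X v) = 0" for v
  proof -
    have "f (\<rho> \<one> v) \<in> f ` {v. \<rho> \<one> v = v}"
      by (simp add: idem)
    then show ?thesis
      unfolding ker by (simp add: X_def Y_def)
  qed
  obtain S0 where S0: "fin_op n S0" "\<And>v. Y (S0 (Y v)) = Y v"
    using fin_op_generalized_inverse[OF Y] by blast
  \<comment> \<open>Placing \<open>S0\<close> between the two idempotents makes \<open>S\<close>
    take values in the middle module and upgrades the generalized inverse to a section of
    \<open>Y\<close>.\<close>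
  define S where "S v = \<sigma> \<one> (S0 (\<tau> \<one> v))" for v
  have S: "fin_op n S"
    using fin_op_comp[OF ns[OF one_closed] fin_op_comp[OF S0(1) nt[OF one_closed]]] by (simp add: S_def[abs_def])
  have YS: "Y (S v) = \<tau> \<one> v" for v
  proof -
    have "\<tau> \<one> v \<in> g ` {v. \<sigma> \<one> v = v}"
      unfolding surj by (simp add: idem)
    then obtain x where "\<tau> \<one> v = g x" "\<sigma> \<one> x = x"
      by auto
    then have "\<tau> \<one> v = Y x"
      by (simp add: Y_def)
    moreover have "Y (\<sigma> \<one> w) = Y w" for w
      by (simp add: Y_def idem)
    ultimately show ?thesis
      using S0(2)[of x] by (simp add: S_def)
  qed
  \<comment> \<open>The projection complementary to S Y. Its values are killed by \<open>g\<close>,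
    hence lie in the image of \<open>f\<close>, and \<open>R\<close> divides them by the injective
    \<open>f\<close>.\<close>
  define D where "D v = \<sigma> \<one> v - S (Y v)" for v
  have D: "fin_op n D"
    unfolding D_def using fin_op_minus[OF ns[OF one_closed] fin_op_comp[OF S Y]] .
  define R where "R v = inv_into {v. \<rho> \<one> v = v} f (D v)" for v
  have Dim: "D v \<in> f ` {v. \<rho> \<one> v = v}" for v
  proof -
    have "\<sigma> \<one> (D v) = D v"
      unfolding D_def fin_op_diff[OF ns[OF one_closed]] by (simp add: idem S_def)
    moreover have "Y (D v) = 0"
      unfolding D_def fin_op_diff[OF Y] by (simp add: YS Yh)
    ultimately show ?thesis
      unfolding ker by (simp add: Y_def)
  qed
  have fR: "f (R v) = D v" and R1: "\<rho> \<one> (R v) = R v" for v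
    using f_inv_into_f[OF Dim[of v]] inv_into_into[OF Dim[of v]] by (auto simp: R_def)
  have XR: "X (R v) = D v" for v
    by (simp add: X_def fR R1)
  have uniq: "R v = u" if "\<rho> \<one> u = u" "X u = D v" for u v
    using that inj_onD[OF inj, of "R v" u] R1 fR by (simp add: X_def)
  note [simp] = fin_op_add[OF nr[OF one_closed]] fin_op_add[OF X] fin_op_add[OF D]
    fin_op_scl[OF nr[OF one_closed]] fin_op_scl[OF X] fin_op_scl[OF D]
  have R: "fin_op n R"
    unfolding fin_op_def
  proof (intro conjI allI impI)
    fix u v :: "nat \<Rightarrow> complex" and c i
    show "R (u + v) = R u + R v" "R (scl c v) = scl c (R v)"
      by (rule uniq; simp add: R1 XR)+
    show "R (\<lambda>i. if i < n then v i else 0) = R v"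
      using D by (simp add: R_def fin_op_def)
    show "R v i = 0" if "i \<ge> n"
      using R1[of v] fin_op_beyond[OF nr[OF one_closed] that, of "R v"] by simp
  qed
  have RX: "R (X v) = \<rho> \<one> v" for v
  proof (rule uniq)
    show "X (\<rho> \<one> v) = D (X v)"
      unfolding D_def YX by (simp add: fin_op_0[OF S]) (simp add: Xh[symmetric])
  qed (simp add: idem)
  \<comment> \<open>The decomposition \<sigma>(1) = X R + S Y is multiplied by \<sigma>(h) from the
    left.\<close>
  have "op_trace (\<sigma> h) = op_trace (\<lambda>v. \<sigma> h (X (R v)) + \<sigma> h (S (Y v)))"
  proof (rule arg_cong[where f = op_trace])
    have "\<sigma> h (X (R v)) + \<sigma> h (S (Y v)) = \<sigma> h v" for v
    proof -
      have "X (R v) + S (Y v) = \<sigma> \<one> v"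
        by (simp add: XR D_def)
      then show ?thesis
        using fin_op_add[OF ns[OF h], of "X (R v)" "S (Y v)"] mat_rep_one[OF \<sigma> h] by simp
    qed
    then show "\<sigma> h = (\<lambda>v. \<sigma> h (X (R v)) + \<sigma> h (S (Y v)))"
      by auto
  qed
  also have "\<dots> = op_trace (\<lambda>v. \<sigma> h (X (R v))) + op_trace (\<lambda>v. \<sigma> h (S (Y v)))"
    by (intro op_trace_plus[of n] fin_op_comp[OF fin_op_comp[OF ns[OF h] X] R] fin_op_comp[OF fin_op_comp[OF ns[OF h] S] Y])
  also have "op_trace (\<lambda>v. \<sigma> h (X (R v))) = op_trace (\<lambda>v. R (\<sigma> h (X v)))"
    by (rule op_trace_comm[OF fin_op_comp[OF ns[OF h] X] R])
  also have "(\<lambda>v. R (\<sigma> h (X v))) = \<rho> h"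
    by (simp add: Xh[OF h, symmetric] RX mat_rep_one[OF \<rho> h])
  also have "op_trace (\<lambda>v. \<sigma> h (S (Y v))) = op_trace (\<lambda>v. Y (\<sigma> h (S v)))"
    by (rule op_trace_comm[OF fin_op_comp[OF ns[OF h] S] Y])
  also have "(\<lambda>v. Y (\<sigma> h (S v))) = \<tau> h"
    by (simp add: Yh[OF h] YS mat_rep_one[OF \<tau> h])
  finally show ?thesis .
qed

section \<open>Transport of exact sequences along isomorphisms\<close>

lemma module_homs_compose:
  assumes "f \<in> module_homs CH L M" "g \<in> module_homs CH M N"
  shows "(\<lambda>x. g (f x)) \<in> module_homs CH L N"
  using assms unfolding module_homs_def by (auto simp: Pi_iff)

lemma module_homs_inv_into:
  assumes M: "left_module CH M" and f: "f \<in> module_homs CH M N" and bij: "bij_betw f (carrier M) (carrier N)"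
  shows "inv_into (carrier M) f \<in> module_homs CH N M"
proof -
  interpret left_module CH M by fact
  let ?g = "inv_into (carrier M) f"
  have gc: "?g y \<in> carrier M" and fg: "f (?g y) = y" if "y \<in> carrier N" for y
    using that bij by (auto simp: bij_betw_def inv_into_into f_inv_into_f)
  have gf: "?g (f x) = x" if "x \<in> carrier M" for x
    using that bij by (auto simp: bij_betw_def)
  show ?thesis
    unfolding module_homs_def
  proof (intro CollectI conjI ballI Pi_I gc)
    fix x y assume "x \<in> carrier N" "y \<in> carrier N"
    then show "?g (x \<oplus>\<^bsub>N\<^esub> y) = ?g x \<oplus>\<^bsub>M\<^esub> ?g y"
      using f gc fg gf[of "?g x \<oplus>\<^bsub>M\<^esub> ?g y"] by (simp add: module_homs_def)
  next
    fix a x assume a: "a \<in> carrier CH" and x: "x \<in> carrier N"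
    then show "?g (a \<odot>\<^bsub>N\<^esub> x) = a \<odot>\<^bsub>M\<^esub> ?g x"
      using f gc[OF x] fg[OF x] gf[OF smult_closed[OF a gc[OF x]]] by (simp add: module_homs_def del: CH_simps)
  qed
qed

lemma module_iso_sym: "left_module CH M \<Longrightarrow> module_iso M N \<Longrightarrow> module_iso N M"
  unfolding module_iso_def using module_homs_inv_into bij_betw_inv_into by blast

lemma module_hom_zero:
  assumes "left_module CH M" "left_module CH N" "f \<in> module_homs CH M N"
  shows "f \<zero>\<^bsub>M\<^esub> = \<zero>\<^bsub>N\<^esub>"
proof -
  interpret M: left_module CH M by fact
  interpret N: left_module CH N by fact
  have "f \<zero>\<^bsub>M\<^esub> \<oplus>\<^bsub>N\<^esub> f \<zero>\<^bsub>M\<^esub> = f \<zero>\<^bsub>M\<^esub>" "f \<zero>\<^bsub>M\<^esub> \<in> carrier N"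
    using assms(3) by (auto simp: module_homs_def dest: bspec[of _ _ "\<zero>\<^bsub>M\<^esub>"])
  then show ?thesis by simp
qed

text \<open>Traces are available for matrix representations only, so an exact sequence of arbitrary
  modules is replaced by one of representations.\<close>

lemma short_exact_module_iso:
  assumes mods: "left_module CH L" "left_module CH M" "left_module CH N" "left_module CH N'"
    and iso: "module_iso L L'" "module_iso M M'" "module_iso N N'"
    and ex: "short_exact CH L M N"
  shows "short_exact CH L' M' N'"
proof -
  obtain f g where f: "f \<in> module_homs CH L M" and g: "g \<in> module_homs CH M N"
    and inj: "inj_on f (carrier L)" and surj: "g ` carrier M = carrier N"
    and ker: "f ` carrier L = {x \<in> carrier M. g x = \<zero>\<^bsub>N\<^esub>}"
    using ex unfolding short_exact_def by auto
  obtain l where l: "l \<in> module_homs CH L' L" "bij_betw l (carrier L') (carrier L)"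
    using module_iso_sym[OF mods(1) iso(1)] by (auto simp: module_iso_def)
  obtain m where m: "m \<in> module_homs CH M M'" "bij_betw m (carrier M) (carrier M')"
    using iso(2) by (auto simp: module_iso_def)
  define m' where "m' = inv_into (carrier M) m"
  have m': "m' \<in> module_homs CH M' M" "bij_betw m' (carrier M') (carrier M)"
    "\<And>x. x \<in> carrier M \<Longrightarrow> m' (m x) = x" "\<And>x. x \<in> carrier M' \<Longrightarrow> m (m' x) = x"
    unfolding m'_def using module_homs_inv_into[OF mods(2) m] bij_betw_inv_into[OF m(2)] m(2)
    by (auto simp: bij_betw_def f_inv_into_f)
  obtain k where k: "k \<in> module_homs CH N N'" "bij_betw k (carrier N) (carrier N')"
    using iso(3) by (auto simp: module_iso_def)
  define f' where "f' x = m (f (l x))" for x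
  define g' where "g' x = k (g (m' x))" for x
  have f': "f' \<in> module_homs CH L' M'"
    unfolding f'_def by (rule module_homs_compose[OF l(1) module_homs_compose[OF f m(1)]])
  have g': "g' \<in> module_homs CH M' N'"
    unfolding g'_def by (rule module_homs_compose[OF m'(1) module_homs_compose[OF g k(1)]])
  have fM: "f ` carrier L \<subseteq> carrier M" and m'M: "m' ` carrier M' = carrier M"
    and lL: "l ` carrier L' = carrier L" and mM: "m ` carrier M = carrier M'" and kN: "k ` carrier N = carrier N'"
    using ker m'(2) l(2) m(2) k(2) by (auto simp: bij_betw_def)
  have "inj_on f' (carrier L')"
  proof (rule inj_onI)
    fix x y assume xy: "x \<in> carrier L'" "y \<in> carrier L'" and eq: "f' x = f' y"
    then have L: "l x \<in> carrier L" "l y \<in> carrier L"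
      using lL by auto
    then have "f (l x) \<in> carrier M" "f (l y) \<in> carrier M"
      using fM by (auto simp: image_subset_iff)
    then have "m' (f' x) = f (l x)" "m' (f' y) = f (l y)"
      unfolding f'_def by (simp_all add: m'(3))
    then have "f (l x) = f (l y)"
      unfolding eq by (rule trans[OF sym])
    then show "x = y"
      using inj_onD[OF inj _ L] xy inj_onD[OF bij_betw_imp_inj_on[OF l(2)]] by blast
  qed
  moreover have "g' ` carrier M' = carrier N'"
    unfolding g'_def image_image[symmetric, of "\<lambda>x. k (g x)" m'] image_image[symmetric, of k g] m'M surj kN ..
  moreover have "f' ` carrier L' = {x \<in> carrier M'. g' x = \<zero>\<^bsub>N'\<^esub>}"
  proof -
    interpret N: left_module CH N by (rule mods)
    have k0: "k \<zero>\<^bsub>N\<^esub> = \<zero>\<^bsub>N'\<^esub>"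
      by (rule module_hom_zero[OF mods(3,4) k(1)])
    have gz: "k (g y) = \<zero>\<^bsub>N'\<^esub> \<longleftrightarrow> g y = \<zero>\<^bsub>N\<^esub>" if "y \<in> carrier M" for y
    proof -
      have "g y \<in> carrier N"
        using surj that by blast
      then show ?thesis
        unfolding k0[symmetric] by (rule inj_on_eq_iff[OF bij_betw_imp_inj_on[OF k(2)]]) simp
    qed
    have "f' ` carrier L' = m ` {x \<in> carrier M. g x = \<zero>\<^bsub>N\<^esub>}"
    proof -
      have "f' ` carrier L' = m ` (f ` (l ` carrier L'))"
        unfolding f'_def image_image ..
      then show ?thesis
        unfolding lL ker .
    qed
    also have "\<dots> = {x \<in> carrier M'. g' x = \<zero>\<^bsub>N'\<^esub>}"
    proof safe
      fix x assume x: "x \<in> carrier M" "g x = \<zero>\<^bsub>N\<^esub>"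
      then show "m x \<in> carrier M'" "g' (m x) = \<zero>\<^bsub>N'\<^esub>"
        using mM by (auto simp: g'_def m'(3) k0)
    next
      fix x assume x: "x \<in> carrier M'" "g' x = \<zero>\<^bsub>N'\<^esub>"
      have "m' x \<in> carrier M"
        using x(1) m'M by blast
      then show "x \<in> m ` {x \<in> carrier M. g x = \<zero>\<^bsub>N\<^esub>}"
        using x gz m'(4)[OF x(1)] by (intro image_eqI[of _ _ "m' x"]) (auto simp: g'_def)
    qed
    finally show ?thesis .
  qed
  ultimately show ?thesis
    unfolding short_exact_def using f' g' by blast
qed

end

section \<open>Characters and the relations of the Grothendieck group\<close>

text \<open>Discrete Fourier inversion on \<int>/m. For f(t) = tr \<rho>(h^t) the inner expression
  is the multiplicity of the eigenvalue \<zeta>^a of \<rho>(h), so a character is recovered from its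
  multiplicities.\<close>

lemma fourier_inversion:
  fixes f :: "nat \<Rightarrow> complex"
  assumes m: "m > 0" and f: "\<And>t. f (t + m) = f t"
  shows "(\<Sum>a<m. root_unity m (int a * int t) * ((1 / of_nat m) * (\<Sum>s<m. root_unity m (- (int a * int s)) * f s))) = f t"
proof -
  have fmod: "f (t mod m) = f t" for t
  proof -
    have "f (s + k * m) = f s" for s k
    proof (induction k)
      case (Suc k)
      then show ?case
        using f[of "s + k * m"] by (simp add: algebra_simps)
    qed simp
    from this[of "t mod m" "t div m"] show ?thesis by simp
  qed
  have "(\<Sum>a<m. root_unity m (int a * int t) * ((1 / of_nat m) * (\<Sum>s<m. root_unity m (- (int a * int s)) * f s)))
      = (\<Sum>a<m. \<Sum>s<m. (f s / of_nat m) * root_unity m (int a * (int t - int s)))"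
    by (simp add: sum_distrib_left right_diff_distrib root_unity_add[of m "int a * int t" "- (int a * int s)" for a s, simplified]
        mult_ac)
  also have "\<dots> = (\<Sum>s<m. (f s / of_nat m) * (\<Sum>a<m. root_unity m (int a * (int t - int s))))"
    by (subst sum.swap) (simp add: sum_distrib_left)
  also have "\<dots> = (\<Sum>s<m. if t mod m = s then f s else 0)"
  proof (intro sum.cong refl)
    fix s assume "s \<in> {..<m}"
    then have "int m dvd int t - int s \<longleftrightarrow> t mod m = s"
      by (metis lessThan_iff mod_eq_dvd_iff mod_less of_nat_eq_iff zmod_int)
    then show "(f s / of_nat m) * (\<Sum>a<m. root_unity m (int a * (int t - int s))) = (if t mod m = s then f s else 0)"
      using m by (simp add: sum_root_unity)
  qed
  also have "\<dots> = f t"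
    using m by (simp add: fmod)
  finally show ?thesis .
qed

context finite_group
begin

lemma mat_rep_zero: "mat_rep H (\<lambda>h v. 0)"
  by (auto simp: mat_rep_def fin_op_zero)

text \<open>Turns an isomorphism into a defining relation of the Grothendieck group. The zero module
  is given by the zero representation, which the non-unital format admits.\<close>

lemma short_exact_of_iso:
  assumes N: "left_module CH N" and iso: "module_iso M N"
  shows "short_exact CH M N (rep_mod H (\<lambda>h v. 0))"
proof -
  interpret N: left_module CH N by (rule N)
  obtain f where f: "f \<in> module_homs CH M N" and bij: "bij_betw f (carrier M) (carrier N)"
    using iso by (auto simp: module_iso_def)
  have "(\<lambda>x. 0) \<in> module_homs CH N (rep_mod H (\<lambda>h v. 0))"
    by (auto simp: module_homs_def)
  moreover have "(\<lambda>x. 0) ` carrier N = carrier (rep_mod H (\<lambda>h v. 0))"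
    using N.M.zero_closed by auto
  moreover have "inj_on f (carrier M)" "f ` carrier M = {x \<in> carrier N. 0 = \<zero>\<^bsub>rep_mod H (\<lambda>h v. 0)\<^esub>}"
    using bij by (auto simp: bij_betw_def)
  ultimately show ?thesis
    using f unfolding short_exact_def by blast
qed

lemma op_trace_module_iso:
  assumes "mat_rep H \<rho>" "mat_rep H \<sigma>" "module_iso (rep_mod H \<rho>) (rep_mod H \<sigma>)" "h \<in> carrier H"
  shows "op_trace (\<rho> h) = op_trace (\<sigma> h)"
  using op_trace_short_exact[OF assms(1,2) mat_rep_zero short_exact_of_iso[OF left_module_rep_mod[OF assms(2)] assms(3)] assms(4)]
  by (simp add: op_trace_zero)

text \<open>The choice is harmless: only traces of the chosen representation are used, and these are
  invariant under isomorphism by \<open>op_trace_module_iso\<close>.\<close>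

definition mod_rep :: "('g, complex) rep_module \<Rightarrow> 'g \<Rightarrow> (nat \<Rightarrow> complex) \<Rightarrow> nat \<Rightarrow> complex" where
  "mod_rep M = (SOME \<rho>. mat_rep H \<rho> \<and> module_iso M (rep_mod H \<rho>))"

definition mod_char :: "('g, complex) rep_module \<Rightarrow> 'g \<Rightarrow> complex" where
  "mod_char M h = op_trace (mod_rep M h)"

lemma mod_rep:
  assumes "M \<in> fg_modules CH"
  shows "mat_rep H (mod_rep M)" "module_iso M (rep_mod H (mod_rep M))"
proof -
  have "\<exists>\<rho>. mat_rep H \<rho> \<and> module_iso M (rep_mod H \<rho>)"
    using fg_module_iso_rep_mod[of M] assms unfolding fg_modules_def by blast
  from someI_ex[OF this] show "mat_rep H (mod_rep M)" "module_iso M (rep_mod H (mod_rep M))"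
    unfolding mod_rep_def by auto
qed

lemma fg_left_module: "M \<in> fg_modules CH \<Longrightarrow> left_module CH M"
  by (simp add: fg_modules_def finitely_generated_module_def)

lemma mod_char_short_exact:
  assumes "L \<in> fg_modules CH" "M \<in> fg_modules CH" "N \<in> fg_modules CH"
    and "short_exact CH L M N" "h \<in> carrier H"
  shows "mod_char M h = mod_char L h + mod_char N h"
  unfolding mod_char_def
proof (rule op_trace_short_exact)
  show "short_exact CH (rep_mod H (mod_rep L)) (rep_mod H (mod_rep M)) (rep_mod H (mod_rep N))"
    by (rule short_exact_module_iso[of L M N])
      (use assms mod_rep fg_left_module left_module_rep_mod in blast)+
qed (use assms mod_rep in blast)+

lemma mod_char_rep_mod:
  assumes "mat_rep H \<rho>" "h \<in> carrier H"
  shows "mod_char (rep_mod H \<rho>) h = op_trace (\<rho> h)"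
  unfolding mod_char_def using mod_rep[OF fg_rep_mod[OF assms(1)]]
  by (intro op_trace_module_iso[symmetric]) (use assms in auto)

lemma mod_char_iso:
  assumes "M \<in> fg_modules CH" "N \<in> fg_modules CH" "module_iso M N" "h \<in> carrier H"
  shows "mod_char M h = mod_char N h"
  using mod_char_short_exact[OF assms(1,2) fg_rep_mod[OF mat_rep_zero] short_exact_of_iso[OF fg_left_module[OF assms(2)] assms(3)] assms(4)]
  by (simp add: mod_char_rep_mod[OF mat_rep_zero assms(4)] op_trace_zero)

section \<open>Characters of formal combinations and the subgroup of relations\<close>

definition frag_char :: "(('g, complex) rep_module \<Rightarrow>\<^sub>0 int) \<Rightarrow> 'g \<Rightarrow> complex" where
  "frag_char p h = (\<Sum>M\<in>Poly_Mapping.keys p. of_int (Poly_Mapping.lookup p M) * mod_char M h)"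

lemma frag_char_superset:
  assumes "finite S" "Poly_Mapping.keys p \<subseteq> S"
  shows "frag_char p h = (\<Sum>M\<in>S. of_int (Poly_Mapping.lookup p M) * mod_char M h)"
  unfolding frag_char_def using assms
  by (intro sum.mono_neutral_left) (auto simp: in_keys_iff)

lemma frag_char_simps [simp]:
  "frag_char 0 h = 0" "frag_char (p + q) h = frag_char p h + frag_char q h"
  "frag_char (- p) h = - frag_char p h" "frag_char (p - q) h = frag_char p h - frag_char q h"
  "frag_char (frag_of M) h = mod_char M h"
proof -
  let ?S = "Poly_Mapping.keys p \<union> Poly_Mapping.keys q"
  have S: "finite ?S" "Poly_Mapping.keys p \<subseteq> ?S" "Poly_Mapping.keys q \<subseteq> ?S"
    "Poly_Mapping.keys (p + q) \<subseteq> ?S" "Poly_Mapping.keys (p - q) \<subseteq> ?S" "Poly_Mapping.keys (- p) \<subseteq> ?S"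
    using Poly_Mapping.keys_add[of p q] keys_diff[of p q] by auto
  note e = frag_char_superset[OF S(1)]
  show "frag_char 0 h = 0" "frag_char (frag_of M) h = mod_char M h"
    by (simp_all add: frag_char_def)
  show "frag_char (p + q) h = frag_char p h + frag_char q h"
    unfolding e[OF S(2)] e[OF S(3)] e[OF S(4)] by (simp add: lookup_add ring_distribs sum.distrib)
  show "frag_char (p - q) h = frag_char p h - frag_char q h"
    unfolding e[OF S(2)] e[OF S(3)] e[OF S(5)] by (simp add: lookup_minus ring_distribs sum_subtractf)
  show "frag_char (- p) h = - frag_char p h"
    unfolding e[OF S(2)] e[OF S(6)] by (simp add: sum_negf)
qed

abbreviation exact_null :: "(('g, complex) rep_module \<Rightarrow>\<^sub>0 int) set" where
  "exact_null \<equiv> exact_subgroup CH"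

lemma subgroup_exact_null: "subgroup exact_null (free_Abelian_group (fg_modules CH))"
proof -
  interpret F: group "free_Abelian_group (fg_modules CH :: ('g, complex) rep_module set)" by simp
  have "exact_relations CH \<subseteq> carrier (free_Abelian_group (fg_modules CH :: ('g, complex) rep_module set))"
    unfolding exact_relations_def using keys_diff keys_add
    by (fastforce simp: subset_iff split: if_splits)
  then show ?thesis
    unfolding exact_subgroup_def by (rule F.generate_is_subgroup)
qed

lemma exact_null_simps:
  "0 \<in> exact_null" "p \<in> exact_null \<Longrightarrow> q \<in> exact_null \<Longrightarrow> p + q \<in> exact_null"
  "p \<in> exact_null \<Longrightarrow> Poly_Mapping.keys p \<subseteq> fg_modules CH"
  "p \<in> exact_null \<Longrightarrow> - p \<in> exact_null" "p \<in> exact_null \<Longrightarrow> q \<in> exact_null \<Longrightarrow> p - q \<in> exact_null"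
proof -
  show 0: "0 \<in> exact_null"
    using subgroup.one_closed[OF subgroup_exact_null] by simp
  show add: "p \<in> exact_null \<Longrightarrow> q \<in> exact_null \<Longrightarrow> p + q \<in> exact_null" for p q
    using subgroup.m_closed[OF subgroup_exact_null] by simp
  show k: "p \<in> exact_null \<Longrightarrow> Poly_Mapping.keys p \<subseteq> fg_modules CH" for p
    using subgroup.mem_carrier[OF subgroup_exact_null] by simp
  show m: "p \<in> exact_null \<Longrightarrow> - p \<in> exact_null" for p
    using subgroup.m_inv_closed[OF subgroup_exact_null, of p] k[of p] by simp
  show "p \<in> exact_null \<Longrightarrow> q \<in> exact_null \<Longrightarrow> p - q \<in> exact_null"
    using add[OF _ m] by fastforce
qed

lemma frag_char_exact_null:
  assumes "p \<in> exact_null" "h \<in> carrier H"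
  shows "frag_char p h = 0"
proof -
  interpret F: group "free_Abelian_group (fg_modules CH :: ('g, complex) rep_module set)" by simp
  have rel: "frag_char r h = 0 \<and> Poly_Mapping.keys r \<subseteq> fg_modules CH" if "r \<in> exact_relations CH" for r
  proof -
    have "r \<in> exact_null"
      unfolding exact_subgroup_def by (rule generate.incl[OF that])
    moreover have "frag_char r h = 0"
      using that mod_char_short_exact[OF _ _ _ _ assms(2)] unfolding exact_relations_def by fastforce
    ultimately show ?thesis
      using exact_null_simps(3) by blast
  qed
  from assms(1) show ?thesis
    unfolding exact_subgroup_def
  proof (induction rule: generate.induct)
    case (inv r)
    then show ?case using rel[OF inv] by simp
  qed (use rel in auto)
qed

lemma exact_null_rel:
  assumes "L \<in> fg_modules CH" "M \<in> fg_modules CH" "N \<in> fg_modules CH" "short_exact CH L M N"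
  shows "frag_of M - (frag_of L + frag_of N) \<in> exact_null"
  unfolding exact_subgroup_def exact_relations_def
  by (rule generate.incl) (use assms in blast)

lemma module_iso_refl: "module_iso M M"
  unfolding module_iso_def by (rule bexI[of _ "\<lambda>x. x"]) (auto simp: module_homs_def bij_betw_def)

lemma exact_null_zero: "frag_of (rep_mod H (\<lambda>h v. 0)) \<in> exact_null"
proof -
  note z = fg_rep_mod[OF mat_rep_zero]
  have "short_exact CH (rep_mod H (\<lambda>h v. 0)) (rep_mod H (\<lambda>h v. 0)) (rep_mod H (\<lambda>h v. 0))"
    by (rule short_exact_of_iso[OF left_module_rep_mod[OF mat_rep_zero] module_iso_refl])
  from exact_null_simps(4)[OF exact_null_rel[OF z z z this]] show ?thesis by simp
qed

lemma exact_null_iso: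
  assumes "M \<in> fg_modules CH" "N \<in> fg_modules CH" "module_iso M N"
  shows "frag_of N - frag_of M \<in> exact_null"
  using exact_null_simps(2)[OF exact_null_rel[OF assms(1,2) fg_rep_mod[OF mat_rep_zero]
      short_exact_of_iso[OF fg_left_module[OF assms(2)] assms(3)]] exact_null_zero] by simp

section \<open>Eigenvalue multiplicities and characters at inverses\<close>

text \<open>The expression is the trace of the projection P = (1/m) \<Sum>_s \<zeta>^(-as)
  \<rho>(h^s) onto the \<zeta>^a-eigenspace of \<rho>(h) inside the image of \<rho>(1). Idempotence
  of \<open>P\<close> is a shift of the summation over \<int>/m.\<close>

lemma rep_multiplicity_nat:
  assumes \<rho>: "mat_rep H \<rho>" and h: "h \<in> carrier H" and m: "m > 0" "h [^] m = \<one>"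
  shows "\<exists>k::nat. (1 / of_nat m) * (\<Sum>s<m. root_unity m (- (int a * int s)) * op_trace (\<rho> (h [^] s))) = of_nat k"
proof -
  obtain n where n: "\<And>h. h \<in> carrier H \<Longrightarrow> fin_op n (\<rho> h)"
    using \<rho> unfolding mat_rep_def by blast
  have np: "fin_op n (\<rho> (h [^] s))" for s :: nat
    by (rule n) (use h in simp)
  define F where "F v s = scl (root_unity m (- (int a * int s)) / of_nat m) (\<rho> (h [^] s) v)" for v and s :: nat
  define P where "P v = (\<Sum>s<m. F v s)" for v
  have P: "fin_op n P"
    unfolding P_def[abs_def] F_def by (rule fin_op_summed) (rule fin_op_scaled[OF np])
  have per: "F v (t + m) = F v t" for v t
  proof -
    have "h [^] (t + m) = h [^] t"
      using h m(2) nat_pow_mult[OF h, of t m] by simp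
    moreover have "root_unity m (- (int a * int (t + m))) = root_unity m (- (int a * int t))"
      using root_unity_add[of m "- (int a * int t)" "int m * - int a"] root_unity_period[OF m(1), of "- int a"]
      by (simp add: algebra_simps)
    ultimately show ?thesis
      by (simp add: F_def)
  qed
  have "P (P v) = P v" for v
  proof -
    have "P (P v) = (\<Sum>s<m. scl (1 / of_nat m) (\<Sum>t<m. F v (s + t)))"
      unfolding P_def[of "P v"]
    proof (intro sum.cong refl)
      fix s
      have "scl (root_unity m (- (int a * int s)) / of_nat m) (\<rho> (h [^] s) (F v t)) = scl (1 / of_nat m) (F v (s + t))" for t
      proof -
        have "root_unity m (- (int a * int (s + t))) = root_unity m (- (int a * int s)) * root_unity m (- (int a * int t))"
          by (simp add: algebra_simps flip: root_unity_add)
        then show ?thesis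
          using h mat_rep_mult[OF \<rho>, of "h [^] s" "h [^] t" v] nat_pow_mult[OF h, of s t]
          by (simp add: F_def fin_op_scl[OF np])
      qed
      then show "F (P v) s = scl (1 / of_nat m) (\<Sum>t<m. F v (s + t))"
        unfolding F_def[where v = "P v"] unfolding P_def by (simp only: fin_op_sum[OF np] cvec.scale_sum_right)
    qed
    also have "\<dots> = (\<Sum>s<m. scl (1 / of_nat m) (P v))"
      unfolding P_def by (subst sum_periodic[of "F v" m, OF per]) simp
    also have "\<dots> = P v"
      using m(1) by (auto simp: fun_eq_iff)
    finally show ?thesis .
  qed
  then obtain k :: nat where "op_trace P = of_nat k"
    using op_trace_idempotent[OF P] by metis
  moreover have "op_trace P = (\<Sum>s<m. op_trace (\<lambda>v. F v s))"
    unfolding P_def[abs_def] F_def by (rule op_trace_summed) (rule fin_op_scaled[OF np])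
  moreover have "op_trace (\<lambda>v. F v s) = (1 / of_nat m) * (root_unity m (- (int a * int s)) * op_trace (\<rho> (h [^] s)))" for s
    unfolding F_def by (simp add: op_trace_scaled[OF np])
  ultimately show ?thesis
    by (auto simp: sum_distrib_left)
qed

text \<open>By Fourier inversion tr \<rho>(h^t) is \<Sum>_a \<zeta>^(at) k_a with real
  multiplicities k_a. Passing from h to h^-1 = h^(m-1) replaces every \<zeta>^a by its
  conjugate.\<close>

lemma rep_char_inv:
  assumes \<rho>: "mat_rep H \<rho>" and h: "h \<in> carrier H"
  shows "op_trace (\<rho> (inv h)) = cnj (op_trace (\<rho> h))"
proof -
  define m where "m = order H"
  have m: "m > 0" "h [^] m = \<one>"
    using pow_order_eq_1[OF h] order_gt_0_iff_finite by (auto simp: m_def)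
  define k where "k a = (1 / of_nat m) * (\<Sum>s<m. root_unity m (- (int a * int s)) * op_trace (\<rho> (h [^] s)))" for a
  have real: "cnj (k a) = k a" for a
    using rep_multiplicity_nat[OF \<rho> h m, of a] unfolding k_def by (metis complex_cnj_of_nat)
  have "h [^] (t + m) = h [^] t" for t
    using h m(2) nat_pow_mult[OF h, of t m] by simp
  then have inv: "op_trace (\<rho> (h [^] t)) = (\<Sum>a<m. root_unity m (int a * int t) * k a)" for t
    unfolding k_def by (intro fourier_inversion[symmetric] m) simp
  have "h [^] (m - 1) \<otimes> h = \<one>"
    using nat_pow_mult[OF h, of "m - 1" 1] m h by simp
  then have "inv h = h [^] (m - 1)"
    using h by (intro inv_equality) auto
  then have "op_trace (\<rho> (inv h)) = (\<Sum>a<m. root_unity m (int a * int (m - 1)) * k a)"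
    using inv by simp
  also have "\<dots> = (\<Sum>a<m. root_unity m (- int a) * k a)"
  proof (intro sum.cong refl)
    fix a
    have "root_unity m (int a * int (m - 1)) = root_unity m (int m * int a) * root_unity m (- int a)"
      using m(1) unfolding root_unity_add[symmetric] by (simp add: algebra_simps of_nat_diff)
    then show "root_unity m (int a * int (m - 1)) * k a = root_unity m (- int a) * k a"
      using root_unity_period[OF m(1)] by simp
  qed
  also have "\<dots> = cnj (\<Sum>a<m. root_unity m (int a * int 1) * k a)"
    by (simp add: cnj_root_unity real)
  also have "(\<Sum>a<m. root_unity m (int a * int 1) * k a) = op_trace (\<rho> (h [^] (1::nat)))"
    by (rule inv[symmetric])
  finally show ?thesis
    using h by simp
qed

section \<open>Averaging over the group and splitting off common summands\<close>

lemma sum_translate: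
  fixes f :: "'g \<Rightarrow> 'b::comm_monoid_add"
  assumes "g \<in> carrier H"
  shows "(\<Sum>h\<in>carrier H. f (g \<otimes> h)) = (\<Sum>h\<in>carrier H. f h)"
  by (rule sum.reindex_bij_witness[where i = "\<lambda>h. inv g \<otimes> h" and j = "\<lambda>h. g \<otimes> h"])
    (use assms in \<open>auto simp: inv_solve_left' simp flip: m_assoc\<close>)

lemma sum_translate_right:
  fixes f :: "'g \<Rightarrow> 'b::comm_monoid_add"
  assumes "g \<in> carrier H"
  shows "(\<Sum>h\<in>carrier H. f (h \<otimes> g)) = (\<Sum>h\<in>carrier H. f h)"
  by (rule sum.reindex_bij_witness[where i = "\<lambda>h. h \<otimes> inv g" and j = "\<lambda>h. h \<otimes> g"])
    (use assms in \<open>auto simp: m_assoc\<close>)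

text \<open>\<open>T k l\<close> is the average \<Sum>_h \<sigma>(h) E_kl \<rho>(h^-1) of the matrix
  unit E_kl, which sends e_l to e_k. The entries of \<open>T k l\<close> at position (k, l) add up
  to the pairing of the two characters, so if that is nonzero, some \<open>T k l\<close> is
  nonzero.\<close>

lemma nonzero_intertwiner:
  assumes \<rho>: "mat_rep H \<rho>" and \<sigma>: "mat_rep H \<sigma>"
    and n: "\<And>h. h \<in> carrier H \<Longrightarrow> fin_op n (\<rho> h)" "\<And>h. h \<in> carrier H \<Longrightarrow> fin_op n (\<sigma> h)"
    and nz: "(\<Sum>h\<in>carrier H. op_trace (\<rho> (inv h)) * op_trace (\<sigma> h)) \<noteq> 0"
  obtains T where "fin_op n T" "T \<noteq> (\<lambda>v. 0)" "\<And>h v. h \<in> carrier H \<Longrightarrow> T (\<rho> h v) = \<sigma> h (T v)"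
    "\<And>v. T (\<rho> \<one> v) = T v"
proof -
  define T where "T k l v = (\<Sum>h\<in>carrier H. scl (\<rho> (inv h) v l) (\<sigma> h (unit_vec k)))" for k l v
  have "(\<Sum>l<n. \<Sum>k<n. T k l (unit_vec l) k) =
      (\<Sum>l<n. \<Sum>k<n. \<Sum>h\<in>carrier H. \<rho> (inv h) (unit_vec l) l * \<sigma> h (unit_vec k) k)"
    by (simp add: T_def)
  also have "\<dots> = (\<Sum>h\<in>carrier H. \<Sum>l<n. \<Sum>k<n. \<rho> (inv h) (unit_vec l) l * \<sigma> h (unit_vec k) k)"
    by (rule trans[OF sum.cong[OF refl sum.swap] sum.swap])
  also have "\<dots> = (\<Sum>h\<in>carrier H. op_trace (\<rho> (inv h)) * op_trace (\<sigma> h))"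
    by (intro sum.cong refl) (simp add: op_trace_eq[OF n(1)] op_trace_eq[OF n(2)] sum_product)
  finally have "(\<Sum>l<n. \<Sum>k<n. T k l (unit_vec l) k) \<noteq> 0"
    using nz by simp
  then obtain k l where kl: "T k l (unit_vec l) k \<noteq> 0"
    by (meson sum.not_neutral_contains_not_neutral)
  have int: "T k l (\<rho> g v) = \<sigma> g (T k l v)" if g: "g \<in> carrier H" for g v
  proof -
    have "T k l (\<rho> g v) = (\<Sum>h\<in>carrier H. scl (\<rho> (inv (g \<otimes> h)) (\<rho> g v) l) (\<sigma> (g \<otimes> h) (unit_vec k)))"
      unfolding T_def by (rule sum_translate[OF g, symmetric])
    also have "\<dots> = (\<Sum>h\<in>carrier H. scl (\<rho> (inv h) v l) (\<sigma> g (\<sigma> h (unit_vec k))))"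
    proof (intro sum.cong refl)
      fix h assume h: "h \<in> carrier H"
      have "inv (g \<otimes> h) \<otimes> g = inv h"
        using g h by (simp add: inv_mult_group m_assoc)
      then show "scl (\<rho> (inv (g \<otimes> h)) (\<rho> g v) l) (\<sigma> (g \<otimes> h) (unit_vec k)) = scl (\<rho> (inv h) v l) (\<sigma> g (\<sigma> h (unit_vec k)))"
        using g h by (simp add: mat_rep_mult[OF \<rho>] mat_rep_mult[OF \<sigma>])
    qed
    also have "\<dots> = \<sigma> g (T k l v)"
      unfolding T_def by (simp add: fin_op_sum[OF n(2)[OF g]] fin_op_scl[OF n(2)[OF g]])
    finally show ?thesis .
  qed
  have one: "T k l (\<rho> \<one> v) = T k l v" for v
    unfolding T_def by (intro sum.cong refl) (simp add: mat_rep_one[OF \<rho>])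
  have "fin_op n (\<lambda>v. scl (\<rho> (inv h) v l) (\<sigma> h (unit_vec k)))" if h: "h \<in> carrier H" for h
  proof -
    have nh: "fin_op n (\<rho> (inv h))"
      using n(1) h by simp
    show ?thesis
      using fin_op_beyond[OF n(2)[OF h]] nh
      by (auto simp: fin_op_def fun_eq_iff algebra_simps)
  qed
  then have "fin_op n (T k l)"
    unfolding T_def[abs_def] by (rule fin_op_summed)
  then show ?thesis
    using that[of "T k l"] kl int one by (auto simp: fun_eq_iff)
qed

text \<open>A linear generalized inverse \<open>U0\<close> is averaged over the group. Every term T
  \<rho>(h^-1) U0 \<sigma>(h) T equals \<sigma>(h^-1) T U0 T \<rho>(h) = T, so the identity T U T =
  T survives the averaging.\<close>

lemma intertwining_inverse:
  assumes \<rho>: "mat_rep H \<rho>" and \<sigma>: "mat_rep H \<sigma>"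
    and n: "\<And>h. h \<in> carrier H \<Longrightarrow> fin_op n (\<rho> h)" "\<And>h. h \<in> carrier H \<Longrightarrow> fin_op n (\<sigma> h)"
    and T: "fin_op n T" "\<And>h v. h \<in> carrier H \<Longrightarrow> T (\<rho> h v) = \<sigma> h (T v)" "\<And>v. T (\<rho> \<one> v) = T v"
  obtains U where "fin_op n U" "\<And>h v. h \<in> carrier H \<Longrightarrow> U (\<sigma> h v) = \<rho> h (U v)"
    "\<And>v. U (\<sigma> \<one> v) = U v" "\<And>v. T (U (T v)) = T v"
proof -
  obtain U0 where U0: "fin_op n U0" "\<And>v. T (U0 (T v)) = T v"
    using fin_op_generalized_inverse[OF T(1)] by blast
  define c :: complex where "c = 1 / of_nat (order H)"
  have c: "(\<Sum>h\<in>carrier H. scl c v) = v" for v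
    using order_gt_0_iff_finite by (auto simp: c_def order_def fun_eq_iff)
  define U where "U v = (\<Sum>h\<in>carrier H. scl c (\<rho> (inv h) (U0 (\<sigma> h v))))" for v
  have "fin_op n U"
    unfolding U_def[abs_def]
    by (intro fin_op_summed fin_op_scaled fin_op_comp[OF n(1) fin_op_comp[OF U0(1) n(2)]]) auto
  moreover have "U (\<sigma> g v) = \<rho> g (U v)" if g: "g \<in> carrier H" for g v
  proof -
    have "\<rho> g (U v) = (\<Sum>h\<in>carrier H. scl c (\<rho> g (\<rho> (inv h) (U0 (\<sigma> h v)))))"
      unfolding U_def by (simp add: fin_op_sum[OF n(1)[OF g]] fin_op_scl[OF n(1)[OF g]])
    also have "\<dots> = (\<Sum>h\<in>carrier H. scl c (\<rho> g (\<rho> (inv (h \<otimes> g)) (U0 (\<sigma> (h \<otimes> g) v)))))"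
      by (rule sum_translate_right[OF g, symmetric])
    also have "\<dots> = U (\<sigma> g v)"
      unfolding U_def using g by (intro sum.cong refl)
        (simp add: mat_rep_mult[OF \<rho>] mat_rep_mult[OF \<sigma>] inv_mult_group flip: m_assoc)
    finally show ?thesis ..
  qed
  moreover have "U (\<sigma> \<one> v) = U v" for v
    unfolding U_def by (intro sum.cong refl) (simp add: mat_rep_one[OF \<sigma>])
  moreover have "T (U (T v)) = T v" for v
  proof -
    have "T (U (T v)) = (\<Sum>h\<in>carrier H. scl c (T (\<rho> (inv h) (U0 (\<sigma> h (T v))))))"
      unfolding U_def by (simp add: fin_op_sum[OF T(1)] fin_op_scl[OF T(1)])
    also have "\<dots> = (\<Sum>h\<in>carrier H. scl c (T v))"
    proof (intro sum.cong refl)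
      fix h assume h: "h \<in> carrier H"
      have "T (\<rho> (inv h) (U0 (\<sigma> h (T v)))) = \<sigma> (inv h) (T (U0 (T (\<rho> h v))))"
        using h by (simp add: T(2))
      also have "\<dots> = T (\<rho> (inv h) (\<rho> h v))"
        unfolding U0(2) using h by (simp add: T(2))
      also have "\<dots> = T v"
        using h by (simp add: mat_rep_mult[OF \<rho>] T(3))
      finally show "scl c (T (\<rho> (inv h) (U0 (\<sigma> h (T v))))) = scl c (T v)"
        by simp
    qed
    finally show ?thesis
      by (simp only: c)
  qed
  ultimately show ?thesis
    using that by blast
qed

lemma mat_rep_cut:
  assumes \<rho>: "mat_rep H \<rho>" and n: "\<And>h. h \<in> carrier H \<Longrightarrow> fin_op n (\<rho> h)"
    and P: "fin_op n P" "\<And>v. P (P v) = P v" "\<And>h v. h \<in> carrier H \<Longrightarrow> P (\<rho> h v) = \<rho> h (P v)"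
  shows "mat_rep H (\<lambda>h v. \<rho> h (P v))"
  unfolding mat_rep_def
proof (intro conjI exI ballI allI)
  fix g h v assume "g \<in> carrier H" "h \<in> carrier H"
  then show "\<rho> (g \<otimes> h) (P v) = \<rho> g (P (\<rho> h (P v)))"
    by (simp add: P(2,3) mat_rep_mult[OF \<rho>])
qed (rule fin_op_comp[OF n P(1)])

text \<open>An idempotent commuting with the action splits the module into the images of
  \<open>P\<close> and \<rho>(1) - P. The exact sequence consists of \<open>P\<close>, acting as the
  inclusion of the first summand, and of the complementary idempotent.\<close>

lemma exact_null_split:
  assumes \<rho>: "mat_rep H \<rho>" and n: "\<And>h. h \<in> carrier H \<Longrightarrow> fin_op n (\<rho> h)"
    and P: "fin_op n P" "\<And>v. P (P v) = P v" "\<And>h v. h \<in> carrier H \<Longrightarrow> P (\<rho> h v) = \<rho> h (P v)"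
    and one: "\<And>v. P (\<rho> \<one> v) = P v"
  defines "\<rho>' \<equiv> \<lambda>h v. \<rho> h v - \<rho> h (P v)"
  shows "mat_rep H \<rho>'" and "\<And>h. h \<in> carrier H \<Longrightarrow> fin_op n (\<rho>' h)"
    and "frag_of (rep_mod H \<rho>) - (frag_of (rep_mod H (\<lambda>h v. \<rho> h (P v))) + frag_of (rep_mod H \<rho>')) \<in> exact_null"
proof -
  show fin: "fin_op n (\<rho>' h)" if "h \<in> carrier H" for h
    unfolding \<rho>'_def using fin_op_minus[OF n fin_op_comp[OF n P(1)]] that by simp
  have mult: "\<rho>' (g \<otimes> h) v = \<rho>' g (\<rho>' h v)" if "g \<in> carrier H" "h \<in> carrier H" for g h v
    unfolding \<rho>'_def using that
    by (simp add: fin_op_diff[OF n] fin_op_diff[OF P(1)] fin_op_0[OF n] P(2,3) mat_rep_mult[OF \<rho>])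
  show rep: "mat_rep H \<rho>'"
    unfolding mat_rep_def using fin mult by blast
  have rep1: "mat_rep H (\<lambda>h v. \<rho> h (P v))"
    by (rule mat_rep_cut[OF \<rho> n P])
  have P1: "\<rho> \<one> (P v) = P v" for v
    using P(3)[of \<one> v] one by simp
  have \<rho>'1: "\<rho>' \<one> v = \<rho> \<one> v - P v" for v
    by (simp add: \<rho>'_def P1)
  have "short_exact CH (rep_mod H (\<lambda>h v. \<rho> h (P v))) (rep_mod H \<rho>) (rep_mod H \<rho>')"
    unfolding short_exact_def
  proof (intro bexI conjI)
    show "P \<in> module_homs CH (rep_mod H (\<lambda>h v. \<rho> h (P v))) (rep_mod H \<rho>)"
      by (rule intertwiner_module_hom[OF P(1)]) (simp add: P)
    show "\<rho>' \<one> \<in> module_homs CH (rep_mod H \<rho>) (rep_mod H \<rho>')"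
    proof (rule intertwiner_module_hom[OF fin])
      fix h v assume h: "h \<in> carrier H"
      show "\<rho>' \<one> (\<rho> h v) = \<rho>' h (\<rho>' \<one> v)"
        unfolding mat_rep_one(2)[OF rep h] unfolding \<rho>'1 using h by (simp add: \<rho>'_def mat_rep_one[OF \<rho>] P(3))
    qed simp
    show "inj_on P (carrier (rep_mod H (\<lambda>h v. \<rho> h (P v))))"
      by (rule inj_onI) (simp add: P1)
    show "\<rho>' \<one> ` carrier (rep_mod H \<rho>) = carrier (rep_mod H \<rho>')"
    proof safe
      fix v assume "v \<in> carrier (rep_mod H \<rho>')"
      then have v: "\<rho>' \<one> v = v" by simp
      have "\<rho> \<one> v = v"
      proof -
        have "\<rho> \<one> (\<rho>' \<one> v) = \<rho>' \<one> v"
          unfolding \<rho>'1 by (simp add: fin_op_diff[OF n] mat_rep_one[OF \<rho>] P1)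
        then show ?thesis using v by simp
      qed
      then show "v \<in> \<rho>' \<one> ` carrier (rep_mod H \<rho>)"
        using v by (intro image_eqI[of _ _ v]) auto
    qed (simp add: mat_rep_one[OF rep])
    show "P ` carrier (rep_mod H (\<lambda>h v. \<rho> h (P v))) = {x \<in> carrier (rep_mod H \<rho>). \<rho>' \<one> x = \<zero>\<^bsub>rep_mod H \<rho>'\<^esub>}"
    proof safe
      fix v
      show "P v \<in> carrier (rep_mod H \<rho>)" "\<rho>' \<one> (P v) = \<zero>\<^bsub>rep_mod H \<rho>'\<^esub>"
        by (simp_all add: P1 \<rho>'1 P(2))
    next
      fix v assume "v \<in> carrier (rep_mod H \<rho>)" "\<rho>' \<one> v = \<zero>\<^bsub>rep_mod H \<rho>'\<^esub>"
      then have "P v = v"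
        by (simp add: \<rho>'1)
      then show "v \<in> P ` carrier (rep_mod H (\<lambda>h v. \<rho> h (P v)))"
        by (intro image_eqI[of _ _ v]) (auto simp: P1)
    qed
  qed
  then show "frag_of (rep_mod H \<rho>) - (frag_of (rep_mod H (\<lambda>h v. \<rho> h (P v))) + frag_of (rep_mod H \<rho>')) \<in> exact_null"
    by (intro exact_null_rel fg_rep_mod rep rep1 \<rho>)
qed

text \<open>A nonzero intertwiner \<open>T\<close> has an intertwining generalized inverse \<open>U\<close>, and the images of the idempotents \<open>U T\<close>
  and \<open>T U\<close> are isomorphic summands. This replaces Schur's lemma and Maschke's theorem.\<close>

lemma split_common_summand:
  assumes \<rho>: "mat_rep H \<rho>" and \<sigma>: "mat_rep H \<sigma>"
    and nz: "(\<Sum>h\<in>carrier H. op_trace (\<rho> (inv h)) * op_trace (\<sigma> h)) \<noteq> 0"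
  obtains \<rho>' \<sigma>' \<delta> and k :: nat where "mat_rep H \<rho>'" "mat_rep H \<sigma>'" "k > 0" "\<delta> \<one> = of_nat k"
    "\<And>h. h \<in> carrier H \<Longrightarrow> op_trace (\<rho> h) = op_trace (\<rho>' h) + \<delta> h"
    "\<And>h. h \<in> carrier H \<Longrightarrow> op_trace (\<sigma> h) = op_trace (\<sigma>' h) + \<delta> h"
    "(frag_of (rep_mod H \<rho>) - frag_of (rep_mod H \<sigma>)) - (frag_of (rep_mod H \<rho>') - frag_of (rep_mod H \<sigma>')) \<in> exact_null"
proof -
  obtain n where nr: "\<And>h. h \<in> carrier H \<Longrightarrow> fin_op n (\<rho> h)" and ns: "\<And>h. h \<in> carrier H \<Longrightarrow> fin_op n (\<sigma> h)"
    using mat_rep_common_size[OF \<rho> \<sigma>] by blast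
  obtain T where T: "fin_op n T" "T \<noteq> (\<lambda>v. 0)" "\<And>h v. h \<in> carrier H \<Longrightarrow> T (\<rho> h v) = \<sigma> h (T v)"
    "\<And>v. T (\<rho> \<one> v) = T v"
    using nonzero_intertwiner[OF \<rho> \<sigma> nr ns nz] by blast
  obtain U where U: "fin_op n U" "\<And>h v. h \<in> carrier H \<Longrightarrow> U (\<sigma> h v) = \<rho> h (U v)"
    "\<And>v. U (\<sigma> \<one> v) = U v" "\<And>v. T (U (T v)) = T v"
    using intertwining_inverse[OF \<rho> \<sigma> nr ns T(1) T(3,4)] by blast
  have UT: "fin_op n (\<lambda>v. U (T v))" and TU: "fin_op n (\<lambda>v. T (U v))"
    by (rule fin_op_comp[OF U(1) T(1)], rule fin_op_comp[OF T(1) U(1)])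
  define \<rho>1 where "\<rho>1 h v = \<rho> h (U (T v))" for h v
  define \<sigma>1 where "\<sigma>1 h v = \<sigma> h (T (U v))" for h v
  define \<rho>' where "\<rho>' h v = \<rho> h v - \<rho> h (U (T v))" for h v
  define \<sigma>' where "\<sigma>' h v = \<sigma> h v - \<sigma> h (T (U v))" for h v
  have rep1: "mat_rep H \<rho>1" "mat_rep H \<sigma>1"
    unfolding \<rho>1_def[abs_def] \<sigma>1_def[abs_def]
    by (rule mat_rep_cut[OF \<rho> nr UT] mat_rep_cut[OF \<sigma> ns TU]; simp add: T U)+
  have \<rho>': "mat_rep H \<rho>'" "frag_of (rep_mod H \<rho>) - (frag_of (rep_mod H \<rho>1) + frag_of (rep_mod H \<rho>')) \<in> exact_null"
    unfolding \<rho>'_def[abs_def] \<rho>1_def[abs_def] by (rule exact_null_split[OF \<rho> nr UT]; simp add: T U)+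
  have \<sigma>': "mat_rep H \<sigma>'" "frag_of (rep_mod H \<sigma>) - (frag_of (rep_mod H \<sigma>1) + frag_of (rep_mod H \<sigma>')) \<in> exact_null"
    unfolding \<sigma>'_def[abs_def] \<sigma>1_def[abs_def] by (rule exact_null_split[OF \<sigma> ns TU]; simp add: T U)+
  have "module_iso (rep_mod H \<rho>1) (rep_mod H \<sigma>1)"
    unfolding module_iso_def
  proof
    show "T \<in> module_homs CH (rep_mod H \<rho>1) (rep_mod H \<sigma>1)"
      by (rule intertwiner_module_hom[OF T(1)]) (simp add: \<rho>1_def \<sigma>1_def T U)
    have U1: "\<rho> \<one> (U v) = U v" and T1: "\<sigma> \<one> (T v) = T v" for v
      using U(2)[of \<one> v] U(3) T(3)[of \<one> v] T(4) by simp_all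
    show "bij_betw T (carrier (rep_mod H \<rho>1)) (carrier (rep_mod H \<sigma>1))"
      by (rule bij_betw_byWitness[where f' = U]) (auto simp: \<rho>1_def \<sigma>1_def U1 T1 U(4))
  qed
  then have iso: "frag_of (rep_mod H \<sigma>1) - frag_of (rep_mod H \<rho>1) \<in> exact_null"
    by (intro exact_null_iso fg_rep_mod rep1)
  obtain k :: nat where k: "op_trace (\<lambda>v. U (T v)) = of_nat k" "k = 0 \<Longrightarrow> (\<lambda>v. U (T v)) = (\<lambda>v. 0)"
    using op_trace_idempotent[OF UT] by (metis U(4))
  define \<delta> where "\<delta> h = op_trace (\<rho>1 h)" for h
  have kpos: "k > 0"
  proof (rule ccontr)
    assume "\<not> k > 0"
    then have "U (T v) = 0" for v
      using k(2) by (auto dest: fun_cong)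
    then have "T v = 0" for v
      using U(4)[of v] by (simp add: fin_op_0[OF T(1)])
    then show False
      using T(2) by auto
  qed
  have \<delta>1: "\<delta> \<one> = of_nat k"
  proof -
    have "\<rho>1 \<one> = (\<lambda>v. U (T v))"
      by (simp add: \<rho>1_def[abs_def] U(2)[symmetric] T(3)[symmetric] T(4))
    then show ?thesis
      using k(1) by (simp add: \<delta>_def)
  qed
  have tr\<rho>: "op_trace (\<rho> h) = op_trace (\<rho>' h) + \<delta> h" if "h \<in> carrier H" for h
    unfolding \<delta>_def \<rho>'_def[abs_def] \<rho>1_def[abs_def]
    by (simp add: op_trace_minus[OF nr[OF that] fin_op_comp[OF nr[OF that] UT]])
  have tr\<sigma>: "op_trace (\<sigma> h) = op_trace (\<sigma>' h) + \<delta> h" if h: "h \<in> carrier H" for h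
  proof -
    \<comment> \<open>The two summands have the same character: \<sigma>(h) T U = T \<rho>(h) U, and
      moving \<open>T\<close> to the end under the trace gives \<rho>(h) U T.\<close>
    have "op_trace (\<sigma>1 h) = op_trace (\<lambda>v. T (\<rho> h (U v)))"
      unfolding \<sigma>1_def[abs_def] by (simp add: T(3)[OF h])
    also have "\<dots> = \<delta> h"
      unfolding \<delta>_def \<rho>1_def[abs_def] by (rule op_trace_comm[OF T(1) fin_op_comp[OF nr[OF h] U(1)]])
    finally show ?thesis
      unfolding \<sigma>'_def[abs_def] \<sigma>1_def[abs_def]
      by (simp add: op_trace_minus[OF ns[OF h] fin_op_comp[OF ns[OF h] TU]])
  qed
  have "(frag_of (rep_mod H \<rho>) - frag_of (rep_mod H \<sigma>)) - (frag_of (rep_mod H \<rho>') - frag_of (rep_mod H \<sigma>')) \<in> exact_null"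
  proof -
    \<comment> \<open>Regrouped as the two splitting relations and the relation identifying the
      isomorphic summands.\<close>
    have eq: "(frag_of (rep_mod H \<rho>) - frag_of (rep_mod H \<sigma>)) - (frag_of (rep_mod H \<rho>') - frag_of (rep_mod H \<sigma>'))
      = (frag_of (rep_mod H \<rho>) - (frag_of (rep_mod H \<rho>1) + frag_of (rep_mod H \<rho>')))
       - (frag_of (rep_mod H \<sigma>) - (frag_of (rep_mod H \<sigma>1) + frag_of (rep_mod H \<sigma>')))
       - (frag_of (rep_mod H \<sigma>1) - frag_of (rep_mod H \<rho>1))"
      by simp
    show ?thesis
      unfolding eq by (rule exact_null_simps(5)[OF exact_null_simps(5)[OF \<rho>'(2) \<sigma>'(2)] iso])
  qed
  from that[OF \<rho>'(1) \<sigma>'(1) kpos, of \<delta>, OF \<delta>1 tr\<rho> tr\<sigma> this] show ?thesis .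
qed

text \<open>The trace of the idempotent \<rho>(1) is the dimension of the module, and dimension zero
  forces every \<rho>(h) to vanish.\<close>

lemma mat_rep_trace_one:
  assumes \<rho>: "mat_rep H \<rho>"
  obtains k :: nat where "op_trace (\<rho> \<one>) = of_nat k" "k = 0 \<Longrightarrow> frag_of (rep_mod H \<rho>) \<in> exact_null"
proof -
  obtain n where n: "\<And>h. h \<in> carrier H \<Longrightarrow> fin_op n (\<rho> h)"
    using \<rho> unfolding mat_rep_def by blast
  obtain k :: nat where k: "op_trace (\<rho> \<one>) = of_nat k" "k = 0 \<Longrightarrow> \<rho> \<one> = (\<lambda>v. 0)"
    using op_trace_idempotent[OF n[OF one_closed]] mat_rep_one(1)[OF \<rho> one_closed] by metis
  have "frag_of (rep_mod H \<rho>) \<in> exact_null" if "k = 0"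
  proof -
    have "\<rho> h v = 0" if "h \<in> carrier H" for h v
      using k(2)[OF \<open>k = 0\<close>] mat_rep_one(1)[OF \<rho> that, of v] by simp
    then have "rep_mod H \<rho> = rep_mod H (\<lambda>h v. 0)"
      unfolding rep_mod_def by simp
    then show ?thesis
      using exact_null_zero by simp
  qed
  with k(1) that show ?thesis by blast
qed

lemma sum_list_trace_one_nat:
  assumes "\<forall>\<rho>\<in>set us. mat_rep H \<rho>"
  shows "\<exists>e::nat. (\<Sum>\<rho>\<leftarrow>us. op_trace (\<rho> \<one>)) = of_nat e"
  using assms
proof (induction us)
  case (Cons \<rho> us)
  then obtain e :: nat where "(\<Sum>\<rho>\<leftarrow>us. op_trace (\<rho> \<one>)) = of_nat e"
    by auto
  moreover obtain k :: nat where "op_trace (\<rho> \<one>) = of_nat k"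
    using mat_rep_trace_one[of \<rho>] Cons.prems by auto
  ultimately show ?case
    by (intro exI[of _ "k + e"]) simp
qed (auto intro: exI[of _ 0])

text \<open>Induction on the total dimension \<open>d\<close>. For d > 0 the common character pairs
  nontrivially with itself, so some \<rho> from \<open>vs\<close> and \<sigma> from
  \<open>ws\<close> pair nontrivially; replacing both by their complements of a common summand
  lowers \<open>d\<close> and keeps the characters equal. Lists of representations stand for direct
  sums, which are thus never formed.\<close>

lemma exact_null_of_equal_chars:
  assumes "\<forall>\<rho>\<in>set vs \<union> set ws. mat_rep H \<rho>" "(\<Sum>\<rho>\<leftarrow>vs. op_trace (\<rho> \<one>)) = of_nat d"
    and "\<And>h. h \<in> carrier H \<Longrightarrow> (\<Sum>\<rho>\<leftarrow>vs. op_trace (\<rho> h)) = (\<Sum>\<sigma>\<leftarrow>ws. op_trace (\<sigma> h))"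
  shows "(\<Sum>\<rho>\<leftarrow>vs. frag_of (rep_mod H \<rho>)) - (\<Sum>\<sigma>\<leftarrow>ws. frag_of (rep_mod H \<sigma>)) \<in> exact_null"
  using assms
proof (induction d arbitrary: vs ws rule: less_induct)
  case (less d)
  show ?case
  proof (cases "d = 0")
    \<comment> \<open>At the identity the character sums give the total dimension, which is
      therefore zero for both lists; every entry is then a zero module.\<close>
    case True
    have "(\<Sum>\<rho>\<leftarrow>us. frag_of (rep_mod H \<rho>)) \<in> exact_null"
      if "\<forall>\<rho>\<in>set us. mat_rep H \<rho>" "(\<Sum>\<rho>\<leftarrow>us. op_trace (\<rho> \<one>)) = 0" for us
    proof -
      have "\<exists>e::nat. (\<Sum>\<rho>\<leftarrow>us. op_trace (\<rho> \<one>)) = of_nat e \<and> (e = 0 \<longrightarrow> (\<Sum>\<rho>\<leftarrow>us. frag_of (rep_mod H \<rho>)) \<in> exact_null)"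
        using that(1)
      proof (induction us)
        case Nil
        show ?case using exact_null_simps(1) by (intro exI[of _ 0]) auto
      next
        case (Cons \<rho> us)
        then obtain e :: nat where e: "(\<Sum>\<rho>\<leftarrow>us. op_trace (\<rho> \<one>)) = of_nat e"
          "e = 0 \<longrightarrow> (\<Sum>\<rho>\<leftarrow>us. frag_of (rep_mod H \<rho>)) \<in> exact_null"
          by auto
        obtain k :: nat where k: "op_trace (\<rho> \<one>) = of_nat k" "k = 0 \<Longrightarrow> frag_of (rep_mod H \<rho>) \<in> exact_null"
          using mat_rep_trace_one[of \<rho>] Cons.prems by auto
        show ?case
          using e k exact_null_simps(2) by (intro exI[of _ "k + e"]) auto
      qed
      then show ?thesis
        using that(2) by auto
    qed
    then show ?thesis
      using less.prems True exact_null_simps(5) by simp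
  next
    case False
    define \<chi> where "\<chi> h = (\<Sum>\<rho>\<leftarrow>vs. op_trace (\<rho> h))" for h
    have inv: "\<chi> (inv h) = cnj (\<chi> h)" if "h \<in> carrier H" for h
    proof -
      have "(\<Sum>\<rho>\<leftarrow>us. op_trace (\<rho> (inv h))) = cnj (\<Sum>\<rho>\<leftarrow>us. op_trace (\<rho> h))" if "\<forall>\<rho>\<in>set us. mat_rep H \<rho>" for us
        using that by (induction us) (auto simp: rep_char_inv[OF _ \<open>h \<in> carrier H\<close>])
      then show ?thesis
        using less.prems(1) by (simp add: \<chi>_def)
    qed
    \<comment> \<open>Each summand is the squared modulus of \<chi>(h), and the term at the identity
      alone is d^2 > 0.\<close>
    have "(\<Sum>h\<in>carrier H. \<chi> (inv h) * \<chi> h) = of_real (\<Sum>h\<in>carrier H. (cmod (\<chi> h))\<^sup>2)"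
      unfolding of_real_sum by (intro sum.cong refl) (simp add: inv mult.commute flip: complex_norm_square)
    moreover have "(\<Sum>h\<in>carrier H. (cmod (\<chi> h))\<^sup>2) \<ge> (cmod (\<chi> \<one>))\<^sup>2"
      by (rule member_le_sum) auto
    moreover have "cmod (\<chi> \<one>) > 0"
      using less.prems(2) False by (simp add: \<chi>_def)
    ultimately have "(\<Sum>h\<in>carrier H. \<chi> (inv h) * \<chi> h) \<noteq> 0"
      by (smt (verit) of_real_eq_0_iff zero_less_power)
    also have "(\<Sum>h\<in>carrier H. \<chi> (inv h) * \<chi> h) = (\<Sum>h\<in>carrier H. (\<Sum>\<rho>\<leftarrow>vs. op_trace (\<rho> (inv h))) * (\<Sum>\<sigma>\<leftarrow>ws. op_trace (\<sigma> h)))"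
      by (intro sum.cong refl) (simp add: \<chi>_def less.prems(3))
    finally have nz: "(\<Sum>h\<in>carrier H. (\<Sum>\<rho>\<leftarrow>vs. op_trace (\<rho> (inv h))) * (\<Sum>\<sigma>\<leftarrow>ws. op_trace (\<sigma> h))) \<noteq> 0" .
    have "\<exists>\<rho>\<in>set vs. \<exists>\<sigma>\<in>set ws. (\<Sum>h\<in>carrier H. op_trace (\<rho> (inv h)) * op_trace (\<sigma> h)) \<noteq> 0"
    proof (rule ccontr)
      assume *: "\<not> ?thesis"
      have "(\<Sum>h\<in>carrier H. op_trace (\<rho> (inv h)) * (\<Sum>\<sigma>\<leftarrow>ws'. op_trace (\<sigma> h))) = 0" if "\<rho> \<in> set vs" "set ws' \<subseteq> set ws" for \<rho> ws'
        using that * by (induction ws') (auto simp: ring_distribs sum.distrib)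
      then have "(\<Sum>h\<in>carrier H. (\<Sum>\<rho>\<leftarrow>vs'. op_trace (\<rho> (inv h))) * (\<Sum>\<sigma>\<leftarrow>ws. op_trace (\<sigma> h))) = 0" if "set vs' \<subseteq> set vs" for vs'
        using that by (induction vs') (auto simp: ring_distribs sum.distrib)
      then show False using nz by blast
    qed
    then obtain \<rho> \<sigma> where \<rho>: "\<rho> \<in> set vs" and \<sigma>: "\<sigma> \<in> set ws"
      and nz': "(\<Sum>h\<in>carrier H. op_trace (\<rho> (inv h)) * op_trace (\<sigma> h)) \<noteq> 0"
      by blast
    have mr: "mat_rep H \<rho>" "mat_rep H \<sigma>"
      using \<rho> \<sigma> less.prems(1) by auto
    obtain \<rho>' \<sigma>' \<delta> and k :: nat
      where s: "mat_rep H \<rho>'" "mat_rep H \<sigma>'" "k > 0" "\<delta> \<one> = of_nat k"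
      "\<And>h. h \<in> carrier H \<Longrightarrow> op_trace (\<rho> h) = op_trace (\<rho>' h) + \<delta> h"
      "\<And>h. h \<in> carrier H \<Longrightarrow> op_trace (\<sigma> h) = op_trace (\<sigma>' h) + \<delta> h"
      "(frag_of (rep_mod H \<rho>) - frag_of (rep_mod H \<sigma>)) - (frag_of (rep_mod H \<rho>') - frag_of (rep_mod H \<sigma>')) \<in> exact_null"
      by (rule split_common_summand[OF mr nz'], rule that)
    obtain vs1 vs2 where vs: "vs = vs1 @ \<rho> # vs2"
      using split_list[OF \<rho>] by blast
    obtain ws1 ws2 where ws: "ws = ws1 @ \<sigma> # ws2"
      using split_list[OF \<sigma>] by blast
    let ?vs = "vs1 @ \<rho>' # vs2" and ?ws = "ws1 @ \<sigma>' # ws2"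
    have vs_sum: "(\<Sum>\<rho>\<leftarrow>vs. op_trace (\<rho> h)) = (\<Sum>\<rho>\<leftarrow>?vs. op_trace (\<rho> h)) + \<delta> h"
      and ws_sum: "(\<Sum>\<rho>\<leftarrow>ws. op_trace (\<rho> h)) = (\<Sum>\<rho>\<leftarrow>?ws. op_trace (\<rho> h)) + \<delta> h" if "h \<in> carrier H" for h
      using s(5,6)[OF that] by (simp_all add: vs ws)
    have reps: "\<forall>\<rho>\<in>set ?vs \<union> set ?ws. mat_rep H \<rho>"
      using less.prems(1) s(1,2) by (auto simp: vs ws)
    obtain e :: nat where e: "(\<Sum>\<rho>\<leftarrow>?vs. op_trace (\<rho> \<one>)) = of_nat e"
      using sum_list_trace_one_nat[of ?vs] reps by blast
    have "(of_nat d :: complex) = of_nat (e + k)"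
      using vs_sum[OF one_closed] less.prems(2) e s(4) by simp
    then have "e < d"
      using s(3) by (simp only: of_nat_eq_iff)
    then have IH: "(\<Sum>\<rho>\<leftarrow>?vs. frag_of (rep_mod H \<rho>)) - (\<Sum>\<sigma>\<leftarrow>?ws. frag_of (rep_mod H \<sigma>)) \<in> exact_null"
    proof (rule less.IH[OF _ reps e])
      fix h assume "h \<in> carrier H"
      then show "(\<Sum>\<rho>\<leftarrow>?vs. op_trace (\<rho> h)) = (\<Sum>\<sigma>\<leftarrow>?ws. op_trace (\<sigma> h))"
        using vs_sum ws_sum less.prems(3) by simp
    qed
    have eq: "(\<Sum>\<rho>\<leftarrow>vs. frag_of (rep_mod H \<rho>)) - (\<Sum>\<sigma>\<leftarrow>ws. frag_of (rep_mod H \<sigma>)) =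
        ((\<Sum>\<rho>\<leftarrow>?vs. frag_of (rep_mod H \<rho>)) - (\<Sum>\<sigma>\<leftarrow>?ws. frag_of (rep_mod H \<sigma>)))
        + ((frag_of (rep_mod H \<rho>) - frag_of (rep_mod H \<sigma>)) - (frag_of (rep_mod H \<rho>') - frag_of (rep_mod H \<sigma>')))"
      unfolding vs ws by simp
    show ?thesis
      unfolding eq by (rule exact_null_simps(2)[OF IH s(7)])
  qed
qed

text \<open>For the inclusion from right to left, every module is replaced by a matrix
  representation modulo relations, and positive and negative parts are collected in the lists
  \<open>vs\<close> and \<open>ws\<close>. This is the step that makes classes and virtual
  characters the same thing.\<close>

lemma exact_null_eq:
  "exact_null = {p. Poly_Mapping.keys p \<subseteq> fg_modules CH \<and> (\<forall>h\<in>carrier H. frag_char p h = 0)}"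
proof (intro equalityI subsetI CollectI)
  fix p :: "('g, complex) rep_module \<Rightarrow>\<^sub>0 int"
  assume "p \<in> exact_null"
  then show "Poly_Mapping.keys p \<subseteq> fg_modules CH \<and> (\<forall>h\<in>carrier H. frag_char p h = 0)"
    using exact_null_simps(3) frag_char_exact_null by blast
next
  fix p :: "('g, complex) rep_module \<Rightarrow>\<^sub>0 int"
  assume "p \<in> {p. Poly_Mapping.keys p \<subseteq> fg_modules CH \<and> (\<forall>h\<in>carrier H. frag_char p h = 0)}"
  then have keys: "Poly_Mapping.keys p \<subseteq> fg_modules CH" and zero: "\<forall>h\<in>carrier H. frag_char p h = 0"
    by blast+
  define S where "S vs ws = (\<Sum>\<rho>\<leftarrow>vs. frag_of (rep_mod H \<rho>)) - (\<Sum>\<sigma>\<leftarrow>ws. frag_of (rep_mod H \<sigma>))" for vs ws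
  have "\<exists>vs ws. (\<forall>\<rho>\<in>set vs \<union> set ws. mat_rep H \<rho>) \<and> p - S vs ws \<in> exact_null"
    using keys
  proof (induction p rule: frag_induction)
    case zero
    show ?case
      by (rule exI[of _ "[]"], rule exI[of _ "[]"]) (simp add: S_def exact_null_simps(1))
  next
    case (one M)
    from exact_null_simps(4)[OF exact_null_iso[OF one fg_rep_mod[OF mod_rep(1)[OF one]] mod_rep(2)[OF one]]]
    show ?case
      by (intro exI[of _ "[mod_rep M]"] exI[of _ "[]"]) (simp add: S_def mod_rep(1)[OF one])
  next
    case (diff a b)
    then obtain vs ws vs' ws' where *: "\<forall>\<rho>\<in>set vs \<union> set ws. mat_rep H \<rho>" "a - S vs ws \<in> exact_null"
      "\<forall>\<rho>\<in>set vs' \<union> set ws'. mat_rep H \<rho>" "b - S vs' ws' \<in> exact_null"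
      by blast
    have eq: "a - b - S (vs @ ws') (ws @ vs') = (a - S vs ws) - (b - S vs' ws')"
      by (simp add: S_def)
    show ?case
    proof (intro exI conjI)
      show "\<forall>\<rho>\<in>set (vs @ ws') \<union> set (ws @ vs'). mat_rep H \<rho>"
        using * by auto
      show "a - b - S (vs @ ws') (ws @ vs') \<in> exact_null"
        unfolding eq by (rule exact_null_simps(5)[OF *(2,4)])
    qed
  qed
  then obtain vs ws where reps: "\<forall>\<rho>\<in>set vs \<union> set ws. mat_rep H \<rho>" and pS: "p - S vs ws \<in> exact_null"
    by blast
  have fc: "frag_char (\<Sum>\<rho>\<leftarrow>us. frag_of (rep_mod H \<rho>)) h = (\<Sum>\<rho>\<leftarrow>us. op_trace (\<rho> h))"
    if "\<forall>\<rho>\<in>set us. mat_rep H \<rho>" "h \<in> carrier H" for us h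
    using that by (induction us) (auto simp: mod_char_rep_mod)
  have eq: "(\<Sum>\<rho>\<leftarrow>vs. op_trace (\<rho> h)) = (\<Sum>\<rho>\<leftarrow>ws. op_trace (\<rho> h))" if "h \<in> carrier H" for h
    using frag_char_exact_null[OF pS that] zero that fc[of vs h] fc[of ws h] reps by (simp add: S_def)
  obtain d :: nat where "(\<Sum>\<rho>\<leftarrow>vs. op_trace (\<rho> \<one>)) = of_nat d"
    using sum_list_trace_one_nat[of vs] reps by auto
  from exact_null_of_equal_chars[OF reps this eq] have "S vs ws \<in> exact_null"
    by (simp add: S_def)
  from exact_null_simps(2)[OF pS this] show "p \<in> exact_null"
    by simp
qed

end

section \<open>Virtual characters\<close>

context finite_group
begin

text \<open>The elements of the Grothendieck group are cosets; by \<open>exact_null_eq\<close> a coset consists of all formal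
  combinations with a given character.\<close>

definition char_class :: "('g \<Rightarrow> complex) \<Rightarrow> ('g, complex) rep_class" where
  "char_class f = {p. Poly_Mapping.keys p \<subseteq> fg_modules CH \<and> (\<forall>h\<in>carrier H. frag_char p h = f h)}"

definition virtual_char :: "('g \<Rightarrow> complex) \<Rightarrow> bool" where
  "virtual_char f \<longleftrightarrow> char_class f \<noteq> {}"

text \<open>All members of a coset have the same character on the carrier, so the choice is harmless
  there. Off the carrier the value is unspecified, which is why equalities of characters are always
  restricted to group elements.\<close>

definition class_char :: "('g, complex) rep_class \<Rightarrow> 'g \<Rightarrow> complex" where
  "class_char X = frag_char (SOME p. p \<in> X)"

lemma char_class_cong: "(\<And>h. h \<in> carrier H \<Longrightarrow> f h = g h) \<Longrightarrow> char_class f = char_class g"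
  by (simp add: char_class_def)

lemma r_coset_exact_null:
  assumes "Poly_Mapping.keys p \<subseteq> fg_modules CH"
  shows "exact_null #>\<^bsub>free_Abelian_group (fg_modules CH)\<^esub> p = char_class (frag_char p)"
proof (intro equalityI subsetI)
  fix q assume "q \<in> exact_null #>\<^bsub>free_Abelian_group (fg_modules CH)\<^esub> p"
  then obtain e where e: "e \<in> exact_null" "q = e + p"
    by (auto simp: r_coset_def)
  then show "q \<in> char_class (frag_char p)"
    using assms Poly_Mapping.keys_add[of e p] unfolding exact_null_eq by (auto simp: char_class_def)
next
  fix q assume q: "q \<in> char_class (frag_char p)"
  then have "q - p \<in> exact_null"
    using assms keys_diff[of q p] unfolding exact_null_eq by (auto simp: char_class_def)
  then have "(q - p) + p \<in> exact_null #>\<^bsub>free_Abelian_group (fg_modules CH)\<^esub> p"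
    unfolding r_coset_def mult_free_Abelian_group by blast
  then show "q \<in> exact_null #>\<^bsub>free_Abelian_group (fg_modules CH)\<^esub> p"
    by simp
qed

lemma virtual_charE:
  assumes "virtual_char f"
  obtains p where "Poly_Mapping.keys p \<subseteq> fg_modules CH" "\<And>h. h \<in> carrier H \<Longrightarrow> frag_char p h = f h"
  using assms unfolding virtual_char_def char_class_def by blast

lemma virtual_charI:
  "Poly_Mapping.keys p \<subseteq> fg_modules CH \<Longrightarrow> (\<And>h. h \<in> carrier H \<Longrightarrow> frag_char p h = f h) \<Longrightarrow> virtual_char f"
  unfolding virtual_char_def char_class_def by blast

lemma virtual_char_cong: "(\<And>h. h \<in> carrier H \<Longrightarrow> f h = g h) \<Longrightarrow> virtual_char f \<longleftrightarrow> virtual_char g"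
  unfolding virtual_char_def by (simp add: char_class_cong[of f g])

lemma carrier_rep_group: "carrier (rep_group H) = char_class ` Collect virtual_char"
proof -
  have "carrier (rep_group H) =
      (\<lambda>p. exact_null #>\<^bsub>free_Abelian_group (fg_modules CH)\<^esub> p) ` {p. Poly_Mapping.keys p \<subseteq> fg_modules CH}"
    by (auto simp: rep_group_def grothendieck_group_def FactGroup_def RCOSETS_def)
  also have "\<dots> = (\<lambda>p. char_class (frag_char p)) ` {p. Poly_Mapping.keys p \<subseteq> fg_modules CH}"
    by (intro image_cong refl r_coset_exact_null) simp
  also have "\<dots> = char_class ` Collect virtual_char"
  proof safe
    fix f assume "virtual_char f"
    then obtain p where p: "Poly_Mapping.keys p \<subseteq> fg_modules CH" "\<And>h. h \<in> carrier H \<Longrightarrow> frag_char p h = f h"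
      by (rule virtual_charE) blast
    then have "char_class f = char_class (frag_char p)"
      by (intro char_class_cong) simp
    then show "char_class f \<in> (\<lambda>p. char_class (frag_char p)) ` {p. Poly_Mapping.keys p \<subseteq> fg_modules CH}"
      using p by blast
  qed (use virtual_charI in blast)
  finally show ?thesis .
qed

lemma class_char_char_class:
  assumes "virtual_char f" "h \<in> carrier H"
  shows "class_char (char_class f) h = f h"
proof -
  have "(SOME p. p \<in> char_class f) \<in> char_class f"
    using assms(1) unfolding virtual_char_def by (simp add: some_in_eq)
  then show ?thesis
    using assms(2) by (simp add: class_char_def char_class_def)
qed

lemma char_class_class_char:
  assumes "X \<in> carrier (rep_group H)"
  shows "char_class (class_char X) = X" "virtual_char (class_char X)"
proof -
  obtain f where f: "virtual_char f" "X = char_class f"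
    using assms unfolding carrier_rep_group by blast
  then have eq: "class_char X h = f h" if "h \<in> carrier H" for h
    using class_char_char_class that by simp
  show "char_class (class_char X) = X"
    unfolding f(2) by (rule char_class_cong) (use eq f(2) in simp)
  show "virtual_char (class_char X)"
    using virtual_char_cong[of "class_char X" f] eq f(1) by simp
qed

lemma virtual_char_0: "virtual_char (\<lambda>h. 0)"
  by (rule virtual_charI[of 0]) auto

lemma virtual_char_add:
  assumes "virtual_char f" "virtual_char g"
  shows "virtual_char (\<lambda>h. f h + g h)"
proof -
  obtain p where p: "Poly_Mapping.keys p \<subseteq> fg_modules CH" "\<And>h. h \<in> carrier H \<Longrightarrow> frag_char p h = f h"
    using assms(1) by (rule virtual_charE) blast
  obtain q where q: "Poly_Mapping.keys q \<subseteq> fg_modules CH" "\<And>h. h \<in> carrier H \<Longrightarrow> frag_char q h = g h"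
    using assms(2) by (rule virtual_charE) blast
  show ?thesis
    by (rule virtual_charI[of "p + q"]) (use p q Poly_Mapping.keys_add[of p q] in auto)
qed

lemma virtual_char_uminus:
  assumes "virtual_char f"
  shows "virtual_char (\<lambda>h. - f h)"
proof -
  obtain p where p: "Poly_Mapping.keys p \<subseteq> fg_modules CH" "\<And>h. h \<in> carrier H \<Longrightarrow> frag_char p h = f h"
    using assms(1) by (rule virtual_charE) blast
  show ?thesis
    by (rule virtual_charI[of "- p"]) (use p in auto)
qed

lemma rep_group_mult:
  assumes "virtual_char f" "virtual_char g"
  shows "char_class f \<otimes>\<^bsub>rep_group H\<^esub> char_class g = char_class (\<lambda>h. f h + g h)"
proof -
  have "char_class f \<otimes>\<^bsub>rep_group H\<^esub> char_class g = (\<Union>p\<in>char_class f. \<Union>q\<in>char_class g. {p + q})"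
    by (simp add: rep_group_def grothendieck_group_def FactGroup_def set_mult_def)
  also have "\<dots> = char_class (\<lambda>h. f h + g h)"
  proof (intro equalityI subsetI)
    fix r assume "r \<in> (\<Union>p\<in>char_class f. \<Union>q\<in>char_class g. {p + q})"
    then obtain p q where "p \<in> char_class f" "q \<in> char_class g" "r = p + q"
      by blast
    then show "r \<in> char_class (\<lambda>h. f h + g h)"
      using Poly_Mapping.keys_add[of p q] by (auto simp: char_class_def)
  next
    fix r assume r: "r \<in> char_class (\<lambda>h. f h + g h)"
    obtain p where p: "p \<in> char_class f"
      using assms(1) unfolding virtual_char_def by blast
    have "r - p \<in> char_class g"
      using r p keys_diff[of r p] by (auto simp: char_class_def)
    then have "p + (r - p) \<in> (\<Union>p\<in>char_class f. \<Union>q\<in>char_class g. {p + q})"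
      using p by blast
    then show "r \<in> (\<Union>p\<in>char_class f. \<Union>q\<in>char_class g. {p + q})"
      by simp
  qed
  finally show ?thesis .
qed

lemma rep_group_one: "\<one>\<^bsub>rep_group H\<^esub> = char_class (\<lambda>h. 0)"
  by (simp add: rep_group_def grothendieck_group_def FactGroup_def exact_null_eq char_class_def)

section \<open>Pullback along group homomorphisms\<close>

text \<open>Used for \<open>pullback_module\<close>, which is at first a mere record: all axioms and
  the generators are carried back along a bijection onto a known module.\<close>

lemma fg_module_transport:
  assumes N: "finitely_generated_module CH N"
    and bij: "bij_betw c (carrier M) (carrier N)"
    and add: "\<And>x y. x \<in> carrier M \<Longrightarrow> y \<in> carrier M \<Longrightarrow> x \<oplus>\<^bsub>M\<^esub> y \<in> carrier M \<and> c (x \<oplus>\<^bsub>M\<^esub> y) = c x \<oplus>\<^bsub>N\<^esub> c y"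
    and zero: "\<zero>\<^bsub>M\<^esub> \<in> carrier M" "c \<zero>\<^bsub>M\<^esub> = \<zero>\<^bsub>N\<^esub>"
    and smult: "\<And>a x. a \<in> carrier CH \<Longrightarrow> x \<in> carrier M \<Longrightarrow> a \<odot>\<^bsub>M\<^esub> x \<in> carrier M \<and> c (a \<odot>\<^bsub>M\<^esub> x) = a \<odot>\<^bsub>N\<^esub> c x"
  shows "finitely_generated_module CH M"
proof -
  interpret N: left_module CH N
    using N by (simp add: finitely_generated_module_def)
  have cN: "c x \<in> carrier N" if "x \<in> carrier M" for x
    using bij_betwE[OF bij] that by blast
  have inj: "x = y" if "c x = c y" "x \<in> carrier M" "y \<in> carrier M" for x y
    using inj_onD[OF bij_betw_imp_inj_on[OF bij]] that by blast
  have surj: "\<exists>x\<in>carrier M. c x = y" if "y \<in> carrier N" for y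
    using that unfolding bij_betw_imp_surj_on[OF bij, symmetric] by auto
  have ab: "abelian_group M"
  proof (rule abelian_groupI)
    fix x assume x: "x \<in> carrier M"
    obtain y where y: "y \<in> carrier M" "c y = \<ominus>\<^bsub>N\<^esub> c x"
      using surj[of "\<ominus>\<^bsub>N\<^esub> c x"] cN[OF x] by auto
    have "c (y \<oplus>\<^bsub>M\<^esub> x) = c \<zero>\<^bsub>M\<^esub>"
      using add[OF y(1) x] y(2) cN[OF x] zero by (simp add: N.M.l_neg)
    then show "\<exists>y\<in>carrier M. y \<oplus>\<^bsub>M\<^esub> x = \<zero>\<^bsub>M\<^esub>"
      using inj add[OF y(1) x] zero y(1) by blast
  next
    fix x y z assume "x \<in> carrier M" "y \<in> carrier M" "z \<in> carrier M"
    then show "x \<oplus>\<^bsub>M\<^esub> y \<oplus>\<^bsub>M\<^esub> z = x \<oplus>\<^bsub>M\<^esub> (y \<oplus>\<^bsub>M\<^esub> z)"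
      using add by (intro inj) (simp_all add: cN N.M.a_assoc)
  next
    fix x y assume "x \<in> carrier M" "y \<in> carrier M"
    then show "x \<oplus>\<^bsub>M\<^esub> y = y \<oplus>\<^bsub>M\<^esub> x"
      using add by (intro inj) (simp_all add: cN N.M.a_comm)
  next
    fix x assume "x \<in> carrier M"
    then show "\<zero>\<^bsub>M\<^esub> \<oplus>\<^bsub>M\<^esub> x = x"
      using add zero by (intro inj) (simp_all add: cN)
  qed (use add zero in blast)+
  interpret M: abelian_group M by (rule ab)
  have lm: "left_module CH M"
  proof (intro left_module.intro left_module_axioms.intro ab ring_CH)
    fix a b x assume "a \<in> carrier CH" "b \<in> carrier CH" "x \<in> carrier M"
    then show "(a \<oplus>\<^bsub>CH\<^esub> b) \<odot>\<^bsub>M\<^esub> x = a \<odot>\<^bsub>M\<^esub> x \<oplus>\<^bsub>M\<^esub> b \<odot>\<^bsub>M\<^esub> x"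
      using add smult N.R.a_closed[of a b] N.smult_l_distr[of a b "c x"] cN by (intro inj) (simp_all del: CH_simps)
    show "(a \<otimes>\<^bsub>CH\<^esub> b) \<odot>\<^bsub>M\<^esub> x = a \<odot>\<^bsub>M\<^esub> (b \<odot>\<^bsub>M\<^esub> x)"
      if "a \<in> carrier CH" "b \<in> carrier CH" "x \<in> carrier M"
      using that smult N.R.m_closed[of a b] N.smult_assoc1[of a b "c x"] cN by (intro inj) (simp_all del: CH_simps)
  next
    fix a x y assume "a \<in> carrier CH" "x \<in> carrier M" "y \<in> carrier M"
    then show "a \<odot>\<^bsub>M\<^esub> (x \<oplus>\<^bsub>M\<^esub> y) = a \<odot>\<^bsub>M\<^esub> x \<oplus>\<^bsub>M\<^esub> a \<odot>\<^bsub>M\<^esub> y"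
      using add smult N.smult_r_distr[of a "c x" "c y"] cN by (intro inj) (simp_all del: CH_simps)
  next
    fix x assume "x \<in> carrier M"
    then show "\<one>\<^bsub>CH\<^esub> \<odot>\<^bsub>M\<^esub> x = x"
      using smult[OF N.R.one_closed, of x] N.smult_one[of "c x"] cN by (intro inj) (simp_all del: CH_simps)
  qed (use smult in blast)
  obtain S where S: "finite S" "S \<subseteq> carrier N"
    and gen: "\<And>x. x \<in> carrier N \<Longrightarrow> \<exists>c \<in> S \<rightarrow> carrier CH. x = (\<Oplus>\<^bsub>N\<^esub>s\<in>S. c s \<odot>\<^bsub>N\<^esub> s)"
    using N unfolding finitely_generated_module_def by blast
  define S' where "S' = {x \<in> carrier M. c x \<in> S}"
  have bijS: "bij_betw c S' S"
    unfolding S'_def using bij S(2) by (auto simp: bij_betw_def inj_on_def image_iff)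
  have finS': "finite S'"
    using bij_betw_finite[OF bijS] S(1) by simp
  have "\<exists>k \<in> S' \<rightarrow> carrier CH. x = (\<Oplus>\<^bsub>M\<^esub>s\<in>S'. k s \<odot>\<^bsub>M\<^esub> s)" if x: "x \<in> carrier M" for x
  proof -
    obtain k where k: "k \<in> S \<rightarrow> carrier CH" "c x = (\<Oplus>\<^bsub>N\<^esub>s\<in>S. k s \<odot>\<^bsub>N\<^esub> s)"
      using gen[OF cN[OF x]] by blast
    have hom: "(\<Oplus>\<^bsub>M\<^esub>s\<in>A. k (c s) \<odot>\<^bsub>M\<^esub> s) \<in> carrier M \<and>
        c (\<Oplus>\<^bsub>M\<^esub>s\<in>A. k (c s) \<odot>\<^bsub>M\<^esub> s) = (\<Oplus>\<^bsub>N\<^esub>s\<in>A. k (c s) \<odot>\<^bsub>N\<^esub> c s)" if "finite A" "A \<subseteq> S'" for A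
      using that
    proof (induction A rule: finite_induct)
      case (insert s A)
      have kc: "k (c s) \<in> carrier CH" "s \<in> carrier M" if "s \<in> insert s A" "s \<in> S'" for s
        using that k(1) by (auto simp: S'_def Pi_iff simp del: CH_simps)
      have *: "(\<lambda>s. k (c s) \<odot>\<^bsub>M\<^esub> s) \<in> A \<rightarrow> carrier M" "k (c s) \<odot>\<^bsub>M\<^esub> s \<in> carrier M"
        "(\<lambda>s. k (c s) \<odot>\<^bsub>N\<^esub> c s) \<in> A \<rightarrow> carrier N" "k (c s) \<odot>\<^bsub>N\<^esub> c s \<in> carrier N"
        "c (k (c s) \<odot>\<^bsub>M\<^esub> s) = k (c s) \<odot>\<^bsub>N\<^esub> c s"
        using insert.prems kc smult N.smult_closed cN by (auto simp: subset_iff simp del: CH_simps)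
      show ?case
        using insert add[OF *(2)] by (simp add: M.finsum_insert[OF _ _ *(1,2)] N.M.finsum_insert[OF _ _ *(3,4)] *(5) *(2))
    qed (simp add: zero)
    have "(\<Oplus>\<^bsub>N\<^esub>s\<in>S. k s \<odot>\<^bsub>N\<^esub> s) = (\<Oplus>\<^bsub>N\<^esub>s\<in>c ` S'. k s \<odot>\<^bsub>N\<^esub> s)"
      using bijS by (simp add: bij_betw_def)
    also have "\<dots> = (\<Oplus>\<^bsub>N\<^esub>s\<in>S'. k (c s) \<odot>\<^bsub>N\<^esub> c s)"
    proof (rule N.M.finsum_reindex)
      show "(\<lambda>s. k s \<odot>\<^bsub>N\<^esub> s) \<in> c ` S' \<rightarrow> carrier N"
        using k(1) S(2) bijS by (auto simp: bij_betw_def Pi_iff simp del: CH_simps intro!: N.smult_closed)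
    qed (use bijS in \<open>simp add: bij_betw_def\<close>)
    finally have "c x = c (\<Oplus>\<^bsub>M\<^esub>s\<in>S'. k (c s) \<odot>\<^bsub>M\<^esub> s)"
      using hom[OF finS' order_refl] k(2) by simp
    then have "x = (\<Oplus>\<^bsub>M\<^esub>s\<in>S'. k (c s) \<odot>\<^bsub>M\<^esub> s)"
      using inj x hom[OF finS' order_refl] by blast
    moreover have "(\<lambda>s. k (c s)) \<in> S' \<rightarrow> carrier CH"
      using k(1) by (auto simp: S'_def Pi_iff simp del: CH_simps)
    ultimately show ?thesis
      by (rule bexI[of _ "\<lambda>s. k (c s)"])
  qed
  then show ?thesis
    unfolding finitely_generated_module_def using lm finS' S'_def by blast
qed

text \<open>If \<rho> describes \<open>M\<close>, then \<rho> composed with \<phi> describes the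
  pullback, through the same coordinate map \<open>c\<close>. Both claims are read off from
  this.\<close>

lemma pullback_module:
  fixes K :: "('h, 'y) monoid_scheme"
  assumes K: "finite_group K" and \<phi>: "\<phi> \<in> hom H K" and M: "M \<in> fg_modules (group_algebra K)"
  shows "pullback_module \<phi> M \<in> fg_modules CH"
    and "\<And>h. h \<in> carrier H \<Longrightarrow> mod_char (pullback_module \<phi> M) h = finite_group.mod_char K M (\<phi> h)"
proof -
  interpret K: finite_group K by (rule K)
  obtain \<rho> where \<rho>: "mat_rep K \<rho>" and iso: "K.module_iso M (rep_mod K \<rho>)"
    using K.fg_module_iso_rep_mod[of M] M by (auto simp: fg_modules_def)
  interpret M: left_module K.CH M
    by (rule K.fg_left_module[OF M])
  obtain c where c: "c \<in> module_homs K.CH M (rep_mod K \<rho>)" and bij: "bij_betw c (carrier M) (carrier (rep_mod K \<rho>))"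
    using iso unfolding K.module_iso_def by blast
  have \<phi>K: "\<phi> h \<in> carrier K" if "h \<in> carrier H" for h
    using \<phi> that by (auto simp: hom_def)
  have \<phi>1: "\<phi> \<one> = \<one>\<^bsub>K\<^esub>"
    by (rule hom_one[OF \<phi> group_axioms K.group_axioms])
  have \<rho>\<phi>: "mat_rep H (\<lambda>h. \<rho> (\<phi> h))"
  proof -
    obtain n where n: "\<And>h. h \<in> carrier K \<Longrightarrow> fin_op n (\<rho> h)"
      using \<rho> unfolding mat_rep_def by blast
    show ?thesis
      unfolding mat_rep_def
    proof (intro conjI exI ballI allI)
      fix g h v assume "g \<in> carrier H" "h \<in> carrier H"
      then show "\<rho> (\<phi> (g \<otimes> h)) v = \<rho> (\<phi> g) (\<rho> (\<phi> h) v)"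
        using \<phi> by (simp add: hom_def mat_rep_mult[OF \<rho>] Pi_iff)
    qed (use n \<phi>K in blast)
  qed
  have car: "carrier (rep_mod H (\<lambda>h. \<rho> (\<phi> h))) = carrier (rep_mod K \<rho>)"
    by (simp add: \<phi>1)
  have map_eq: "group_algebra_map \<phi> a k = (\<Sum>h | h \<in> carrier H \<and> \<phi> h = k. a h)" if "a \<in> carrier CH" for a :: "'g \<Rightarrow> complex" and k
    unfolding group_algebra_map_def using that
    by (intro sum.mono_neutral_left) (auto intro: finite_subset[OF _ finite_carrier])
  have map_closed: "group_algebra_map \<phi> a \<in> carrier K.CH" if "a \<in> carrier CH" for a
  proof -
    have "group_algebra_map \<phi> a k = 0" if "k \<notin> carrier K" for k
    proof -
      have *: "{h. h \<in> carrier H \<and> \<phi> h = k} = {}"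
        using that \<phi>K by blast
      show ?thesis
        unfolding map_eq[OF \<open>a \<in> carrier CH\<close>] * by simp
    qed
    then show ?thesis
      by simp
  qed
  \<comment> \<open>The sum over \<open>K\<close> of fibre sums is regrouped into a single sum over
    \<open>H\<close>.\<close>
  have sm: "group_algebra_map \<phi> a \<odot>\<^bsub>rep_mod K \<rho>\<^esub> v = a \<odot>\<^bsub>rep_mod H (\<lambda>h. \<rho> (\<phi> h))\<^esub> v" if a: "a \<in> carrier CH" for a v
  proof -
    have "group_algebra_map \<phi> a \<odot>\<^bsub>rep_mod K \<rho>\<^esub> v = (\<Sum>k\<in>carrier K. \<Sum>h | h \<in> carrier H \<and> \<phi> h = k. scl (a h) (\<rho> (\<phi> h) v))"
      by (simp add: map_eq[OF a] cvec.scale_sum_left)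
    also have "\<dots> = (\<Sum>h\<in>carrier H. scl (a h) (\<rho> (\<phi> h) v))"
      by (rule sum.group) (use \<phi>K in auto)
    finally show ?thesis by simp
  qed
  have pb: "carrier (pullback_module \<phi> M) = carrier M" "\<zero>\<^bsub>pullback_module \<phi> M\<^esub> = \<zero>\<^bsub>M\<^esub>"
    "x \<oplus>\<^bsub>pullback_module \<phi> M\<^esub> y = x \<oplus>\<^bsub>M\<^esub> y"
    "a \<odot>\<^bsub>pullback_module \<phi> M\<^esub> x = group_algebra_map \<phi> a \<odot>\<^bsub>M\<^esub> x" for x y a
    by (simp_all add: pullback_module_def)
  have csm: "c (a \<odot>\<^bsub>pullback_module \<phi> M\<^esub> x) = a \<odot>\<^bsub>rep_mod H (\<lambda>h. \<rho> (\<phi> h))\<^esub> c x" if "a \<in> carrier CH" "x \<in> carrier M" for a x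
    unfolding pb sm[OF that(1), symmetric] using c map_closed[OF that(1)] that(2)
    unfolding module_homs_def by blast
  have cadd: "c (x \<oplus>\<^bsub>pullback_module \<phi> M\<^esub> y) = c x \<oplus>\<^bsub>rep_mod H (\<lambda>h. \<rho> (\<phi> h))\<^esub> c y" if "x \<in> carrier M" "y \<in> carrier M" for x y
    using c that by (simp add: pb module_homs_def)
  have bij': "bij_betw c (carrier (pullback_module \<phi> M)) (carrier (rep_mod H (\<lambda>h. \<rho> (\<phi> h))))"
    unfolding car pb by (rule bij)
  show fg: "pullback_module \<phi> M \<in> fg_modules CH"
    unfolding fg_modules_def mem_Collect_eq
  proof (rule fg_module_transport[OF _ bij'])
    show "finitely_generated_module CH (rep_mod H (\<lambda>h. \<rho> (\<phi> h)))"
      using fg_rep_mod[OF \<rho>\<phi>] by (simp add: fg_modules_def)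
    show "c \<zero>\<^bsub>pullback_module \<phi> M\<^esub> = \<zero>\<^bsub>rep_mod H (\<lambda>h. \<rho> (\<phi> h))\<^esub>"
      using K.module_hom_zero[OF M.left_module_axioms K.left_module_rep_mod[OF \<rho>] c] by (simp add: pb)
    fix x y assume "x \<in> carrier (pullback_module \<phi> M)" "y \<in> carrier (pullback_module \<phi> M)"
    then show "x \<oplus>\<^bsub>pullback_module \<phi> M\<^esub> y \<in> carrier (pullback_module \<phi> M) \<and>
        c (x \<oplus>\<^bsub>pullback_module \<phi> M\<^esub> y) = c x \<oplus>\<^bsub>rep_mod H (\<lambda>h. \<rho> (\<phi> h))\<^esub> c y"
      using cadd[of x y] by (simp add: pb)
  next
    fix a x assume a: "a \<in> carrier CH" and x: "x \<in> carrier (pullback_module \<phi> M)"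
    have "a \<odot>\<^bsub>pullback_module \<phi> M\<^esub> x \<in> carrier (pullback_module \<phi> M)"
      using M.smult_closed[OF map_closed[OF a]] x unfolding pb by blast
    then show "a \<odot>\<^bsub>pullback_module \<phi> M\<^esub> x \<in> carrier (pullback_module \<phi> M) \<and>
        c (a \<odot>\<^bsub>pullback_module \<phi> M\<^esub> x) = a \<odot>\<^bsub>rep_mod H (\<lambda>h. \<rho> (\<phi> h))\<^esub> c x"
      using csm[OF a, of x] x unfolding pb by blast
  qed (simp add: pb)
  have iso': "module_iso (pullback_module \<phi> M) (rep_mod H (\<lambda>h. \<rho> (\<phi> h)))"
    unfolding module_iso_def module_homs_def
    using bij' csm cadd bij_betw_imp_funcset[OF bij'] pb(1) by blast
  fix h assume h: "h \<in> carrier H"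
  show "mod_char (pullback_module \<phi> M) h = K.mod_char M (\<phi> h)"
    using mod_char_iso[OF fg fg_rep_mod[OF \<rho>\<phi>] iso' h] mod_char_rep_mod[OF \<rho>\<phi> h]
      K.mod_char_iso[OF M K.fg_rep_mod[OF \<rho>] iso \<phi>K[OF h]] K.mod_char_rep_mod[OF \<rho> \<phi>K[OF h]] by simp
qed

text \<open>Pullback of classes becomes composition of characters with \<phi>. All representatives
  of \<open>X\<close> have the same character on \<open>K\<close>, so the union defining
  \<open>rep_pullback\<close> consists of equal cosets.\<close>

lemma rep_pullback_eq:
  fixes K :: "('h, 'y) monoid_scheme"
  assumes K: "finite_group K" and \<phi>: "\<phi> \<in> hom H K" and X: "X \<in> carrier (rep_group K)"
  shows "rep_pullback H \<phi> X = char_class (\<lambda>h. finite_group.class_char K X (\<phi> h))"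
    and "virtual_char (\<lambda>h. finite_group.class_char K X (\<phi> h))"
proof -
  interpret K: finite_group K by (rule K)
  let ?e = "frag_extend (\<lambda>M. frag_of (pullback_module \<phi> M))"
  have e: "Poly_Mapping.keys (?e p) \<subseteq> fg_modules CH \<and> (\<forall>h\<in>carrier H. frag_char (?e p) h = K.frag_char p (\<phi> h))"
    if "Poly_Mapping.keys p \<subseteq> fg_modules K.CH" for p
    using that
  proof (induction p rule: frag_induction)
    case zero
    then show ?case by simp
  next
    case (one M)
    then show ?case
      using pullback_module[OF K \<phi> one] by simp
  next
    case (diff a b)
    then show ?case
      using keys_diff[of "?e a" "?e b"] by (auto simp: frag_extend_diff)
  qed
  have Xeq: "X = K.char_class (K.class_char X)" and vX: "K.virtual_char (K.class_char X)"
    using K.char_class_class_char[OF X] by simp_all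
  have mem: "Poly_Mapping.keys p \<subseteq> fg_modules K.CH" "\<And>k. k \<in> carrier K \<Longrightarrow> K.frag_char p k = K.class_char X k" if "p \<in> X" for p
    using that Xeq unfolding K.char_class_def by blast+
  have \<phi>K: "\<phi> h \<in> carrier K" if "h \<in> carrier H" for h
    using \<phi> that by (auto simp: hom_def)
  have "exact_null #>\<^bsub>free_Abelian_group (fg_modules CH)\<^esub> ?e p = char_class (\<lambda>h. K.class_char X (\<phi> h))" if p: "p \<in> X" for p
  proof -
    have "exact_null #>\<^bsub>free_Abelian_group (fg_modules CH)\<^esub> ?e p = char_class (frag_char (?e p))"
      by (rule r_coset_exact_null) (use e[OF mem(1)[OF p]] in blast)
    also have "\<dots> = char_class (\<lambda>h. K.class_char X (\<phi> h))"
      by (rule char_class_cong) (use e[OF mem(1)[OF p]] mem(2)[OF p] \<phi>K in simp)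
    finally show ?thesis .
  qed
  moreover obtain p where p: "p \<in> X"
    using vX Xeq unfolding K.virtual_char_def by blast
  ultimately show "rep_pullback H \<phi> X = char_class (\<lambda>h. K.class_char X (\<phi> h))"
    unfolding rep_pullback_def by (simp cong: SUP_cong) blast
  show "virtual_char (\<lambda>h. K.class_char X (\<phi> h))"
    by (rule virtual_charI[of "?e p"]) (use e[OF mem(1)[OF p]] mem(2)[OF p] \<phi>K in auto)
qed

end

section \<open>Characters induced from cyclic subgroups\<close>

text \<open>The factor at \<open>p\<close> is p - \<Sum>_i \<zeta>_p^(it), an integral combination
  of characters of \<int>/m. Hence a positive multiple of the indicator of the generators of
  \<int>/m is such a combination as well.\<close>

lemma prod_primes_not_dvd:
  fixes m t :: nat
  assumes "m > 0"
  shows "(\<Prod>p | prime p \<and> p dvd m. if p dvd t then 0 else of_nat p :: complex) =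
    (if coprime t m then of_nat (\<Prod>p | prime p \<and> p dvd m. p) else 0)"
proof -
  have fin: "finite {p. prime p \<and> p dvd m}"
    using assms by (auto intro!: finite_subset[OF _ finite_atMost[of m]] dest: dvd_imp_le)
  show ?thesis
  proof (cases "coprime t m")
    case True
    have "\<not> p dvd t" if "prime p" "p dvd m" for p
      using coprime_common_divisor[OF True _ that(2)] not_prime_unit that(1) by blast
    then have "(\<Prod>p | prime p \<and> p dvd m. if p dvd t then 0 else of_nat p :: complex) = (\<Prod>p | prime p \<and> p dvd m. of_nat p)"
      by (intro prod.cong) auto
    then show ?thesis
      using True by simp
  next
    case False
    then obtain p where "prime p" "p dvd gcd t m"
      using prime_factor_nat[of "gcd t m"] by (auto simp: coprime_iff_gcd_eq_1)
    then have "\<exists>p\<in>{p. prime p \<and> p dvd m}. (if p dvd t then 0 else of_nat p :: complex) = 0"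
      by (intro bexI[of _ p]) auto
    then show ?thesis
      using False prod_zero[OF fin] by simp
  qed
qed

lemma root_unity_scale:
  assumes "p > 0" "m = p * q" "q > 0"
  shows "root_unity m (int q * k) = root_unity p k"
  using assms by (simp add: root_unity_def field_simps)

context finite_group
begin

lemma virtual_char_sum:
  "(\<And>i. i \<in> A \<Longrightarrow> virtual_char (f i)) \<Longrightarrow> virtual_char (\<lambda>h. \<Sum>i\<in>A. f i h)"
  by (induction A rule: infinite_finite_induct) (auto intro: virtual_char_0 virtual_char_add)

lemma virtual_char_nat_mult:
  assumes "virtual_char f"
  shows "virtual_char (\<lambda>h. of_nat k * f h)"
proof -
  have "virtual_char (\<lambda>h. \<Sum>i<k. f h)"
    by (rule virtual_char_sum) (rule assms)
  then show ?thesis by simp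
qed

text \<open>The representation induced along \<open>t \<mapsto> k^t\<close> from a character of \<open>\<int>/m\<close>, realised on functions on the
  group: left translation composed with an averaging over right translations by powers of \<open>k\<close>.\<close>

lemma virtual_char_induced:
  assumes k: "k \<in> carrier H" and m: "m > 0" "k [^] m = \<one>"
  shows "virtual_char (\<lambda>h. (1 / of_nat m) *
    (\<Sum>t<m. root_unity m (b * int t) * of_nat (card {g \<in> carrier H. g \<otimes> k [^] t \<otimes> inv g = h})))"
proof -
  define N where "N = card (carrier H)"
  obtain e where e: "bij_betw e {..<N} (carrier H)"
    unfolding N_def using bij_betw_from_nat_into_finite[OF finite_carrier] by blast
  define idx where "idx = inv_into {..<N} e"
  have idx: "idx g < N" "e (idx g) = g" if "g \<in> carrier H" for g
    using bij_betw_inv_into[OF e] bij_betwE[of idx "carrier H" "{..<N}"] that e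
    unfolding idx_def by (auto simp: bij_betw_def f_inv_into_f)
  have eH: "e i \<in> carrier H" and idxe: "idx (e i) = i" if "i < N" for i
    using bij_betwE[OF e] that e unfolding idx_def by (auto simp: bij_betw_def)
  \<comment> \<open>Sequences below \<open>N\<close> are functions f on the group. The image of
    \<rho>(1) consists of those with f(xk) = \<zeta>^(-b) f(x), which is an induced module, and
    \<open>h\<close> acts on it by left translation.\<close>
  define \<rho> where "\<rho> h v = (\<lambda>i. if i < N then (1 / of_nat m) *
      (\<Sum>t<m. root_unity m (b * int t) * v (idx (inv h \<otimes> e i \<otimes> k [^] t))) else 0)" for h and v :: "nat \<Rightarrow> complex"
  have fin: "fin_op N (\<rho> h)" if h: "h \<in> carrier H" for h
    unfolding fin_op_def
  proof (intro conjI allI impI)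
    fix u v :: "nat \<Rightarrow> complex" and c
    show "\<rho> h (u + v) = \<rho> h u + \<rho> h v"
      by (auto simp: \<rho>_def sum.distrib ring_distribs)
    show "\<rho> h (scl c v) = scl c (\<rho> h v)"
      by (auto simp: \<rho>_def sum_distrib_left mult_ac)
    show "\<rho> h (\<lambda>i. if i < N then v i else 0) = \<rho> h v"
      using h k by (auto simp: \<rho>_def idx eH)
  qed (simp add: \<rho>_def)
  have mult: "\<rho> (g \<otimes> h) v = \<rho> g (\<rho> h v)" if g: "g \<in> carrier H" and h: "h \<in> carrier H" for g h v
  proof
    fix i
    show "\<rho> (g \<otimes> h) v i = \<rho> g (\<rho> h v) i"
    proof (cases "i < N")
      case True
      define x where "x = inv h \<otimes> inv g \<otimes> e i"
      have x: "x \<in> carrier H"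
        using g h eH[OF True] by (simp add: x_def)
      define F where "F t = root_unity m (b * int t) * v (idx (x \<otimes> k [^] t))" for t :: nat
      have per: "F (t + m) = F t" for t
      proof -
        have "k [^] (t + m) = k [^] t"
          using k m(2) nat_pow_mult[OF k, of t m] by simp
        moreover have "root_unity m (b * int (t + m)) = root_unity m (b * int t)"
          using root_unity_add[of m "b * int t" "int m * b"] root_unity_period[OF m(1), of b]
          by (simp add: algebra_simps)
        ultimately show ?thesis by (simp add: F_def)
      qed
      have "\<rho> g (\<rho> h v) i = (1 / of_nat m) * (\<Sum>t<m. (1 / of_nat m) * (\<Sum>s<m. F (t + s)))"
      proof -
        have "root_unity m (b * int t) * \<rho> h v (idx (inv g \<otimes> e i \<otimes> k [^] t)) = (1 / of_nat m) * (\<Sum>s<m. F (t + s))" for t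
        proof -
          let ?y = "inv g \<otimes> e i \<otimes> k [^] t"
          have y: "?y \<in> carrier H"
            using g eH[OF True] k by simp
          have "inv h \<otimes> ?y \<otimes> k [^] s = x \<otimes> k [^] (t + s)" for s
            using g h eH[OF True] k by (simp add: x_def m_assoc flip: nat_pow_mult)
          then show ?thesis
            unfolding \<rho>_def[of h] F_def using idx[OF y]
            by (simp add: sum_distrib_left ring_distribs root_unity_add mult_ac)
        qed
        then show ?thesis
          unfolding \<rho>_def[of g] using True by simp
      qed
      also have "\<dots> = (1 / of_nat m) * (\<Sum>t<m. (1 / of_nat m) * (\<Sum>s<m. F s))"
        using sum_periodic[of F m, OF per] by simp
      also have "\<dots> = (1 / of_nat m) * (\<Sum>s<m. F s)"
        using m(1) by simp
      also have "\<dots> = \<rho> (g \<otimes> h) v i"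
        using True g h by (simp add: \<rho>_def F_def x_def inv_mult_group)
      finally show ?thesis ..
    qed (simp add: \<rho>_def)
  qed
  have rep: "mat_rep H \<rho>"
    unfolding mat_rep_def using fin mult by blast
  have tr: "op_trace (\<rho> h) = (1 / of_nat m) *
    (\<Sum>t<m. root_unity m (b * int t) * of_nat (card {g \<in> carrier H. g \<otimes> k [^] t \<otimes> inv g = h}))" if h: "h \<in> carrier H" for h
  proof -
    \<comment> \<open>The map x \<mapsto> h^-1 x k^t contributes to the diagonal at its fixed
      points, which are the x with x k^t x^-1 = h.\<close>
    have "op_trace (\<rho> h) = (\<Sum>i<N. (1 / of_nat m) * (\<Sum>t<m. root_unity m (b * int t) * (if idx (inv h \<otimes> e i \<otimes> k [^] t) = i then 1 else 0)))"
      unfolding op_trace_eq[OF fin[OF h]] by (intro sum.cong refl) (simp add: \<rho>_def)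
    also have "\<dots> = (\<Sum>i<N. (1 / of_nat m) * (\<Sum>t<m. root_unity m (b * int t) * (if e i \<otimes> k [^] t \<otimes> inv (e i) = h then 1 else 0)))"
    proof -
      have "idx (inv h \<otimes> e i \<otimes> k [^] t) = i \<longleftrightarrow> e i \<otimes> k [^] t \<otimes> inv (e i) = h" if i: "i < N" for i and t :: nat
      proof -
        have x: "inv h \<otimes> e i \<otimes> k [^] t \<in> carrier H"
          using eH[OF i] h k by simp
        have "idx (inv h \<otimes> e i \<otimes> k [^] t) = i \<longleftrightarrow> inv h \<otimes> e i \<otimes> k [^] t = e i"
        proof
          assume "idx (inv h \<otimes> e i \<otimes> k [^] t) = i"
          with idx(2)[OF x] show "inv h \<otimes> e i \<otimes> k [^] t = e i"
            by (rule_tac trans[OF sym]) simp_all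
        qed (simp add: idxe[OF i])
        also have "\<dots> \<longleftrightarrow> e i = inv h \<otimes> (e i \<otimes> k [^] t)"
          using eH[OF i] h k by (auto simp: m_assoc)
        also have "\<dots> \<longleftrightarrow> e i \<otimes> k [^] t = h \<otimes> e i"
          by (rule inv_solve_left) (use eH[OF i] h k in simp_all)
        also have "\<dots> \<longleftrightarrow> h = e i \<otimes> k [^] t \<otimes> inv (e i)"
          using inv_solve_right[of h "e i \<otimes> k [^] t" "e i"] eH[OF i] h k by simp
        finally show ?thesis
          by (simp only: eq_commute)
      qed
      then show ?thesis by simp
    qed
    also have "\<dots> = (\<Sum>g\<in>carrier H. (1 / of_nat m) * (\<Sum>t<m. root_unity m (b * int t) * (if g \<otimes> k [^] t \<otimes> inv g = h then 1 else 0)))"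
      by (rule sum.reindex_bij_betw[OF e])
    also have "\<dots> = (1 / of_nat m) * (\<Sum>t<m. root_unity m (b * int t) * (\<Sum>g\<in>carrier H. if g \<otimes> k [^] t \<otimes> inv g = h then 1 else 0))"
      unfolding sum_distrib_left[symmetric] by (subst sum.swap) (simp add: sum_distrib_left)
    also have "\<dots> = (1 / of_nat m) * (\<Sum>t<m. root_unity m (b * int t) * of_nat (card {g \<in> carrier H. g \<otimes> k [^] t \<otimes> inv g = h}))"
      by (simp add: sum.If_cases Int_def)
    finally show ?thesis .
  qed
  show ?thesis
    by (rule virtual_charI[of "frag_of (rep_mod H \<rho>)"]) (simp_all add: fg_rep_mod[OF rep] mod_char_rep_mod[OF rep] tr)
qed

text \<open>Multiplying a combination of characters of \<open>\<int>/m\<close> by \<open>p - \<Sum>\<^sub>i \<zeta>\<^sub>p\<^sup>i\<^sup>t\<close> for a prime divisor \<open>p\<close> of \<open>m\<close> kills the multiples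
  of \<open>p\<close>. Doing this for all \<open>p\<close> isolates the generators of \<open>\<int>/m\<close>.\<close>

lemma virtual_char_induced_coprime:
  assumes k: "k \<in> carrier H" and m: "m > 0" "k [^] m = \<one>"
  shows "virtual_char (\<lambda>h. (1 / of_nat m) * (\<Sum>t<m. (if coprime t m then of_nat (\<Prod>p | prime p \<and> p dvd m. p) else 0) *
    root_unity m (b * int t) * of_nat (card {g \<in> carrier H. g \<otimes> k [^] t \<otimes> inv g = h})))"
proof -
  define c where "c t h = (of_nat (card {g \<in> carrier H. g \<otimes> k [^] t \<otimes> inv g = h}) :: complex)" for t :: nat and h
  define I where "I F b h = (1 / of_nat m) * (\<Sum>t<m. F t * root_unity m (b * int t) * c t h)" for F b h
  \<comment> \<open>The exponent \<open>b\<close> has to vary in the induction over the set of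
    primes, since each step uses shifted exponents.\<close>
  have "virtual_char (I (\<lambda>t. \<Prod>p\<in>P. if p dvd t then 0 else of_nat p) b)"
    if "finite P" "P \<subseteq> {p. prime p \<and> p dvd m}" for P b
    using that
  proof (induction P arbitrary: b rule: finite_induct)
    case empty
    then show ?case
      using virtual_char_induced[OF k m, of b] by (simp add: I_def[abs_def] c_def)
  next
    case (insert p P)
    obtain q where q: "m = p * q"
      using insert.prems by auto
    have p: "p > 0" "q > 0"
      using q m(1) by auto
    define F where "F t = (\<Prod>p\<in>P. if p dvd t then 0 else of_nat p :: complex)" for t
    have IH: "virtual_char (I F b)" for b
      unfolding F_def[abs_def] using insert.IH insert.prems by simp
    \<comment> \<open>As m = p q, shifting \<open>b\<close> by i q multiplies the term at t by
      \<zeta>_p^(it). Summed over i < p this is p if p divides t and 0 otherwise, so the difference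
      keeps exactly the t not divisible by p.\<close>
    have "virtual_char (\<lambda>h. of_nat p * I F b h + - (\<Sum>i<p. I F (b + int i * int q) h))"
      by (intro virtual_char_add virtual_char_uminus virtual_char_sum virtual_char_nat_mult IH)
    also have "(\<lambda>h. of_nat p * I F b h + - (\<Sum>i<p. I F (b + int i * int q) h)) =
        I (\<lambda>t. \<Prod>p\<in>insert p P. if p dvd t then 0 else of_nat p) b"
    proof
      fix h
      have s: "(\<Sum>i<p. root_unity m ((b + int i * int q) * int t)) = root_unity m (b * int t) * (if p dvd t then of_nat p else 0)" for t
      proof -
        have "root_unity m ((b + int i * int q) * int t) = root_unity m (b * int t) * root_unity p (int i * int t)" for i
          using root_unity_scale[OF p(1) q p(2), of "int i * int t"]
          by (simp add: ring_distribs root_unity_add mult_ac)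
        then show ?thesis
          using sum_root_unity[OF p(1), of "int t"] by (simp add: sum_distrib_left[symmetric])
      qed
      have "(\<Sum>i<p. I F (b + int i * int q) h) = (1 / of_nat m) * (\<Sum>t<m. F t * (\<Sum>i<p. root_unity m ((b + int i * int q) * int t)) * c t h)"
        unfolding I_def sum_distrib_left[symmetric] sum_distrib_right[symmetric]
        by (subst sum.swap) (simp add: sum_distrib_left sum_distrib_right)
      then have "of_nat p * I F b h + - (\<Sum>i<p. I F (b + int i * int q) h) =
          (1 / of_nat m) * (\<Sum>t<m. of_nat p * (F t * root_unity m (b * int t) * c t h)
             - F t * (root_unity m (b * int t) * (if p dvd t then of_nat p else 0)) * c t h)"
        unfolding s I_def by (simp add: sum_subtractf sum_distrib_left right_diff_distrib mult_ac)
      also have "\<dots> = I (\<lambda>t. \<Prod>p\<in>insert p P. if p dvd t then 0 else of_nat p) b h"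
        unfolding I_def F_def using insert.hyps
        by (intro arg_cong2[where f = "(*)"] sum.cong refl) (auto simp: algebra_simps)
      finally show "of_nat p * I F b h + - (\<Sum>i<p. I F (b + int i * int q) h) =
        I (\<lambda>t. \<Prod>p\<in>insert p P. if p dvd t then 0 else of_nat p) b h" .
    qed
    finally show ?case .
  qed
  moreover have "finite {p. prime p \<and> p dvd m}"
    using m(1) by (auto intro!: finite_subset[OF _ finite_atMost[of m]] dest: dvd_imp_le)
  ultimately have "virtual_char (I (\<lambda>t. \<Prod>p | prime p \<and> p dvd m. if p dvd t then 0 else of_nat p) b)"
    by blast
  then show ?thesis
    unfolding prod_primes_not_dvd[OF m(1)] by (simp add: I_def[abs_def] c_def)
qed

text \<open>The induced characters for all k in a conjugation-invariant set \<open>C\<close> are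
  added up. Counting conjugating elements g then turns into counting t-th roots of h in
  \<open>C\<close>, a quantity without any conjugation in it.\<close>

lemma virtual_char_root_sum:
  assumes m: "m > 0" "\<And>k. k \<in> carrier H \<Longrightarrow> k [^] m = \<one>"
    and C: "C \<subseteq> carrier H" "\<And>g k. g \<in> carrier H \<Longrightarrow> k \<in> C \<Longrightarrow> g \<otimes> k \<otimes> inv g \<in> C"
  shows "virtual_char (\<lambda>h. of_nat ((\<Prod>p | prime p \<and> p dvd m. p) * order H) *
    (\<Sum>t | t < m \<and> coprime t m. root_unity m (b * int t) * of_nat (card {k \<in> C. k [^] t = h})))"
proof -
  define N :: nat where "N = (\<Prod>p | prime p \<and> p dvd m. p)"
  have finC: "finite C"
    using finite_subset[OF C(1)] by simp
  \<comment> \<open>Conjugation by each g permutes \<open>C\<close>, so every g contributes the same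
    number of roots.\<close>
  have count: "(\<Sum>k\<in>C. card {g \<in> carrier H. g \<otimes> k [^] t \<otimes> inv g = h}) = order H * card {k \<in> C. k [^] t = h}" for t :: nat and h
  proof -
    have "(\<Sum>k\<in>C. card {g \<in> carrier H. g \<otimes> k [^] t \<otimes> inv g = h}) =
        (\<Sum>k\<in>C. \<Sum>g\<in>carrier H. if g \<otimes> k [^] t \<otimes> inv g = h then 1 else 0)"
      by (simp add: sum.If_cases Int_def)
    also have "\<dots> = (\<Sum>g\<in>carrier H. \<Sum>k\<in>C. if g \<otimes> k [^] t \<otimes> inv g = h then 1 else 0)"
      by (rule sum.swap)
    also have "\<dots> = (\<Sum>g\<in>carrier H. \<Sum>k\<in>C. if k [^] t = h then 1 else 0)"
    proof (rule sum.cong[OF refl])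
      fix g assume g: "g \<in> carrier H"
      have pow: "g \<otimes> k [^] t \<otimes> inv g = (g \<otimes> k \<otimes> inv g) [^] t" if k: "k \<in> carrier H" for k
      proof (induction t)
        case (Suc t)
        have "inv g \<otimes> (g \<otimes> y) = y" if "y \<in> carrier H" for y
          using g that by (simp flip: m_assoc)
        then show ?case
          using g k Suc[symmetric] by (simp add: m_assoc)
      qed (use g in simp)
      have "(\<Sum>k\<in>C. if g \<otimes> k [^] t \<otimes> inv g = h then 1 else 0) = (\<Sum>k\<in>C. if (g \<otimes> k \<otimes> inv g) [^] t = h then 1 else 0 :: nat)"
        using C(1) pow by (intro sum.cong refl) auto
      also have "\<dots> = (\<Sum>k\<in>C. if k [^] t = h then 1 else 0)"
      proof (rule sum.reindex_bij_witness[where i = "\<lambda>k. inv g \<otimes> k \<otimes> g" and j = "\<lambda>k. g \<otimes> k \<otimes> inv g"])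
        fix k assume k: "k \<in> C"
        then have kH: "k \<in> carrier H" using C(1) by auto
        have c1: "inv g \<otimes> (g \<otimes> y) = y" "g \<otimes> (inv g \<otimes> y) = y" if "y \<in> carrier H" for y
          using g that by (simp_all flip: m_assoc)
        show "inv g \<otimes> (g \<otimes> k \<otimes> inv g) \<otimes> g = k" "g \<otimes> (inv g \<otimes> k \<otimes> g) \<otimes> inv g = k"
          using g kH by (simp_all add: m_assoc c1)
        show "g \<otimes> k \<otimes> inv g \<in> C" "inv g \<otimes> k \<otimes> g \<in> C"
          using C(2)[OF g k] C(2)[of "inv g" k] g k by simp_all
      qed simp
      finally show "(\<Sum>k\<in>C. if g \<otimes> k [^] t \<otimes> inv g = h then 1 else 0) = (\<Sum>k\<in>C. if k [^] t = h then 1 else 0 :: nat)" .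
    qed
    also have "\<dots> = order H * card {k \<in> C. k [^] t = h}"
      using finC by (simp add: sum.If_cases Int_def order_def)
    finally show ?thesis .
  qed
  \<comment> \<open>The outer factor \<open>m\<close> clears the denominators of the induced
    characters.\<close>
  have "virtual_char (\<lambda>h. of_nat m * (\<Sum>k\<in>C. (1 / of_nat m) * (\<Sum>t<m. (if coprime t m then of_nat N else 0) *
    root_unity m (b * int t) * of_nat (card {g \<in> carrier H. g \<otimes> k [^] t \<otimes> inv g = h}))))"
    unfolding N_def using C(1) m by (intro virtual_char_nat_mult virtual_char_sum virtual_char_induced_coprime) auto
  also have "(\<lambda>h. of_nat m * (\<Sum>k\<in>C. (1 / of_nat m) * (\<Sum>t<m. (if coprime t m then of_nat N else 0) *
    root_unity m (b * int t) * of_nat (card {g \<in> carrier H. g \<otimes> k [^] t \<otimes> inv g = h})))) =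
    (\<lambda>h. of_nat (N * order H) * (\<Sum>t | t < m \<and> coprime t m. root_unity m (b * int t) * of_nat (card {k \<in> C. k [^] t = h})))"
  proof
    fix h
    have "of_nat m * (\<Sum>k\<in>C. (1 / of_nat m) * (\<Sum>t<m. (if coprime t m then of_nat N else 0) *
        root_unity m (b * int t) * of_nat (card {g \<in> carrier H. g \<otimes> k [^] t \<otimes> inv g = h}))) =
      (\<Sum>t<m. (if coprime t m then of_nat N else 0) * root_unity m (b * int t) *
        of_nat (\<Sum>k\<in>C. card {g \<in> carrier H. g \<otimes> k [^] t \<otimes> inv g = h}))"
      using m(1) unfolding sum_distrib_left[symmetric, of "1 / of_nat m"]
      by (subst sum.swap) (simp add: sum_distrib_left)
    also have "\<dots> = (\<Sum>t<m. if coprime t m then of_nat (N * order H) * (root_unity m (b * int t) * of_nat (card {k \<in> C. k [^] t = h})) else 0)"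
      unfolding count by (intro sum.cong refl) auto
    also have "\<dots> = of_nat (N * order H) * (\<Sum>t | t < m \<and> coprime t m. root_unity m (b * int t) * of_nat (card {k \<in> C. k [^] t = h}))"
      by (simp add: sum.If_cases sum_distrib_left Int_def)
    finally show "of_nat m * (\<Sum>k\<in>C. (1 / of_nat m) * (\<Sum>t<m. (if coprime t m then of_nat N else 0) *
        root_unity m (b * int t) * of_nat (card {g \<in> carrier H. g \<otimes> k [^] t \<otimes> inv g = h}))) =
      of_nat (N * order H) * (\<Sum>t | t < m \<and> coprime t m. root_unity m (b * int t) * of_nat (card {k \<in> C. k [^] t = h}))" .
  qed
  finally show ?thesis
    by (simp add: N_def)
qed

text \<open>The multiplicity functional is additive, and on modules it is a natural number by
  \<open>rep_multiplicity_nat\<close>.\<close>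

lemma virtual_char_multiplicity_int:
  assumes f: "virtual_char f" and h: "h \<in> carrier H" and m: "m > 0" "h [^] m = \<one>"
  shows "\<exists>k::int. (1 / of_nat m) * (\<Sum>s<m. root_unity m (- (int a * int s)) * f (h [^] s)) = of_int k"
proof -
  define L where "L f = (1 / of_nat m) * (\<Sum>s<m. root_unity m (- (int a * int s)) * f (h [^] s))" for f
  obtain p where p: "Poly_Mapping.keys p \<subseteq> fg_modules CH" "\<And>h. h \<in> carrier H \<Longrightarrow> frag_char p h = f h"
    using f by (rule virtual_charE) blast
  have "\<exists>k::int. L (frag_char p) = of_int k"
    using p(1)
  proof (induction p rule: frag_induction)
    case zero
    show ?case by (rule exI[of _ 0]) (simp add: L_def)
  next
    case (one M)
    obtain k :: nat where "(1 / of_nat m) * (\<Sum>s<m. root_unity m (- (int a * int s)) * op_trace (mod_rep M (h [^] s))) = of_nat k"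
      using rep_multiplicity_nat[OF mod_rep(1)[OF one] h m] by blast
    then show ?case
      by (intro exI[of _ "int k"]) (simp add: L_def mod_char_def)
  next
    case (diff p q)
    then obtain k l :: int where "L (frag_char p) = of_int k" "L (frag_char q) = of_int l"
      by blast
    moreover have "L (frag_char (p - q)) = L (frag_char p) - L (frag_char q)"
      by (simp add: L_def right_diff_distrib sum_subtractf)
    ultimately have "L (frag_char (p - q)) = of_int (k - l)"
      by (simp only: of_int_diff)
    then show ?case
      by (rule exI)
  qed
  moreover have "L (frag_char p) = L f"
    using h by (simp add: L_def p(2))
  ultimately have "\<exists>k::int. L f = of_int k"
    by simp
  then show ?thesis
    unfolding L_def .
qed

end

section \<open>Integral lattices in spaces of class functions\<close>

text \<open>As simplification rules these also rewrite the unapplied functions, into abstractions.\<close>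

declare scl_apply [simp del] sum_fun_apply [simp del] zero_fun_apply [simp del] plus_fun_apply [simp del] minus_apply [simp del]
  uminus_apply [simp del]

lemmas fun_apply_simps = scl_apply sum_fun_apply zero_fun_apply plus_fun_apply minus_apply uminus_apply

lemma scl_of_int_mem:
  assumes A: "0 \<in> A" "\<And>u v. u \<in> A \<Longrightarrow> v \<in> A \<Longrightarrow> u - v \<in> A" and v: "v \<in> A"
  shows "scl (of_int j) v \<in> A"
proof -
  have neg: "- u \<in> A" if "u \<in> A" for u
    using A(2)[OF A(1) that] by simp
  have nat: "scl (of_nat k) v \<in> A" for k
  proof (induction k)
    case 0
    have "scl (of_nat 0) v = 0"
      by (auto simp: fun_eq_iff fun_apply_simps)
    then show ?case
      using A(1) by (simp only:)
  next
    case (Suc k)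
    have "scl (of_nat k) v - (- v) = scl (of_nat (Suc k)) v"
      by (auto simp: fun_eq_iff fun_apply_simps algebra_simps)
    then show ?case
      using A(2)[OF Suc neg[OF v]] by (simp only:)
  qed
  show ?thesis
  proof (cases j rule: int_cases2)
    case (nonneg k)
    then show ?thesis using nat[of k] by (simp only: of_int_of_nat_eq)
  next
    case (nonpos k)
    have "scl (of_int j) v = - scl (of_nat k) v"
      by (auto simp: fun_eq_iff fun_apply_simps nonpos)
    then show ?thesis using neg[OF nat[of k]] by (simp only:)
  qed
qed

lemma inj_unit_vec: "inj_on unit_vec A"
proof (rule inj_onI)
  fix i j assume "unit_vec i = unit_vec j"
  then have "unit_vec i i = unit_vec j i" by simp
  then show "i = j" by (simp split: if_splits)
qed

text \<open>The coordinate functionals are treated one at a time: the kernel of the last one has a basis by induction, and an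
  element on which the last one takes its least positive value completes it.\<close>

lemma integral_subgroup_basis:
  fixes \<psi> :: "nat \<Rightarrow> (nat \<Rightarrow> complex) \<Rightarrow> complex"
  assumes lin: "\<And>i u v. \<psi> i (u + v) = \<psi> i u + \<psi> i v" "\<And>i c v. \<psi> i (scl c v) = c * \<psi> i v"
    and A: "0 \<in> A" "\<And>u v. u \<in> A \<Longrightarrow> v \<in> A \<Longrightarrow> u - v \<in> A"
    and int: "\<And>i a. i < M \<Longrightarrow> a \<in> A \<Longrightarrow> \<psi> i a \<in> \<int>"
    and inj: "\<And>a. a \<in> A \<Longrightarrow> (\<And>i. i < M \<Longrightarrow> \<psi> i a = 0) \<Longrightarrow> a = 0"
  shows "\<exists>B. finite B \<and> B \<subseteq> A \<and> cvec.independent B \<and>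
    (\<forall>a\<in>A. \<exists>z::_ \<Rightarrow> int. a = (\<Sum>b\<in>B. scl (of_int (z b)) b))"
  using A int inj
proof (induction M arbitrary: A)
  case 0
  then have "A = {0}" by blast
  then show ?case
    by (intro exI[of _ "{}"]) (simp add: cvec.independent_empty)
next
  case (Suc M A)
  have diff: "\<psi> i (u - v) = \<psi> i u - \<psi> i v" for i u v
    using lin(1)[of i "u - v" v] by simp
  define A' where "A' = {a \<in> A. \<psi> M a = 0}"
  have "\<exists>B. finite B \<and> B \<subseteq> A' \<and> cvec.independent B \<and> (\<forall>a\<in>A'. \<exists>z::_ \<Rightarrow> int. a = (\<Sum>b\<in>B. scl (of_int (z b)) b))"
  proof (rule Suc.IH)
    show "0 \<in> A'"
      using Suc.prems(1) diff[of M 0 0] by (simp add: A'_def)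
    show "u - v \<in> A'" if "u \<in> A'" "v \<in> A'" for u v
      using that Suc.prems(2) by (simp add: A'_def diff)
    show "\<psi> i a \<in> \<int>" if "i < M" "a \<in> A'" for i a
      using that Suc.prems(3)[of i a] by (simp add: A'_def)
    show "a = 0" if "a \<in> A'" "\<And>i. i < M \<Longrightarrow> \<psi> i a = 0" for a
      using that Suc.prems(4)[of a] by (auto simp: A'_def less_Suc_eq)
  qed
  then obtain B' where B': "finite B'" "B' \<subseteq> A'" "cvec.independent B'"
    "\<And>a. a \<in> A' \<Longrightarrow> \<exists>z::_ \<Rightarrow> int. a = (\<Sum>b\<in>B'. scl (of_int (z b)) b)"
    by blast
  show ?case
  proof (cases "A' = A")
    case True
    then show ?thesis using B' by blast
  next
    case False
    then obtain w where w: "w \<in> A" "\<psi> M w \<noteq> 0"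
      by (auto simp: A'_def)
    define P where "P d \<longleftrightarrow> d > 0 \<and> (\<exists>v\<in>A. \<psi> M v = of_nat d)" for d
    have "\<exists>d. P d"
    proof -
      obtain j :: int where j: "\<psi> M w = of_int j"
        using Suc.prems(3)[of M w] w(1) by (auto elim: Ints_cases)
      have "P (nat \<bar>j\<bar>)"
      proof (cases "j > 0")
        case True
        then show ?thesis using w j by (auto simp: P_def intro!: bexI[of _ w])
      next
        case False
        then have "\<psi> M (0 - w) = of_nat (nat \<bar>j\<bar>)" "nat \<bar>j\<bar> > 0"
          using w j diff[of M 0 0] diff[of M 0 w] False by auto
        then show ?thesis
          unfolding P_def using Suc.prems(2)[OF Suc.prems(1) w(1)] by blast
      qed
      then show ?thesis ..
    qed
    define d where "d = (LEAST d. P d)"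
    have d: "P d" and least: "P e \<Longrightarrow> d \<le> e" for e
      unfolding d_def using \<open>\<exists>d. P d\<close> by (auto intro: LeastI_ex Least_le)
    obtain v where v: "v \<in> A" "\<psi> M v = of_nat d" "d > 0"
      using d by (auto simp: P_def)
    \<comment> \<open>Complex linearity of the functional gives independence over \<complex>: it
      vanishes on the whole complex span of \<open>B'\<close> but not at \<open>v\<close>.\<close>
    have vanish: "\<psi> M x = 0" if "x \<in> cvec.span B'" for x
    proof -
      have "\<psi> M 0 = 0"
        using diff[of M 0 0] by simp
      then have "cvec.subspace {x. \<psi> M x = 0}"
        by (simp add: cvec.subspace_def lin)
      moreover have "B' \<subseteq> {x. \<psi> M x = 0}"
        using B'(2) by (auto simp: A'_def)
      ultimately show ?thesis
        using cvec.span_minimal[of B' "{x. \<psi> M x = 0}"] that by blast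
    qed
    have nv: "v \<notin> cvec.span B'"
      using vanish[of v] v(2,3) by auto
    then have vB: "v \<notin> B'"
      using cvec.span_base by blast
    have "\<exists>z::_ \<Rightarrow> int. a = (\<Sum>b\<in>insert v B'. scl (of_int (z b)) b)" if a: "a \<in> A" for a
    proof -
      obtain j :: int where j: "\<psi> M a = of_int j"
        using Suc.prems(3)[of M a] a by (auto elim: Ints_cases)
      \<comment> \<open>Division with remainder by the least positive value: the remainder is again
        a value on \<open>A\<close> and smaller than \<open>d\<close>, hence zero.\<close>
      define q where "q = j div int d"
      define a' where "a' = a - scl (of_int q) v"
      have a'A: "a' \<in> A"
        unfolding a'_def by (intro Suc.prems(2) a scl_of_int_mem[OF Suc.prems(1)] v(1))
      have val: "\<psi> M a' = of_nat (nat (j mod int d))"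
      proof -
        have "\<psi> M a' = of_int (j - q * int d)"
          by (simp add: a'_def diff lin j v(2))
        also have "j - q * int d = j mod int d"
          by (simp add: q_def minus_div_mult_eq_mod)
        finally show ?thesis
          using v(3) by simp
      qed
      have "nat (j mod int d) < d"
        using v(3) by (simp add: nat_less_iff)
      then have "nat (j mod int d) = 0"
        using least[of "nat (j mod int d)"] val a'A by (force simp: P_def)
      then have "a' \<in> A'"
        using val a'A by (simp add: A'_def)
      then obtain z :: "_ \<Rightarrow> int" where z: "a' = (\<Sum>b\<in>B'. scl (of_int (z b)) b)"
        using B'(4) by blast
      have "a = scl (of_int q) v + (\<Sum>b\<in>B'. scl (of_int (z b)) b)"
        unfolding z[symmetric] a'_def by simp
      also have "\<dots> = (\<Sum>b\<in>insert v B'. scl (of_int ((z(v := q)) b)) b)"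
        using B'(1) vB by (simp add: sum.insert) (intro sum.cong refl, auto)
      finally show ?thesis by blast
    qed
    then show ?thesis
      using B' v(1) cvec.independent_insertI[OF nv B'(3)]
      by (intro exI[of _ "insert v B'"]) (auto simp: A'_def)
  qed
qed

lemma independent_unit_vec: "cvec.independent (unit_vec ` {..<n})"
proof (rule cvec.independent_if_scalars_zero)
  fix f x assume sum: "(\<Sum>x\<in>unit_vec ` {..<n}. scl (f x) x) = 0" and x: "x \<in> unit_vec ` {..<n}"
  obtain i where i: "i < n" "x = unit_vec i"
    using x by auto
  have "(\<Sum>j<n. scl (f (unit_vec j)) (unit_vec j)) = 0"
    using sum sum.reindex[OF inj_unit_vec[of "{..<n}"], of "\<lambda>x. scl (f x) x"] by (simp add: comp_def)
  then have "(\<Sum>j<n. scl (f (unit_vec j)) (unit_vec j)) i = 0"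
    by (simp add: zero_fun_apply)
  moreover have "(\<Sum>j<n. scl (f (unit_vec j)) (unit_vec j)) i = (\<Sum>j<n. if i = j then f (unit_vec j) else 0)"
    unfolding sum_fun_apply by (intro sum.cong) (auto simp: scl_apply)
  ultimately show "f x = 0"
    using i by simp
qed simp

text \<open>\<Phi> embeds the group into \<complex>^n. The functionals provide a \<int>-basis of the
  image that is independent over \<complex>; by \<open>span\<close> and \<open>supp\<close> its
  complex span is \<complex>^n, so it has \<open>n\<close> elements.\<close>

lemma free_abelian_of_rankI:
  fixes \<Phi> :: "'a \<Rightarrow> nat \<Rightarrow> complex" and \<psi> :: "nat \<Rightarrow> (nat \<Rightarrow> complex) \<Rightarrow> complex"
  assumes G: "comm_group G"
    and \<Phi>: "\<And>x y. x \<in> carrier G \<Longrightarrow> y \<in> carrier G \<Longrightarrow> \<Phi> (x \<otimes>\<^bsub>G\<^esub> y) = \<Phi> x + \<Phi> y" "inj_on \<Phi> (carrier G)"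
    and supp: "\<And>x i. x \<in> carrier G \<Longrightarrow> i \<ge> n \<Longrightarrow> \<Phi> x i = 0"
    and lin: "\<And>i u v. \<psi> i (u + v) = \<psi> i u + \<psi> i v" "\<And>i c v. \<psi> i (scl c v) = c * \<psi> i v"
    and int: "\<And>i x. i < M \<Longrightarrow> x \<in> carrier G \<Longrightarrow> \<psi> i (\<Phi> x) \<in> \<int>"
    and inj: "\<And>x. x \<in> carrier G \<Longrightarrow> (\<And>i. i < M \<Longrightarrow> \<psi> i (\<Phi> x) = 0) \<Longrightarrow> \<Phi> x = 0"
    and span: "\<And>i. i < n \<Longrightarrow> unit_vec i \<in> cvec.span (\<Phi> ` carrier G)"
  shows "free_abelian_of_rank G n"
proof -
  interpret comm_group G by (rule G)
  define A where "A = \<Phi> ` carrier G"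
  have \<Phi>1: "\<Phi> \<one>\<^bsub>G\<^esub> = 0"
    using \<Phi>(1)[of "\<one>\<^bsub>G\<^esub>" "\<one>\<^bsub>G\<^esub>"] by simp
  have A0: "0 \<in> A"
    unfolding A_def using \<Phi>1 by (intro image_eqI[of _ _ "\<one>\<^bsub>G\<^esub>"]) auto
  have A_diff: "u - v \<in> A" if "u \<in> A" "v \<in> A" for u v
  proof -
    obtain x y where xy: "x \<in> carrier G" "y \<in> carrier G" "u = \<Phi> x" "v = \<Phi> y"
      using \<open>u \<in> A\<close> \<open>v \<in> A\<close> unfolding A_def by blast
    have "\<Phi> (inv\<^bsub>G\<^esub> y) + \<Phi> y = 0"
      using \<Phi>(1)[of "inv\<^bsub>G\<^esub> y" y] xy(2) \<Phi>1 by simp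
    then have "u - v = \<Phi> (x \<otimes>\<^bsub>G\<^esub> inv\<^bsub>G\<^esub> y)"
      using \<Phi>(1)[of x "inv\<^bsub>G\<^esub> y"] xy by (simp add: eq_neg_iff_add_eq_0[symmetric])
    then show ?thesis
      unfolding A_def using xy by simp
  qed
  have "\<exists>B. finite B \<and> B \<subseteq> A \<and> cvec.independent B \<and> (\<forall>a\<in>A. \<exists>z::_ \<Rightarrow> int. a = (\<Sum>b\<in>B. scl (of_int (z b)) b))"
    by (rule integral_subgroup_basis[where \<psi> = \<psi> and M = M])
      (use lin A0 A_diff int inj in \<open>auto simp: A_def\<close>)
  then obtain B where B: "finite B" "B \<subseteq> A" "cvec.independent B"
    "\<And>a. a \<in> A \<Longrightarrow> \<exists>z::_ \<Rightarrow> int. a = (\<Sum>b\<in>B. scl (of_int (z b)) b)"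
    by blast
  have AB: "A \<subseteq> cvec.span B"
  proof
    fix a assume "a \<in> A"
    then obtain z :: "_ \<Rightarrow> int" where "a = (\<Sum>b\<in>B. scl (of_int (z b)) b)"
      using B(4) by blast
    then show "a \<in> cvec.span B"
      by (simp add: cvec.span_sum cvec.span_scale cvec.span_base)
  qed
  \<comment> \<open>Equal spans of two complex-independent sets fix the cardinality of
    \<open>B\<close>.\<close>
  have "cvec.span B = cvec.span (unit_vec ` {..<n})"
  proof (intro equalityI cvec.span_minimal cvec.subspace_span)
    show "B \<subseteq> cvec.span (unit_vec ` {..<n})"
    proof
      fix b assume "b \<in> B"
      then obtain x where x: "x \<in> carrier G" "b = \<Phi> x"
        using B(2) unfolding A_def by blast
      have "b = (\<lambda>i. if i < n then b i else 0)"
        using supp[OF x(1)] x(2) by (auto simp: fun_eq_iff)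
      also have "\<dots> = (\<Sum>j<n. scl (b j) (unit_vec j))"
        by (rule truncate_eq_sum)
      also have "\<dots> \<in> cvec.span (unit_vec ` {..<n})"
        by (intro cvec.span_sum cvec.span_scale cvec.span_base) auto
      finally show "b \<in> cvec.span (unit_vec ` {..<n})" .
    qed
    show "unit_vec ` {..<n} \<subseteq> cvec.span B"
    proof
      fix u assume "u \<in> unit_vec ` {..<n}"
      then have "u \<in> cvec.span A"
        using span unfolding A_def by blast
      then show "u \<in> cvec.span B"
        using cvec.span_minimal[OF AB cvec.subspace_span] by blast
    qed
  qed
  then have card: "card B = n"
    using cvec.dim_span_eq_card_independent[OF B(3)] cvec.dim_span_eq_card_independent[OF independent_unit_vec[of n]]
      card_image[OF inj_unit_vec[of "{..<n}"]] by simp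
  obtain b where b: "bij_betw b {..<n} B"
    using bij_betw_from_nat_into_finite[OF B(1)] card by metis
  define comb where "comb z = (\<Sum>i<n. scl (of_int (z i)) (b i))" for z :: "nat \<Rightarrow> int"
  have comb_B: "(\<Sum>x\<in>B. scl (of_int (z x)) x) = comb (\<lambda>i. z (b i))" for z :: "_ \<Rightarrow> int"
    unfolding comb_def using sum.reindex_bij_betw[OF b, of "\<lambda>x. scl (of_int (z x)) x"] by simp
  have comb_add: "comb (\<lambda>i. z i + w i) = comb z + comb w" for z w
    by (simp add: comb_def cvec.scale_left_distrib sum.distrib)
  have combA: "comb z \<in> A" for z
  proof -
    have add: "u + v \<in> A" if "u \<in> A" "v \<in> A" for u v
      using A_diff[OF that(1) A_diff[OF A0 that(2)]] by simp
    have "k \<le> n \<Longrightarrow> (\<Sum>i<k. scl (of_int (z i)) (b i)) \<in> A" for k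
    proof (induction k)
      case (Suc k)
      then have "b k \<in> A"
        using bij_betwE[OF b] B(2) by auto
      then have "scl (of_int (z k)) (b k) \<in> A"
        by (intro scl_of_int_mem A0 A_diff)
      then show ?case
        unfolding sum.lessThan_Suc using Suc by (intro add) auto
    qed (simp add: A0)
    then show ?thesis
      by (simp add: comb_def)
  qed
  have comb_inj: "z i = w i" if eq: "comb z = comb w" and i: "i < n" for z w i
  proof -
    define c where "c x = (of_int (z (inv_into {..<n} b x)) - of_int (w (inv_into {..<n} b x)) :: complex)" for x
    have cb: "c (b j) = of_int (z j) - of_int (w j)" if "j < n" for j
      using b that by (simp add: c_def bij_betw_def)
    have "(\<Sum>x\<in>B. scl (c x) x) = (\<Sum>j<n. scl (c (b j)) (b j))"
      by (rule sum.reindex_bij_betw[OF b, symmetric])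
    also have "\<dots> = comb z - comb w"
      by (simp add: cb comb_def cvec.scale_left_diff_distrib sum_subtractf)
    finally have "(\<Sum>x\<in>B. scl (c x) x) = 0"
      using eq by simp
    then have "c (b i) = 0"
      using cvec.independentD[OF B(3,1) order_refl, of c "b i"] bij_betwE[OF b] i by blast
    then show ?thesis
      using cb[OF i] by simp
  qed
  define inv\<Phi> where "inv\<Phi> = inv_into (carrier G) \<Phi>"
  have inv\<Phi>: "inv\<Phi> a \<in> carrier G" "\<Phi> (inv\<Phi> a) = a" if "a \<in> A" for a
    using that unfolding inv\<Phi>_def A_def by (auto simp: inv_into_into f_inv_into_f)
  let ?F = "free_Abelian_group {..<n}"
  \<comment> \<open>A formal combination gives integer coordinates with respect to \<open>B\<close>;
    the resulting lattice vector is pulled back through \<Phi>.\<close>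
  define h where "h p = inv\<Phi> (comb (Poly_Mapping.lookup p))" for p
  have hG: "h p \<in> carrier G" and \<Phi>h: "\<Phi> (h p) = comb (Poly_Mapping.lookup p)" for p
    unfolding h_def using inv\<Phi>[OF combA] by auto
  have "h \<in> iso ?F G"
    unfolding iso_def bij_betw_def
  proof (intro CollectI conjI)
    show "h \<in> hom ?F G"
    proof (rule homI)
      fix p q
      have "\<Phi> (h (p + q)) = \<Phi> (h p \<otimes>\<^bsub>G\<^esub> h q)"
        using \<Phi>(1)[OF hG hG] by (simp add: \<Phi>h comb_add lookup_add[abs_def] plus_fun_def)
      then show "h (p \<otimes>\<^bsub>?F\<^esub> q) = h p \<otimes>\<^bsub>G\<^esub> h q"
        using inj_onD[OF \<Phi>(2)] hG by simp
    qed (rule hG)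
    show "inj_on h (carrier ?F)"
    proof (rule inj_onI)
      fix p q assume p: "p \<in> carrier ?F" and q: "q \<in> carrier ?F" and eq: "h p = h q"
      have "comb (Poly_Mapping.lookup p) = comb (Poly_Mapping.lookup q)"
        using \<Phi>h[of p] \<Phi>h[of q] eq by simp
      note * = comb_inj[OF this]
      show "p = q"
      proof (rule poly_mapping_eqI)
        fix i
        show "Poly_Mapping.lookup p i = Poly_Mapping.lookup q i"
        proof (cases "i < n")
          case False
          then have "i \<notin> Poly_Mapping.keys p" "i \<notin> Poly_Mapping.keys q"
            using p q by auto
          then show ?thesis by (simp add: in_keys_iff)
        qed (rule *)
      qed
    qed
    show "h ` carrier ?F = carrier G"
    proof (intro equalityI subsetI)
      fix x assume x: "x \<in> carrier G"
      then obtain z :: "_ \<Rightarrow> int" where z: "\<Phi> x = (\<Sum>b\<in>B. scl (of_int (z b)) b)"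
        using B(4)[of "\<Phi> x"] unfolding A_def by blast
      define w where "w i = (if i < n then z (b i) else 0)" for i
      have "finite {i. w i \<noteq> 0}"
        by (rule finite_subset[of _ "{..<n}"]) (auto simp: w_def split: if_splits)
      then have lw: "Poly_Mapping.lookup (Abs_poly_mapping w) = w"
        by (simp add: Abs_poly_mapping_inverse)
      have "\<Phi> x = comb w"
        unfolding z comb_B by (simp add: comb_def w_def)
      then have "\<Phi> (h (Abs_poly_mapping w)) = \<Phi> x"
        by (simp add: \<Phi>h lw)
      then have "x = h (Abs_poly_mapping w)"
        by (rule inj_onD[OF \<Phi>(2) _ hG x, symmetric])
      moreover have "Abs_poly_mapping w \<in> carrier ?F"
        by (auto simp: in_keys_iff lw w_def split: if_splits)
      ultimately show "x \<in> h ` carrier ?F" by blast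
    qed (use hG in blast)
  qed
  then have "?F \<cong> G"
    by (auto simp: is_iso_def)
  then have "G \<cong> ?F"
    by (rule group.iso_sym[OF group_free_Abelian_group])
  then show ?thesis
    using G by (simp add: free_abelian_of_rank_def)
qed

section \<open>Families of finite subgroups\<close>

locale finite_subgroup_family = group G for G :: "('g, 'x) monoid_scheme" (structure) +
  fixes F :: "'g set set"
  assumes family: "family_of_finite_subgroups G F"
    and finitely_many: "finitely_many_finite_subgroups_up_to_conj G"
begin

abbreviation sub :: "'g set \<Rightarrow> ('g, 'x) monoid_scheme" where "sub H \<equiv> G\<lparr>carrier := H\<rparr>"

definition cyc :: "'g \<Rightarrow> 'g set" where "cyc \<gamma> = generate G {\<gamma>}"

text \<open>By \<open>cyc_in\<close> and \<open>F_D\<close> this is the union of the family.\<close>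

definition D :: "'g set" where "D = {\<gamma> \<in> carrier G. cyc \<gamma> \<in> F}"

definition cls :: "'g \<Rightarrow> 'g set" where "cls \<gamma> = {\<delta> \<otimes> \<gamma> \<otimes> inv \<delta> | \<delta>. \<delta> \<in> carrier G}"

lemma F_subgroup: "H \<in> F \<Longrightarrow> subgroup H G" and F_finite: "H \<in> F \<Longrightarrow> finite H"
  and F_conj: "H \<in> F \<Longrightarrow> \<gamma> \<in> carrier G \<Longrightarrow> \<gamma> <# H #> inv \<gamma> \<in> F"
  and F_sub: "H \<in> F \<Longrightarrow> subgroup L G \<Longrightarrow> L \<subseteq> H \<Longrightarrow> L \<in> F"
  using family unfolding family_of_finite_subgroups_def by blast+

lemma F_carrier: "H \<in> F \<Longrightarrow> h \<in> H \<Longrightarrow> h \<in> carrier G"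
  by (rule subgroup.mem_carrier[OF F_subgroup])

lemma sub_finite_group: "H \<in> F \<Longrightarrow> finite_group (sub H)"
  using subgroup.subgroup_is_group[OF F_subgroup group_axioms] F_finite
  by (intro finite_group.intro finite_group_axioms.intro) auto

lemma conj_set: "\<delta> <# H #> inv \<delta> = (\<lambda>h. \<delta> \<otimes> h \<otimes> inv \<delta>) ` H"
  by (auto simp: l_coset_def r_coset_def)

lemma conj_inj: "\<delta> \<in> carrier G \<Longrightarrow> H \<subseteq> carrier G \<Longrightarrow> inj_on (\<lambda>h. \<delta> \<otimes> h \<otimes> inv \<delta>) H"
  by (rule inj_onI) (simp add: subset_iff)

lemma inv_cancel: "\<delta> \<in> carrier G \<Longrightarrow> x \<in> carrier G \<Longrightarrow> inv \<delta> \<otimes> (\<delta> \<otimes> x) = x"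
  by (simp flip: m_assoc)

lemma conj_mult: "\<delta> \<in> carrier G \<Longrightarrow> x \<in> carrier G \<Longrightarrow> y \<in> carrier G \<Longrightarrow>
    \<delta> \<otimes> (x \<otimes> y) \<otimes> inv \<delta> = (\<delta> \<otimes> x \<otimes> inv \<delta>) \<otimes> (\<delta> \<otimes> y \<otimes> inv \<delta>)"
  by (simp add: m_assoc inv_cancel)

lemma conj_pow: "\<delta> \<in> carrier G \<Longrightarrow> x \<in> carrier G \<Longrightarrow>
    (\<delta> \<otimes> x \<otimes> inv \<delta>) [^] (t::nat) = \<delta> \<otimes> x [^] t \<otimes> inv \<delta>"
  by (induction t) (simp_all add: conj_mult)

lemma conj_conj: "\<delta> \<in> carrier G \<Longrightarrow> \<epsilon> \<in> carrier G \<Longrightarrow> x \<in> carrier G \<Longrightarrow>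
    \<delta> \<otimes> (\<epsilon> \<otimes> x \<otimes> inv \<epsilon>) \<otimes> inv \<delta> = (\<delta> \<otimes> \<epsilon>) \<otimes> x \<otimes> inv (\<delta> \<otimes> \<epsilon>)"
  by (simp add: m_assoc inv_mult_group)

lemma conj_inverse: "\<delta> \<in> carrier G \<Longrightarrow> x \<in> carrier G \<Longrightarrow> inv \<delta> \<otimes> (\<delta> \<otimes> x \<otimes> inv \<delta>) \<otimes> inv (inv \<delta>) = x"
  by (subst conj_conj) simp_all

lemma cyc_in: "\<gamma> \<in> cyc \<gamma>"
  unfolding cyc_def by (rule generate.incl) simp

lemma cyc_F: "\<gamma> \<in> D \<Longrightarrow> cyc \<gamma> \<in> F"
  by (simp add: D_def)

lemma D_carrier: "\<gamma> \<in> D \<Longrightarrow> \<gamma> \<in> carrier G"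
  by (simp add: D_def)

lemma cyc_subset: "H \<in> F \<Longrightarrow> h \<in> H \<Longrightarrow> cyc h \<subseteq> H"
  unfolding cyc_def using F_subgroup by (intro generate_subgroup_incl) auto

lemma F_D:
  assumes "H \<in> F" "h \<in> H"
  shows "h \<in> D"
proof -
  have "subgroup (cyc h) G"
    unfolding cyc_def using F_carrier[OF assms] by (intro generate_is_subgroup) simp
  then show ?thesis
    using F_sub[OF assms(1) _ cyc_subset[OF assms]] F_carrier[OF assms] by (simp add: D_def)
qed

lemma D_conj:
  assumes "\<gamma> \<in> D" "\<delta> \<in> carrier G"
  shows "\<delta> \<otimes> \<gamma> \<otimes> inv \<delta> \<in> D"
proof (rule F_D[OF F_conj[OF cyc_F[OF assms(1)] assms(2)]])
  show "\<delta> \<otimes> \<gamma> \<otimes> inv \<delta> \<in> \<delta> <# cyc \<gamma> #> inv \<delta>"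
    unfolding conj_set by (rule imageI) (rule cyc_in)
qed

lemma pow_mem:
  assumes "H \<in> F" "h \<in> H"
  shows "h [^] (t::nat) \<in> H"
  using assms(2) subgroup.m_closed[OF F_subgroup[OF assms(1)]] subgroup.one_closed[OF F_subgroup[OF assms(1)]]
  by (induction t) simp_all

lemma D_pow: "\<gamma> \<in> D \<Longrightarrow> \<gamma> [^] (t::nat) \<in> D"
  by (rule F_D[OF cyc_F pow_mem[OF cyc_F cyc_in]])

lemma sub_pow: "x [^]\<^bsub>sub H\<^esub> (t::nat) = x [^] t"
  by (rule nat_pow_consistent[symmetric])

lemma family_conj_classes_eq: "family_conj_classes G F = cls ` D"
  by (auto simp: family_conj_classes_def orbits_def orbit_def cls_def D_def cyc_def)

lemma cls_self: "\<gamma> \<in> carrier G \<Longrightarrow> \<gamma> \<in> cls \<gamma>"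
  unfolding cls_def by (intro CollectI exI[of _ \<one>]) simp

lemma cls_conj: "\<gamma> \<in> carrier G \<Longrightarrow> \<delta> \<in> carrier G \<Longrightarrow> \<delta> \<otimes> x \<otimes> inv \<delta> \<in> cls \<gamma> \<longleftrightarrow> x \<in> cls \<gamma>" if "x \<in> carrier G"
proof
  assume \<gamma>: "\<gamma> \<in> carrier G" and \<delta>: "\<delta> \<in> carrier G"
  have *: "\<epsilon> \<otimes> y \<otimes> inv \<epsilon> \<in> cls \<gamma>" if "y \<in> cls \<gamma>" "\<epsilon> \<in> carrier G" for y \<epsilon>
    using that conj_conj \<gamma> unfolding cls_def by blast
  show "\<delta> \<otimes> x \<otimes> inv \<delta> \<in> cls \<gamma>" if "x \<in> cls \<gamma>"
    by (rule *[OF that \<delta>])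
  show "x \<in> cls \<gamma>" if "\<delta> \<otimes> x \<otimes> inv \<delta> \<in> cls \<gamma>"
    using *[OF that inv_closed[OF \<delta>]] conj_inverse[OF \<delta> \<open>x \<in> carrier G\<close>] by simp
qed

lemma cls_eq: "\<gamma> \<in> carrier G \<Longrightarrow> \<delta> \<in> carrier G \<Longrightarrow> cls (\<delta> \<otimes> \<gamma> \<otimes> inv \<delta>) = cls \<gamma>"
proof (intro equalityI subsetI)
  assume g: "\<gamma> \<in> carrier G" "\<delta> \<in> carrier G"
  have *: "cls (\<delta> \<otimes> \<gamma> \<otimes> inv \<delta>) \<subseteq> cls \<gamma>" if "\<gamma> \<in> carrier G" "\<delta> \<in> carrier G" for \<gamma> \<delta>
    using that conj_conj unfolding cls_def by blast
  show "x \<in> cls \<gamma>" if "x \<in> cls (\<delta> \<otimes> \<gamma> \<otimes> inv \<delta>)" for x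
    using *[OF g] that by blast
  show "x \<in> cls (\<delta> \<otimes> \<gamma> \<otimes> inv \<delta>)" if "x \<in> cls \<gamma>" for x
    using *[of "\<delta> \<otimes> \<gamma> \<otimes> inv \<delta>" "inv \<delta>"] conj_inverse[OF g(2,1)] g that by auto
qed

text \<open>The finiteness hypothesis enters here. The choice \<open>r\<close> picks one subgroup
  from each orbit, and it stays in \<open>F\<close> because \<open>F\<close> is closed under
  conjugation.\<close>

lemma finite_representatives:
  obtains R where "finite R" "R \<subseteq> F" "\<And>H. H \<in> F \<Longrightarrow> \<exists>\<delta>\<in>carrier G. (\<lambda>h. \<delta> \<otimes> h \<otimes> inv \<delta>) ` H \<in> R"
proof -
  define orb where "orb H = orbit G (\<lambda>\<gamma> H. \<gamma> <# H #> inv \<gamma>) H" for H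
  have "orb ` F \<subseteq> orbits G {H. subgroup H G \<and> finite H} (\<lambda>\<gamma> H. \<gamma> <# H #> inv \<gamma>)"
    using F_subgroup F_finite unfolding orbits_def orb_def by blast
  then have fin: "finite (orb ` F)"
    using finitely_many unfolding finitely_many_finite_subgroups_up_to_conj_def by (rule finite_subset)
  define r where "r X = (SOME H. H \<in> X)" for X :: "'g set set"
  have r: "r (orb H) \<in> orb H" if "H \<in> F" for H
  proof -
    have "\<one> <# H #> inv \<one> \<in> orb H"
      unfolding orb_def orbit_def by blast
    then show ?thesis
      unfolding r_def by (rule someI)
  qed
  show ?thesis
  proof (rule that[of "r ` orb ` F"])
    show "r ` orb ` F \<subseteq> F"
    proof safe
      fix H assume H: "H \<in> F"
      then obtain \<delta> where "\<delta> \<in> carrier G" "r (orb H) = \<delta> <# H #> inv \<delta>"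
        using r[OF H] unfolding orb_def orbit_def by blast
      then show "r (orb H) \<in> F"
        using F_conj[OF H] by simp
    qed
    show "\<exists>\<delta>\<in>carrier G. (\<lambda>h. \<delta> \<otimes> h \<otimes> inv \<delta>) ` H \<in> r ` orb ` F" if H: "H \<in> F" for H
    proof -
      obtain \<delta> where "\<delta> \<in> carrier G" "r (orb H) = (\<lambda>h. \<delta> \<otimes> h \<otimes> inv \<delta>) ` H"
        using r[OF H] unfolding orb_def orbit_def conj_set by blast
      then show ?thesis
        using H by (intro bexI[of _ \<delta>]) auto
    qed
  qed (use fin in simp)
qed

lemma finite_classes: "finite (cls ` D)"
proof -
  obtain R where R: "finite R" "R \<subseteq> F" "\<And>H. H \<in> F \<Longrightarrow> \<exists>\<delta>\<in>carrier G. (\<lambda>h. \<delta> \<otimes> h \<otimes> inv \<delta>) ` H \<in> R"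
    using finite_representatives by blast
  have "cls ` D \<subseteq> cls ` (\<Union>R)"
  proof (rule image_subsetI)
    fix \<gamma> assume \<gamma>: "\<gamma> \<in> D"
    obtain \<delta> where \<delta>: "\<delta> \<in> carrier G" "(\<lambda>h. \<delta> \<otimes> h \<otimes> inv \<delta>) ` cyc \<gamma> \<in> R"
      using R(3)[OF cyc_F[OF \<gamma>]] by blast
    then have "\<delta> \<otimes> \<gamma> \<otimes> inv \<delta> \<in> \<Union>R"
      using cyc_in[of \<gamma>] by blast
    then have "cls (\<delta> \<otimes> \<gamma> \<otimes> inv \<delta>) \<in> cls ` (\<Union>R)"
      by (rule imageI)
    then show "cls \<gamma> \<in> cls ` (\<Union>R)"
      unfolding cls_eq[OF D_carrier[OF \<gamma>] \<delta>(1)] .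
  qed
  moreover have "finite (\<Union>R)"
    using R(1,2) F_finite by blast
  ultimately show ?thesis
    using finite_surj by blast
qed

lemma common_exponent:
  obtains m :: nat where "m \<ge> 2" "\<And>H. H \<in> F \<Longrightarrow> card H dvd m" "\<And>\<gamma>. \<gamma> \<in> D \<Longrightarrow> \<gamma> [^] m = \<one>"
proof -
  obtain R where R: "finite R" "R \<subseteq> F" "\<And>H. H \<in> F \<Longrightarrow> \<exists>\<delta>\<in>carrier G. (\<lambda>h. \<delta> \<otimes> h \<otimes> inv \<delta>) ` H \<in> R"
    using finite_representatives by blast
  \<comment> \<open>The factor 2 forces m \<ge> 2 even for the trivial family, so that the exponent
    1 is a residue below \<open>m\<close>.\<close>
  define m where "m = 2 * (\<Prod>H\<in>R. card H)"
  have pos: "card H > 0" if "H \<in> F" for H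
    using that F_finite subgroup.one_closed[OF F_subgroup] by (auto simp: card_gt_0_iff)
  have "(\<Prod>H\<in>R. card H) > 0"
    using R(2) pos by (intro prod_pos) auto
  then have m2: "m \<ge> 2"
    by (simp add: m_def)
  have dvd: "card H dvd m" if H: "H \<in> F" for H
  proof -
    obtain \<delta> where \<delta>: "\<delta> \<in> carrier G" "(\<lambda>h. \<delta> \<otimes> h \<otimes> inv \<delta>) ` H \<in> R"
      using R(3)[OF H] by blast
    have "card ((\<lambda>h. \<delta> \<otimes> h \<otimes> inv \<delta>) ` H) = card H"
      by (rule card_image) (rule conj_inj[OF \<delta>(1)], use F_carrier[OF H] in blast)
    moreover have "card ((\<lambda>h. \<delta> \<otimes> h \<otimes> inv \<delta>) ` H) dvd (\<Prod>H\<in>R. card H)"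
      by (rule dvd_prodI[OF R(1) \<delta>(2)])
    ultimately show ?thesis
      by (simp add: m_def)
  qed
  have "\<gamma> [^] m = \<one>" if \<gamma>: "\<gamma> \<in> D" for \<gamma>
  proof -
    interpret C: finite_group "sub (cyc \<gamma>)"
      by (rule sub_finite_group[OF cyc_F[OF \<gamma>]])
    have "\<gamma> [^] card (cyc \<gamma>) = \<one>"
      using C.pow_order_eq_1[of \<gamma>] cyc_in[of \<gamma>] by (simp add: order_def sub_pow)
    moreover obtain q where "m = card (cyc \<gamma>) * q"
      using dvd[OF cyc_F[OF \<gamma>]] by blast
    ultimately show ?thesis
      using D_carrier[OF \<gamma>] by (simp flip: nat_pow_pow)
  qed
  with m2 dvd that show ?thesis by blast
qed

section \<open>The inverse limit as a group of class functions\<close>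

abbreviation limit_group :: "('g set \<Rightarrow> ('g, complex) rep_class) monoid" where
  "limit_group \<equiv> family_rep_group TYPE(complex) G F"

text \<open>The value at \<gamma> is read off in the smallest member of the family that contains it;
  restriction compatibility makes every larger member agree.\<close>

definition fchar :: "('g set \<Rightarrow> ('g, complex) rep_class) \<Rightarrow> 'g \<Rightarrow> complex" where
  "fchar x \<gamma> = finite_group.class_char (sub (cyc \<gamma>)) (x (cyc \<gamma>)) \<gamma>"

text \<open>Membership in the group \<open>A\<close> of the overview. Values off \<open>D\<close>
  are unconstrained, so functions are compared on \<open>D\<close> only.\<close>

definition family_char :: "('g \<Rightarrow> complex) \<Rightarrow> bool" where
  "family_char f \<longleftrightarrow> (\<forall>\<gamma>\<in>D. \<forall>\<delta>\<in>carrier G. f (\<delta> \<otimes> \<gamma> \<otimes> inv \<delta>) = f \<gamma>) \<and>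
    (\<forall>H\<in>F. finite_group.virtual_char (sub H) f)"

definition of_char :: "('g \<Rightarrow> complex) \<Rightarrow> 'g set \<Rightarrow> ('g, complex) rep_class" where
  "of_char f = (\<lambda>H\<in>F. finite_group.char_class (sub H) f)"

lemma carrier_limit_group: "x \<in> carrier limit_group \<longleftrightarrow>
    x \<in> (\<Pi>\<^sub>E H\<in>F. carrier (rep_group (sub H))) \<and>
    (\<forall>H\<in>F. \<forall>K\<in>F. H \<subseteq> K \<longrightarrow> rep_pullback (sub H) (\<lambda>h. h) (x K) = x H) \<and>
    (\<forall>H\<in>F. \<forall>K\<in>F. \<forall>\<gamma>\<in>carrier G. K = \<gamma> <# H #> inv \<gamma> \<longrightarrow>
      rep_pullback (sub H) (\<lambda>h. \<gamma> \<otimes> h \<otimes> inv \<gamma>) (x K) = x H)"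
  by (simp add: family_rep_group_def Let_def)

lemma incl_hom: "H \<subseteq> K \<Longrightarrow> (\<lambda>h. h) \<in> hom (sub H) (sub K)"
  by (auto simp: hom_def)

lemma conj_hom: "H \<in> F \<Longrightarrow> \<delta> \<in> carrier G \<Longrightarrow> (\<lambda>h. \<delta> \<otimes> h \<otimes> inv \<delta>) \<in> hom (sub H) (sub (\<delta> <# H #> inv \<delta>))"
  unfolding conj_set by (rule homI) (auto simp: conj_mult F_carrier)

text \<open>Restriction to \<langle>h\<rangle> shows that the characters of all components come from
  one function on \<open>D\<close>, and compatibility with conjugation makes it a class
  function.\<close>

lemma limit_group_char:
  assumes x: "x \<in> carrier limit_group"
  shows "\<And>H h. H \<in> F \<Longrightarrow> h \<in> H \<Longrightarrow> finite_group.class_char (sub H) (x H) h = fchar x h"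
    and "family_char (fchar x)" and "x = of_char (fchar x)"
proof -
  have mem: "x H \<in> carrier (rep_group (sub H))" if "H \<in> F" for H
    using x that unfolding carrier_limit_group by blast
  show eq: "finite_group.class_char (sub H) (x H) h = fchar x h" if H: "H \<in> F" and h: "h \<in> H" for H h
  proof -
    have hF: "cyc h \<in> F"
      by (rule cyc_F[OF F_D[OF H h]])
    interpret C: finite_group "sub (cyc h)"
      by (rule sub_finite_group[OF hF])
    note pb = C.rep_pullback_eq[OF sub_finite_group[OF H] incl_hom[OF cyc_subset[OF H h]] mem[OF H]]
    have "x (cyc h) = rep_pullback (sub (cyc h)) (\<lambda>h. h) (x H)"
      using x hF H cyc_subset[OF H h] unfolding carrier_limit_group by metis
    then show ?thesis
      unfolding fchar_def using pb C.class_char_char_class[OF pb(2), of h] cyc_in[of h] by simp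
  qed
  show "family_char (fchar x)"
    unfolding family_char_def
  proof (intro conjI ballI)
    fix \<gamma> \<delta> assume \<gamma>: "\<gamma> \<in> D" and \<delta>: "\<delta> \<in> carrier G"
    let ?K = "\<delta> <# cyc \<gamma> #> inv \<delta>"
    note hF = cyc_F[OF \<gamma>]
    note K = F_conj[OF hF \<delta>]
    interpret C: finite_group "sub (cyc \<gamma>)"
      by (rule sub_finite_group[OF hF])
    note pb = C.rep_pullback_eq[OF sub_finite_group[OF K] conj_hom[OF hF \<delta>] mem[OF K]]
    have "rep_pullback (sub (cyc \<gamma>)) (\<lambda>h. \<delta> \<otimes> h \<otimes> inv \<delta>) (x ?K) = x (cyc \<gamma>)"
      using x hF K \<delta> unfolding carrier_limit_group by blast
    then have "fchar x \<gamma> = finite_group.class_char (sub ?K) (x ?K) (\<delta> \<otimes> \<gamma> \<otimes> inv \<delta>)"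
      unfolding fchar_def using pb C.class_char_char_class[OF pb(2), of \<gamma>] cyc_in[of \<gamma>] by simp
    also have "\<dots> = fchar x (\<delta> \<otimes> \<gamma> \<otimes> inv \<delta>)"
      by (rule eq[OF K]) (use cyc_in[of \<gamma>] in \<open>simp add: conj_set\<close>)
    finally show "fchar x (\<delta> \<otimes> \<gamma> \<otimes> inv \<delta>) = fchar x \<gamma>" ..
  next
    fix H assume H: "H \<in> F"
    interpret C: finite_group "sub H"
      by (rule sub_finite_group[OF H])
    show "C.virtual_char (fchar x)"
      using C.virtual_char_cong[of "C.class_char (x H)" "fchar x"] C.char_class_class_char(2)[OF mem[OF H]] eq[OF H] by simp
  qed
  have x_eq: "x H = of_char (fchar x) H" if H: "H \<in> F" for H
  proof -
    interpret C: finite_group "sub H"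
      by (rule sub_finite_group[OF H])
    have "x H = C.char_class (C.class_char (x H))"
      by (rule C.char_class_class_char(1)[OF mem[OF H], symmetric])
    also have "\<dots> = C.char_class (fchar x)"
      by (rule C.char_class_cong) (use eq[OF H] in simp)
    also have "\<dots> = of_char (fchar x) H"
      using H by (simp add: of_char_def)
    finally show ?thesis .
  qed
  have x_PiE: "x \<in> (\<Pi>\<^sub>E H\<in>F. carrier (rep_group (sub H)))"
    by (rule carrier_limit_group[THEN iffD1, OF x, THEN conjunct1])
  show "x = of_char (fchar x)"
  proof
    fix H
    show "x H = of_char (fchar x) H"
    proof (cases "H \<in> F")
      case False
      then show ?thesis
        using PiE_arb[OF x_PiE] by (simp add: of_char_def)
    qed (rule x_eq)
  qed
qed

lemma of_char:
  assumes f: "family_char f"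
  shows "of_char f \<in> carrier limit_group" and "\<And>\<gamma>. \<gamma> \<in> D \<Longrightarrow> fchar (of_char f) \<gamma> = f \<gamma>"
proof -
  have vc: "finite_group.virtual_char (sub H) f" if "H \<in> F" for H
    using f that unfolding family_char_def by blast
  have cc: "finite_group.class_char (sub H) (of_char f H) h = f h" if H: "H \<in> F" and h: "h \<in> H" for H h
    using finite_group.class_char_char_class[OF sub_finite_group[OF H] vc[OF H]] H h by (simp add: of_char_def)
  have mem: "of_char f H \<in> carrier (rep_group (sub H))" if H: "H \<in> F" for H
    using vc[OF H] H by (simp add: of_char_def finite_group.carrier_rep_group[OF sub_finite_group[OF H]])
  \<comment> \<open>Inclusions and conjugations are handled together: both are homomorphisms between
    members of the family that leave \<open>f\<close> unchanged.\<close>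
  have pb: "rep_pullback (sub H) \<phi> (of_char f K) = of_char f H"
    if H: "H \<in> F" and K: "K \<in> F" and \<phi>: "\<phi> \<in> hom (sub H) (sub K)" and f\<phi>: "\<And>h. h \<in> H \<Longrightarrow> f (\<phi> h) = f h" for H K \<phi>
  proof -
    interpret C: finite_group "sub H"
      by (rule sub_finite_group[OF H])
    have "\<phi> h \<in> K" if "h \<in> H" for h
      using \<phi> that by (auto simp: hom_def)
    then have "C.char_class (\<lambda>h. finite_group.class_char (sub K) (of_char f K) (\<phi> h)) = C.char_class f"
      by (intro C.char_class_cong) (simp add: cc[OF K] f\<phi>)
    then show ?thesis
      using C.rep_pullback_eq(1)[OF sub_finite_group[OF K] \<phi> mem[OF K]] H by (simp add: of_char_def)
  qed
  show "of_char f \<in> carrier limit_group"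
    unfolding carrier_limit_group
  proof (intro conjI ballI impI)
    show "of_char f \<in> (\<Pi>\<^sub>E H\<in>F. carrier (rep_group (sub H)))"
      using mem by (intro PiE_I) (auto simp: of_char_def)
    fix H K assume H: "H \<in> F" and K: "K \<in> F"
    show "rep_pullback (sub H) (\<lambda>h. h) (of_char f K) = of_char f H" if "H \<subseteq> K"
      by (rule pb[OF H K incl_hom[OF that]]) simp
    show "rep_pullback (sub H) (\<lambda>h. \<delta> \<otimes> h \<otimes> inv \<delta>) (of_char f K) = of_char f H"
      if "\<delta> \<in> carrier G" "K = \<delta> <# H #> inv \<delta>" for \<delta>
    proof (rule pb[OF H K])
      show "(\<lambda>h. \<delta> \<otimes> h \<otimes> inv \<delta>) \<in> hom (sub H) (sub K)"
        unfolding that(2) by (rule conj_hom[OF H that(1)])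
      show "f (\<delta> \<otimes> h \<otimes> inv \<delta>) = f h" if "h \<in> H" for h
        using f F_D[OF H that] \<open>\<delta> \<in> carrier G\<close> unfolding family_char_def by blast
    qed
  qed
  show "fchar (of_char f) \<gamma> = f \<gamma>" if "\<gamma> \<in> D" for \<gamma>
    unfolding fchar_def by (rule cc[OF cyc_F[OF that] cyc_in])
qed

lemma of_char_cong:
  assumes "\<And>\<gamma>. \<gamma> \<in> D \<Longrightarrow> f \<gamma> = g \<gamma>"
  shows "of_char f = of_char g"
  unfolding of_char_def
proof (rule restrict_ext)
  fix H assume H: "H \<in> F"
  show "finite_group.char_class (sub H) f = finite_group.char_class (sub H) g"
    by (rule finite_group.char_class_cong[OF sub_finite_group[OF H]]) (use assms F_D[OF H] in simp)
qed

lemma family_char_add: "family_char f \<Longrightarrow> family_char g \<Longrightarrow> family_char (\<lambda>h. f h + g h)"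
  unfolding family_char_def using finite_group.virtual_char_add[OF sub_finite_group] by simp

lemma family_char_uminus: "family_char f \<Longrightarrow> family_char (\<lambda>h. - f h)"
  unfolding family_char_def using finite_group.virtual_char_uminus[OF sub_finite_group] by simp

lemma family_char_0: "family_char (\<lambda>h. 0)"
  unfolding family_char_def using finite_group.virtual_char_0[OF sub_finite_group] by simp

lemma of_char_mult:
  assumes "family_char f" "family_char g"
  shows "of_char f \<otimes>\<^bsub>limit_group\<^esub> of_char g = of_char (\<lambda>h. f h + g h)"
proof -
  have "of_char f \<otimes>\<^bsub>limit_group\<^esub> of_char g = (\<lambda>H\<in>F. of_char f H \<otimes>\<^bsub>rep_group (sub H)\<^esub> of_char g H)"
    by (simp add: family_rep_group_def Let_def)
  also have "\<dots> = of_char (\<lambda>h. f h + g h)"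
    unfolding of_char_def
  proof (rule restrict_ext)
    fix H assume H: "H \<in> F"
    then show "(\<lambda>H\<in>F. finite_group.char_class (sub H) f) H \<otimes>\<^bsub>rep_group (sub H)\<^esub> (\<lambda>H\<in>F. finite_group.char_class (sub H) g) H =
        finite_group.char_class (sub H) (\<lambda>h. f h + g h)"
      using finite_group.rep_group_mult[OF sub_finite_group[OF H], of f g] assms by (simp add: family_char_def)
  qed
  finally show ?thesis .
qed

lemma limit_group_one: "\<one>\<^bsub>limit_group\<^esub> = of_char (\<lambda>h. 0)"
proof -
  have "\<one>\<^bsub>limit_group\<^esub> = (\<lambda>H\<in>F. \<one>\<^bsub>rep_group (sub H)\<^esub>)"
    by (simp add: family_rep_group_def Let_def)
  then show ?thesis
    unfolding of_char_def by (simp add: finite_group.rep_group_one[OF sub_finite_group] cong: restrict_cong)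
qed

lemma limit_group_cases:
  assumes "x \<in> carrier limit_group"
  obtains f where "family_char f" "x = of_char f"
  using limit_group_char(2,3)[OF assms] by blast

lemma comm_group_limit_group: "comm_group limit_group"
proof (rule comm_groupI)
  show "\<one>\<^bsub>limit_group\<^esub> \<in> carrier limit_group"
    unfolding limit_group_one by (rule of_char(1)[OF family_char_0])
  fix x assume "x \<in> carrier limit_group"
  then obtain f where f: "family_char f" "x = of_char f"
    by (rule limit_group_cases)
  show "\<one>\<^bsub>limit_group\<^esub> \<otimes>\<^bsub>limit_group\<^esub> x = x"
    unfolding limit_group_one f(2) of_char_mult[OF family_char_0 f(1)] by simp
  show "\<exists>y\<in>carrier limit_group. y \<otimes>\<^bsub>limit_group\<^esub> x = \<one>\<^bsub>limit_group\<^esub>"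
    unfolding limit_group_one f(2) using family_char_uminus[OF f(1)]
    by (intro bexI[of _ "of_char (\<lambda>h. - f h)"] of_char(1)) (simp_all add: of_char_mult f(1))
  fix y assume "y \<in> carrier limit_group"
  then obtain g where g: "family_char g" "y = of_char g"
    by (rule limit_group_cases)
  show "x \<otimes>\<^bsub>limit_group\<^esub> y \<in> carrier limit_group"
    unfolding f(2) g(2) of_char_mult[OF f(1) g(1)] by (rule of_char(1)[OF family_char_add[OF f(1) g(1)]])
  show "x \<otimes>\<^bsub>limit_group\<^esub> y = y \<otimes>\<^bsub>limit_group\<^esub> x"
    unfolding f(2) g(2) of_char_mult[OF f(1) g(1)] of_char_mult[OF g(1) f(1)] by (simp add: add.commute)
  fix z assume "z \<in> carrier limit_group"
  then obtain k where k: "family_char k" "z = of_char k"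
    by (rule limit_group_cases)
  show "x \<otimes>\<^bsub>limit_group\<^esub> y \<otimes>\<^bsub>limit_group\<^esub> z = x \<otimes>\<^bsub>limit_group\<^esub> (y \<otimes>\<^bsub>limit_group\<^esub> z)"
    unfolding f(2) g(2) k(2)
    by (simp add: of_char_mult f(1) g(1) k(1) family_char_add add.assoc)
qed

section \<open>Class functions built from cyclic subgroups\<close>

text \<open>With s inverse to t modulo \<open>m\<close>, k = k^(ts) = h^s is a power of h. This
  removes the dependence of root counts on the subgroup.\<close>

lemma coprime_root_mem:
  assumes H: "H \<in> F" "h \<in> H" and k: "k \<in> D" "k [^] m = \<one>" "k [^] t = h" and t: "coprime t m" and m: "m \<ge> (2::nat)"
  shows "k \<in> H"
proof -
  obtain s where "[t * s = Suc 0] (mod m)"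
    using cong_solve_coprime_nat[OF t] by blast
  then have "(t * s) mod m = 1"
    using m by (simp add: cong_def)
  then have ts: "t * s = m * (t * s div m) + 1"
    using mult_div_mod_eq[of m "t * s"] by simp
  note kG = D_carrier[OF k(1)]
  have "k [^] (t * s) = k [^] (m * (t * s div m)) \<otimes> k [^] (1::nat)"
    using kG by (subst ts) (simp only: nat_pow_mult)
  also have "k [^] (m * (t * s div m)) = \<one>"
    using kG k(2) nat_pow_pow[OF kG, of m "t * s div m"] by simp
  finally have "k = (k [^] t) [^] s"
    using kG by (simp add: nat_pow_pow)
  then show ?thesis
    using pow_mem[OF H, of s] k(3) by simp
qed

text \<open>A multiple of the sum, over the conjugates \<open>k\<close> of \<open>\<gamma>\<close> in a member \<open>H\<close> of the family, of virtual characters induced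
  from \<open>\<langle>k\<rangle>\<close>. As only exponents coprime to \<open>m\<close> occur, \<open>k\<close> is a power of \<open>h\<close>, so the value does not depend on \<open>H\<close>.\<close>

definition root_char :: "nat \<Rightarrow> int \<Rightarrow> 'g \<Rightarrow> 'g \<Rightarrow> complex" where
  "root_char m b \<gamma> h = of_nat ((\<Prod>p | prime p \<and> p dvd m. p) * m) *
    (\<Sum>t | t < m \<and> coprime t m. root_unity m (b * int t) * of_nat (card {k \<in> cls \<gamma>. k [^] t = h}))"

lemma cls_D: "\<gamma> \<in> D \<Longrightarrow> k \<in> cls \<gamma> \<Longrightarrow> k \<in> D"
  unfolding cls_def using D_conj by blast

text \<open>Conjugation maps the t-th roots of h in \<open>cls \<gamma>\<close> bijectively to those
  of the conjugate of h. On a member \<open>H\<close> the function is a multiple of the one from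
  \<open>virtual_char_root_sum\<close> for the part of \<open>cls \<gamma>\<close> inside
  \<open>H\<close>.\<close>

lemma family_char_root_char:
  assumes m: "m \<ge> 2" "\<And>H. H \<in> F \<Longrightarrow> card H dvd m" "\<And>\<gamma>. \<gamma> \<in> D \<Longrightarrow> \<gamma> [^] m = \<one>" and \<gamma>: "\<gamma> \<in> D"
  shows "family_char (root_char m b \<gamma>)"
  unfolding family_char_def
proof (intro conjI ballI)
  fix h \<delta> assume h: "h \<in> D" and \<delta>: "\<delta> \<in> carrier G"
  have "card {k \<in> cls \<gamma>. k [^] t = \<delta> \<otimes> h \<otimes> inv \<delta>} = card {k \<in> cls \<gamma>. k [^] t = h}" for t :: nat
  proof (rule bij_betw_same_card[symmetric])
    have "bij_betw (\<lambda>k. \<delta> \<otimes> k \<otimes> inv \<delta>) {k \<in> cls \<gamma>. k [^] t = h}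
        ((\<lambda>k. \<delta> \<otimes> k \<otimes> inv \<delta>) ` {k \<in> cls \<gamma>. k [^] t = h})"
      using D_carrier[OF cls_D[OF \<gamma>]] by (intro inj_on_imp_bij_betw conj_inj[OF \<delta>]) blast
    also have "(\<lambda>k. \<delta> \<otimes> k \<otimes> inv \<delta>) ` {k \<in> cls \<gamma>. k [^] t = h} = {k \<in> cls \<gamma>. k [^] t = \<delta> \<otimes> h \<otimes> inv \<delta>}"
    proof (intro equalityI subsetI)
      fix x assume "x \<in> (\<lambda>k. \<delta> \<otimes> k \<otimes> inv \<delta>) ` {k \<in> cls \<gamma>. k [^] t = h}"
      then obtain k where k: "k \<in> cls \<gamma>" "k [^] t = h" "x = \<delta> \<otimes> k \<otimes> inv \<delta>"
        by blast
      note kG = D_carrier[OF cls_D[OF \<gamma> k(1)]]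
      show "x \<in> {k \<in> cls \<gamma>. k [^] t = \<delta> \<otimes> h \<otimes> inv \<delta>}"
        using k cls_conj[OF kG D_carrier[OF \<gamma>] \<delta>] conj_pow[OF \<delta> kG, of t] by simp
    next
      fix x assume "x \<in> {k \<in> cls \<gamma>. k [^] t = \<delta> \<otimes> h \<otimes> inv \<delta>}"
      then have x: "x \<in> cls \<gamma>" "x [^] t = \<delta> \<otimes> h \<otimes> inv \<delta>"
        by blast+
      note xG = D_carrier[OF cls_D[OF \<gamma> x(1)]]
      define k where "k = inv \<delta> \<otimes> x \<otimes> inv (inv \<delta>)"
      have kG: "k \<in> carrier G"
        using xG \<delta> by (simp add: k_def)
      have xk: "x = \<delta> \<otimes> k \<otimes> inv \<delta>"
        using conj_inverse[OF inv_closed[OF \<delta>] xG] \<delta> by (simp add: k_def)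
      have "k \<in> cls \<gamma>"
        using cls_conj[OF kG D_carrier[OF \<gamma>] \<delta>] x(1) xk by simp
      moreover have "k [^] t = h"
        unfolding k_def conj_pow[OF inv_closed[OF \<delta>] xG] x(2) by (rule conj_inverse[OF \<delta> D_carrier[OF h]])
      ultimately show "x \<in> (\<lambda>k. \<delta> \<otimes> k \<otimes> inv \<delta>) ` {k \<in> cls \<gamma>. k [^] t = h}"
        using xk by blast
    qed
    finally show "bij_betw (\<lambda>k. \<delta> \<otimes> k \<otimes> inv \<delta>) {k \<in> cls \<gamma>. k [^] t = h} {k \<in> cls \<gamma>. k [^] t = \<delta> \<otimes> h \<otimes> inv \<delta>}" .
  qed
  then show "root_char m b \<gamma> (\<delta> \<otimes> h \<otimes> inv \<delta>) = root_char m b \<gamma> h"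
    by (simp add: root_char_def)
next
  fix H assume H: "H \<in> F"
  interpret C: finite_group "sub H"
    by (rule sub_finite_group[OF H])
  define N :: nat where "N = (\<Prod>p | prime p \<and> p dvd m. p)"
  \<comment> \<open>The factor \<open>q\<close> replaces the order of \<open>H\<close> in the
    normalisation by \<open>m\<close>, which is the same for all members.\<close>
  obtain q where q: "m = card H * q"
    using m(2)[OF H] by blast
  have "C.virtual_char (\<lambda>h. of_nat ((\<Prod>p | prime p \<and> p dvd m. p) * order (sub H)) *
    (\<Sum>t | t < m \<and> coprime t m. root_unity m (b * int t) * of_nat (card {k \<in> cls \<gamma> \<inter> H. k [^]\<^bsub>sub H\<^esub> t = h})))"
  proof (rule C.virtual_char_root_sum)
    show "k [^]\<^bsub>sub H\<^esub> m = \<one>\<^bsub>sub H\<^esub>" if "k \<in> carrier (sub H)" for k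
      using m(3)[OF F_D[OF H]] that by (simp add: sub_pow)
    fix g k assume g: "g \<in> carrier (sub H)" and k: "k \<in> cls \<gamma> \<inter> H"
    then have gk: "g \<in> carrier G" "k \<in> carrier G" "g \<in> H"
      using F_carrier[OF H] by auto
    have "g \<otimes>\<^bsub>sub H\<^esub> k \<otimes>\<^bsub>sub H\<^esub> inv\<^bsub>sub H\<^esub> g = g \<otimes> k \<otimes> inv g"
      using m_inv_consistent[OF F_subgroup[OF H] gk(3)] by simp
    moreover have "g \<otimes> k \<otimes> inv g \<in> H"
      using subgroup.m_closed[OF F_subgroup[OF H]] subgroup.m_inv_closed[OF F_subgroup[OF H]] gk(3) k by simp
    ultimately show "g \<otimes>\<^bsub>sub H\<^esub> k \<otimes>\<^bsub>sub H\<^esub> inv\<^bsub>sub H\<^esub> g \<in> cls \<gamma> \<inter> H"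
      using cls_conj[OF gk(2) D_carrier[OF \<gamma>] gk(1)] k by simp
  qed (use m(1) in auto)
  then have vc: "C.virtual_char (\<lambda>h. of_nat q * (of_nat (N * order (sub H)) *
    (\<Sum>t | t < m \<and> coprime t m. root_unity m (b * int t) * of_nat (card {k \<in> cls \<gamma> \<inter> H. k [^]\<^bsub>sub H\<^esub> t = h}))))"
    unfolding N_def by (rule C.virtual_char_nat_mult)
  have "root_char m b \<gamma> h = of_nat q * (of_nat (N * order (sub H)) *
    (\<Sum>t | t < m \<and> coprime t m. root_unity m (b * int t) * of_nat (card {k \<in> cls \<gamma> \<inter> H. k [^]\<^bsub>sub H\<^esub> t = h})))"
    if h: "h \<in> carrier (sub H)" for h
  proof -
    \<comment> \<open>Roots for coprime exponents lie in \<open>H\<close> automatically, so counting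
      in \<open>H\<close> and counting in the whole group agree.\<close>
    have set_eq: "{k \<in> cls \<gamma> \<inter> H. k [^]\<^bsub>sub H\<^esub> t = h} = {k \<in> cls \<gamma>. k [^] t = h}" if "coprime t m" for t :: nat
    proof -
      have "k \<in> H" if "k \<in> cls \<gamma>" "k [^] t = h" for k
        by (rule coprime_root_mem[OF H _ cls_D[OF \<gamma> that(1)] m(3)[OF cls_D[OF \<gamma> that(1)]] that(2) \<open>coprime t m\<close> m(1)])
          (use h in simp)
      then show ?thesis
        by (auto simp: sub_pow)
    qed
    have "(\<Sum>t | t < m \<and> coprime t m. root_unity m (b * int t) * of_nat (card {k \<in> cls \<gamma> \<inter> H. k [^]\<^bsub>sub H\<^esub> t = h})) =
        (\<Sum>t | t < m \<and> coprime t m. root_unity m (b * int t) * of_nat (card {k \<in> cls \<gamma>. k [^] t = h}) :: complex)"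
    proof (rule sum.cong[OF refl])
      fix t assume "t \<in> {t. t < m \<and> coprime t m}"
      then have "coprime t m"
        by simp
      then show "root_unity m (b * int t) * of_nat (card {k \<in> cls \<gamma> \<inter> H. k [^]\<^bsub>sub H\<^esub> t = h}) =
          (root_unity m (b * int t) * of_nat (card {k \<in> cls \<gamma>. k [^] t = h}) :: complex)"
        by (simp only: set_eq)
    qed
    moreover have "of_nat (N * m) = (of_nat q * of_nat (N * order (sub H)) :: complex)"
      by (simp add: order_def q)
    ultimately show ?thesis
      unfolding root_char_def N_def[symmetric] by (simp only: mult.assoc)
  qed
  then show "C.virtual_char (root_char m b \<gamma>)"
    using C.virtual_char_cong[of "root_char m b \<gamma>"] vc by simp
qed

text \<open>Fourier inversion in the parameter \<open>b\<close> isolates t = 1, where the count of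
  roots is the indicator of the class of \<gamma>. Hence indicators of classes are complex
  combinations of elements of \<open>A\<close>.\<close>

lemma sum_root_char:
  assumes m: "m \<ge> 2" and h: "h \<in> carrier G" and \<gamma>: "\<gamma> \<in> D"
  shows "(\<Sum>a<m. root_unity m (- int a) * root_char m (int a) \<gamma> h) =
    (if h \<in> cls \<gamma> then of_nat ((\<Prod>p | prime p \<and> p dvd m. p) * m * m) else 0)"
proof -
  define K where "K = (\<Prod>p | prime p \<and> p dvd m. p) * m"
  define c where "c t = (of_nat (card {k \<in> cls \<gamma>. k [^] t = h}) :: complex)" for t :: nat
  let ?T = "{t. t < m \<and> coprime t m}"
  have "(\<Sum>a<m. root_unity m (- int a) * root_char m (int a) \<gamma> h) =
      (\<Sum>a<m. \<Sum>t\<in>?T. of_nat K * c t * root_unity m (int a * (int t - 1)))"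
  proof (intro sum.cong refl)
    fix a
    have "root_unity m (int a * (int t - 1)) = root_unity m (- int a) * root_unity m (int a * int t)" for t
      by (simp add: algebra_simps flip: root_unity_add)
    then show "root_unity m (- int a) * root_char m (int a) \<gamma> h =
        (\<Sum>t\<in>?T. of_nat K * c t * root_unity m (int a * (int t - 1)))"
      unfolding root_char_def K_def[symmetric] c_def by (simp add: sum_distrib_left mult_ac)
  qed
  also have "\<dots> = (\<Sum>t\<in>?T. of_nat K * c t * (\<Sum>a<m. root_unity m (int a * (int t - 1))))"
    by (subst sum.swap) (simp add: sum_distrib_left)
  also have "\<dots> = (\<Sum>t\<in>?T. if 1 = t then of_nat K * c 1 * of_nat m else 0)"
  proof (intro sum.cong refl)
    fix t assume t: "t \<in> ?T"
    have "int m dvd int t - 1 \<longleftrightarrow> 1 = t"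
    proof
      assume dvd: "int m dvd int t - 1"
      have "\<bar>int t - 1\<bar> < int m"
        using t m by auto
      then show "1 = t"
        using zdvd_imp_le[of "int m" "\<bar>int t - 1\<bar>"] dvd by (cases "int t - 1 = 0") auto
    qed auto
    then show "of_nat K * c t * (\<Sum>a<m. root_unity m (int a * (int t - 1))) = (if 1 = t then of_nat K * c 1 * of_nat m else 0)"
      using m by (auto simp: sum_root_unity)
  qed
  \<comment> \<open>The index 1 occurs in the sum because m \<ge> 2.\<close>
  also have "\<dots> = of_nat K * c 1 * of_nat m"
    using m by (subst sum.delta') auto
  also have "c 1 = (if h \<in> cls \<gamma> then 1 else 0)"
  proof -
    have "{k \<in> cls \<gamma>. k [^] (1::nat) = h} = (if h \<in> cls \<gamma> then {h} else {})"
      using D_carrier[OF cls_D[OF \<gamma>]] by auto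
    then show ?thesis
      by (simp add: c_def)
  qed
  finally show ?thesis
    by (simp add: K_def)
qed

section \<open>The rank of the inverse limit\<close>

lemma free_abelian_limit_group: "free_abelian_of_rank limit_group (card (cls ` D))"
proof -
  obtain m where m: "m \<ge> 2" "\<And>H. H \<in> F \<Longrightarrow> card H dvd m" "\<And>\<gamma>. \<gamma> \<in> D \<Longrightarrow> \<gamma> [^] m = \<one>"
    using common_exponent by blast
  have m0: "m > 0"
    using m(1) by simp
  define n where "n = card (cls ` D)"
  obtain q where q: "bij_betw q {..<n} (cls ` D)"
    unfolding n_def using bij_betw_from_nat_into_finite[OF finite_classes] by blast
  define rep where "rep i = (SOME \<gamma>. \<gamma> \<in> D \<and> cls \<gamma> = q i)" for i
  have rep: "rep i \<in> D \<and> cls (rep i) = q i" if "i < n" for i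
  proof -
    have "q i \<in> cls ` D"
      using bij_betwE[OF q] that by simp
    then have "\<exists>\<gamma>. \<gamma> \<in> D \<and> cls \<gamma> = q i"
      by auto
    then show ?thesis
      unfolding rep_def by (rule someI_ex)
  qed
  define ind where "ind \<gamma> = inv_into {..<n} q (cls \<gamma>)" for \<gamma>
  have ind: "ind \<gamma> < n" "q (ind \<gamma>) = cls \<gamma>" if "\<gamma> \<in> D" for \<gamma>
    using bij_betw_inv_into[OF q] bij_betwE that q unfolding ind_def
    by (force simp: bij_betw_def f_inv_into_f)+
  have ind_rep: "ind (rep i) = i" if "i < n" for i
    using rep[OF that] q that unfolding ind_def by (simp add: bij_betw_def)
  have rep_ind: "\<exists>\<delta>\<in>carrier G. \<gamma> = \<delta> \<otimes> rep (ind \<gamma>) \<otimes> inv \<delta>" if \<gamma>: "\<gamma> \<in> D" for \<gamma>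
  proof -
    have "\<gamma> \<in> cls (rep (ind \<gamma>))"
      using rep[OF ind(1)[OF \<gamma>]] ind(2)[OF \<gamma>] cls_self[OF D_carrier[OF \<gamma>]] by simp
    then show ?thesis
      unfolding cls_def by blast
  qed
  \<comment> \<open>Values at class representatives; nothing is lost, as \<open>fchar x\<close> is a
    class function.\<close>
  define \<Phi> where "\<Phi> x = (\<lambda>i. if i < n then fchar x (rep i) else 0)" for x
  have \<Phi>_ind: "\<Phi> x (ind \<gamma>) = fchar x \<gamma>" if x: "x \<in> carrier limit_group" and \<gamma>: "\<gamma> \<in> D" for x \<gamma>
  proof -
    obtain \<delta> where "\<delta> \<in> carrier G" "\<gamma> = \<delta> \<otimes> rep (ind \<gamma>) \<otimes> inv \<delta>"
      using rep_ind[OF \<gamma>] by blast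
    then have "fchar x \<gamma> = fchar x (rep (ind \<gamma>))"
      using limit_group_char(2)[OF x] rep[OF ind(1)[OF \<gamma>]] unfolding family_char_def by metis
    then show ?thesis
      using ind(1)[OF \<gamma>] by (simp add: \<Phi>_def)
  qed
  have \<Phi>_of_char: "\<Phi> (of_char f) = (\<lambda>i. if i < n then f (rep i) else 0)" if "family_char f" for f
    unfolding \<Phi>_def using of_char(2)[OF that] rep by auto
  \<comment> \<open>The index \<open>k\<close> encodes a pair: \<open>k div m\<close> selects the
    class representative and \<open>k mod m\<close> the eigenvalue \<zeta>^(k mod m) whose
    multiplicity is taken. The powers of the representative are looked up through their classes, so
    this is a functional of \<open>v\<close>.\<close>
  define \<psi> where "\<psi> k v = (1 / of_nat m) *
    (\<Sum>s<m. root_unity m (- (int (k mod m) * int s)) * v (ind (rep (k div m) [^] s)))" for k and v :: "nat \<Rightarrow> complex"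
  show ?thesis
    unfolding n_def[symmetric]
  proof (rule free_abelian_of_rankI[where \<Phi> = \<Phi> and \<psi> = \<psi> and M = "n * m"])
    show "comm_group limit_group"
      by (rule comm_group_limit_group)
    show "\<Phi> (x \<otimes>\<^bsub>limit_group\<^esub> y) = \<Phi> x + \<Phi> y" if "x \<in> carrier limit_group" "y \<in> carrier limit_group" for x y
    proof -
      obtain f where f: "family_char f" "x = of_char f"
        using \<open>x \<in> carrier limit_group\<close> by (rule limit_group_cases)
      obtain g where g: "family_char g" "y = of_char g"
        using \<open>y \<in> carrier limit_group\<close> by (rule limit_group_cases)
      show ?thesis
        unfolding f(2) g(2) of_char_mult[OF f(1) g(1)] \<Phi>_of_char[OF f(1)] \<Phi>_of_char[OF g(1)]
          \<Phi>_of_char[OF family_char_add[OF f(1) g(1)]]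
        by (auto simp: fun_eq_iff plus_fun_apply)
    qed
    show "inj_on \<Phi> (carrier limit_group)"
    proof (rule inj_onI)
      fix x y assume x: "x \<in> carrier limit_group" and y: "y \<in> carrier limit_group" and eq: "\<Phi> x = \<Phi> y"
      have "fchar x \<gamma> = fchar y \<gamma>" if "\<gamma> \<in> D" for \<gamma>
        using \<Phi>_ind[OF x that] \<Phi>_ind[OF y that] eq by simp
      then have "of_char (fchar x) = of_char (fchar y)"
        by (rule of_char_cong)
      then show "x = y"
        using limit_group_char(3)[OF x] limit_group_char(3)[OF y] by (rule_tac trans[OF _ trans[OF _ sym]])
    qed
    show "\<Phi> x i = 0" if "i \<ge> n" for x i
      using that by (simp add: \<Phi>_def)
    show "\<psi> i (u + v) = \<psi> i u + \<psi> i v" for i u v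
      by (simp add: \<psi>_def plus_fun_apply ring_distribs sum.distrib)
    show "\<psi> i (scl c v) = c * \<psi> i v" for i c v
      by (simp add: \<psi>_def scl_apply sum_distrib_left mult_ac)
    have \<psi>_fchar: "\<psi> k (\<Phi> x) = (1 / of_nat m) *
        (\<Sum>s<m. root_unity m (- (int (k mod m) * int s)) * fchar x (rep (k div m) [^] s))"
      if "k < n * m" "x \<in> carrier limit_group" for k x
    proof -
      have "k div m < n"
        using that(1) m0 by (simp add: less_mult_imp_div_less)
      then show ?thesis
        unfolding \<psi>_def using \<Phi>_ind[OF that(2) D_pow] rep by simp
    qed
    show "\<psi> k (\<Phi> x) \<in> \<int>" if k: "k < n * m" and x: "x \<in> carrier limit_group" for k x
    proof -
      have i: "k div m < n"
        using k m0 by (simp add: less_mult_imp_div_less)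
      let ?\<gamma> = "rep (k div m)"
      have \<gamma>: "?\<gamma> \<in> D"
        using rep[OF i] by blast
      interpret C: finite_group "sub (cyc ?\<gamma>)"
        by (rule sub_finite_group[OF cyc_F[OF \<gamma>]])
      have "C.virtual_char (fchar x)"
        using limit_group_char(2)[OF x] cyc_F[OF \<gamma>] unfolding family_char_def by blast
      then obtain j :: int where "(1 / of_nat m) * (\<Sum>s<m. root_unity m (- (int (k mod m) * int s)) * fchar x (?\<gamma> [^]\<^bsub>sub (cyc ?\<gamma>)\<^esub> s)) = of_int j"
        using C.virtual_char_multiplicity_int[of "fchar x" ?\<gamma> m "k mod m"] cyc_in[of ?\<gamma>] m0 m(3)[OF \<gamma>] by (auto simp: sub_pow)
      then have "\<psi> k (\<Phi> x) = of_int j"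
        unfolding \<psi>_fchar[OF k x] sub_pow .
      then show ?thesis by simp
    qed
    show "\<Phi> x = 0" if x: "x \<in> carrier limit_group" and zero: "\<And>k. k < n * m \<Longrightarrow> \<psi> k (\<Phi> x) = 0" for x
    proof
      fix i
      show "\<Phi> x i = 0 i"
      proof (cases "i < n")
        case True
        let ?\<gamma> = "rep i"
        have \<gamma>: "?\<gamma> \<in> D"
          using rep[OF True] by blast
        define f where "f s = fchar x (?\<gamma> [^] s)" for s :: nat
        have per: "f (t + m) = f t" for t
        proof -
          have "?\<gamma> [^] (t + m) = ?\<gamma> [^] t"
            using D_carrier[OF \<gamma>] m(3)[OF \<gamma>] nat_pow_mult[OF D_carrier[OF \<gamma>], of t m] by simp
          then show ?thesis by (simp add: f_def)
        qed
        \<comment> \<open>At t = 1 the inversion expresses the value at the representative through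
          its multiplicities, all of which vanish.\<close>
        from fourier_inversion[where f = f and t = 1, OF m0 per]
        have "f 1 = (\<Sum>a<m. root_unity m (int a * int 1) * ((1 / of_nat m) * (\<Sum>s<m. root_unity m (- (int a * int s)) * f s)))"
          by (rule sym)
        also have "\<dots> = (\<Sum>a<m. 0)"
        proof (rule sum.cong[OF refl])
          fix a assume a: "a \<in> {..<m}"
          have "i * m + a < n * m"
          proof -
            have "i * m + a < Suc i * m"
              using a by simp
            also have "\<dots> \<le> n * m"
              using True by (intro mult_right_mono) auto
            finally show ?thesis .
          qed
          from zero[OF this] have "(1 / of_nat m) * (\<Sum>s<m. root_unity m (- (int a * int s)) * f s) = 0"
            unfolding \<psi>_fchar[OF \<open>i * m + a < n * m\<close> x] f_def using a by simp
          then show "root_unity m (int a * int 1) * ((1 / of_nat m) * (\<Sum>s<m. root_unity m (- (int a * int s)) * f s)) = 0"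
            by (simp only: mult_zero_right)
        qed
        finally have "fchar x ?\<gamma> = 0"
          using D_carrier[OF \<gamma>] by (simp add: f_def)
        then show ?thesis
          using True by (simp add: \<Phi>_def zero_fun_apply)
      qed (simp add: \<Phi>_def zero_fun_apply)
    qed
    show "unit_vec i \<in> cvec.span (\<Phi> ` carrier limit_group)" if i: "i < n" for i
    proof -
      let ?\<gamma> = "rep i"
      have \<gamma>: "?\<gamma> \<in> D"
        using rep[OF i] by blast
      define K where "K = (\<Prod>p | prime p \<and> p dvd m. p) * m * m"
      have "K > 0"
        using m0 by (auto simp: K_def prime_gt_0_nat intro!: prod_pos)
      note fc = family_char_root_char[OF m \<gamma>]
      \<comment> \<open>In coordinates \<open>unit_vec i\<close> is the indicator of the i-th class;
        \<open>K\<close> is the constant produced by \<open>sum_root_char\<close>.\<close>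
      have "unit_vec i = (\<Sum>a<m. scl (root_unity m (- int a) / of_nat K) (\<Phi> (of_char (root_char m (int a) ?\<gamma>))))"
      proof
        fix j
        show "unit_vec i j = (\<Sum>a<m. scl (root_unity m (- int a) / of_nat K) (\<Phi> (of_char (root_char m (int a) ?\<gamma>)))) j"
        proof (cases "j < n")
          case True
          have "rep j \<in> cls ?\<gamma> \<longleftrightarrow> j = i"
          proof
            assume "rep j \<in> cls ?\<gamma>"
            then obtain \<delta> where "\<delta> \<in> carrier G" "rep j = \<delta> \<otimes> ?\<gamma> \<otimes> inv \<delta>"
              unfolding cls_def by blast
            then have "cls (rep j) = cls ?\<gamma>"
              using cls_eq[OF D_carrier[OF \<gamma>]] by simp
            then show "j = i"
              using ind_rep[OF True] ind_rep[OF i] by (simp add: ind_def)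
          qed (use cls_self[OF D_carrier[OF \<gamma>]] in simp)
          then have "(\<Sum>a<m. root_unity m (- int a) * root_char m (int a) ?\<gamma> (rep j)) = (if j = i then of_nat K else 0)"
            using sum_root_char[OF m(1) D_carrier \<gamma>, of "rep j"] rep[OF True] by (simp add: K_def)
          then have "(if j = i then 1 else 0) = (\<Sum>a<m. root_unity m (- int a) * root_char m (int a) ?\<gamma> (rep j)) / of_nat K"
            using \<open>K > 0\<close> by simp
          also have "\<dots> = (\<Sum>a<m. scl (root_unity m (- int a) / of_nat K) (\<Phi> (of_char (root_char m (int a) ?\<gamma>)))) j"
            using True by (simp add: \<Phi>_of_char[OF fc] sum_fun_apply scl_apply sum_divide_distrib)
          finally show ?thesis by simp
        next
          case False
          then show ?thesis
            using i by (simp add: \<Phi>_of_char[OF fc] sum_fun_apply scl_apply)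
        qed
      qed
      also have "\<dots> \<in> cvec.span (\<Phi> ` carrier limit_group)"
        by (intro cvec.span_sum cvec.span_scale cvec.span_base imageI of_char(1) fc)
      finally show ?thesis .
    qed
  qed
qed

end

theorem proposition2p4:
  fixes \<Gamma> :: "('g, 'x) monoid_scheme" and F :: "'g set set"
  assumes "group \<Gamma>"
    and "finitely_many_finite_subgroups_up_to_conj \<Gamma>"
    and "family_of_finite_subgroups \<Gamma> F"
  shows "finite (family_conj_classes \<Gamma> F) \<and>
    free_abelian_of_rank (family_rep_group TYPE(complex) \<Gamma> F) (card (family_conj_classes \<Gamma> F))"
proof -
  interpret finite_subgroup_family \<Gamma> F
    using assms by (intro finite_subgroup_family.intro finite_subgroup_family_axioms.intro)
  show ?thesis
    unfolding family_conj_classes_eq using finite_classes free_abelian_limit_group by blast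
qed

end
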